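(* Let $K$ be a field, $S=K[x_1,\ldots,x_n]$ with the standard grading, and $A=K[x_1,\ldots,x_n,y_1,\ldots,y_m]$ with the bigrading $\deg x_i=(1,0)$ and $\deg y_j=(p_j,1)$, where the $p_j\ge0$ are integers. Let $M$ be a finitely generated graded $S$-module and $N$ a finitely generated bigraded $A$-module. Then, for each $i$, the Krull dimensions of the finitely generated graded $S$-modules $\operatorname{Tor}^S_i(M,N)_k$ and $\operatorname{Ext}^i_S(M,N)_k$ are constant for $k\gg0$.
   Context: For a bigraded $A$-module $L=\bigoplus_{i,j\in\mathbb{Z}}L_{(i,j)}$, $L_k$ denotes the graded $S$-module $\bigoplus_{i\in\mathbb{Z}}L_{(i,k)}$. The modules $\operatorname{Tor}^S_i(M,N)$ and $\operatorname{Ext}^i_S(M,N)$ are bigraded $A$-modules with the structure induced from the following bigradings: for a finitely generated graded $S$-module $U$ and a finitely generated bigraded $A$-module $V$, $(U\otimes_S V)_{(c,d)}$ is generated by the images of $U_k\otimes_K V_{(c-k,d)}$, $k\in\mathbb{Z}$, and $\operatorname{Hom}_S(U,V)_{(c,d)}=\{f\in\operatorname{Hom}_S(U,V): f(U_i)\subset V_{(i+c,d)}\text{ for all }i\}$. One has $\operatorname{Tor}^S_i(M,N)_k\cong\operatorname{Tor}^S_i(M,N_k)$ and $\operatorname{Ext}^i_S(M,N)_k\cong\operatorname{Ext}^i_S(M,N_k)$. *)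

theory Defs
  imports
    "HOL-Algebra.Algebra"
    "HOL-Library.Poly_Mapping"
    "HOL-Library.Product_Plus"
    "HOL-Library.Extended_Real"
begin

section \<open>The polynomial rings \<open>S\<close> and \<open>A\<close>\<close>

datatype pvar = VarX nat | VarY nat

type_synonym 'k mpoly = "(pvar \<Rightarrow>\<^sub>0 nat) \<Rightarrow>\<^sub>0 'k"

text \<open>All polynomial rings live in one type, so that \<open>S\<close> is literally a subring of \<open>A\<close>
  and every \<open>A\<close>-module record is also an \<open>S\<close>-module record.\<close>

definition poly_ring :: "pvar set \<Rightarrow> ('k::field) mpoly ring" where
  "poly_ring V = \<lparr>carrier = {f. \<forall>t\<in>Poly_Mapping.keys f. Poly_Mapping.keys t \<subseteq> V},
     monoid.mult = (*), one = 1, ring.zero = 0, add = (+)\<rparr>"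

definition polyS :: "nat \<Rightarrow> ('k::field) mpoly ring" where
  "polyS n = poly_ring (VarX ` {1..n})"

definition polyA :: "nat \<Rightarrow> nat \<Rightarrow> ('k::field) mpoly ring" where
  "polyA n m = poly_ring (VarX ` {1..n} \<union> VarY ` {1..m})"

definition mon_deg :: "(pvar \<Rightarrow> int) \<Rightarrow> (pvar \<Rightarrow>\<^sub>0 nat) \<Rightarrow> int" where
  "mon_deg w t = (\<Sum>v\<in>Poly_Mapping.keys t. int (Poly_Mapping.lookup t v) * w v)"

primrec var_bideg :: "(nat \<Rightarrow> nat) \<Rightarrow> pvar \<Rightarrow> int \<times> int" where
  "var_bideg p (VarX i) = (1, 0)"
| "var_bideg p (VarY j) = (int (p j), 1)"

definition polyS_comp :: "nat \<Rightarrow> int \<Rightarrow> ('k::field) mpoly set" where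
  "polyS_comp n a =
     {f \<in> carrier (polyS n). \<forall>t\<in>Poly_Mapping.keys f. mon_deg (\<lambda>_. 1) t = a}"

definition polyA_comp :: "nat \<Rightarrow> nat \<Rightarrow> (nat \<Rightarrow> nat) \<Rightarrow> int \<times> int \<Rightarrow> ('k::field) mpoly set" where
  "polyA_comp n m p g =
     {f \<in> carrier (polyA n m). \<forall>t\<in>Poly_Mapping.keys f.
        (mon_deg (fst \<circ> var_bideg p) t, mon_deg (snd \<circ> var_bideg p) t) = g}"


section \<open>Graded modules\<close>

text \<open>\<open>RG\<close> and \<open>MG\<close> are the families of homogeneous components of the ring and the module.
  The last axiom says that the module is the internal direct sum of its components.\<close>

locale graded_module = Module.module R M
  for R :: "('a, 'c) ring_scheme" (structure) and M :: "('a, 'b, 'd) module_scheme" (structure)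
    and RG :: "'g::ab_group_add \<Rightarrow> 'a set" and MG :: "'g \<Rightarrow> 'b set" +
  assumes comp_subgroup: "subgroup (MG g) (add_monoid M)"
    and comp_smult: "\<lbrakk>a \<in> RG g; x \<in> MG h\<rbrakk> \<Longrightarrow> a \<odot>\<^bsub>M\<^esub> x \<in> MG (g + h)"
    and direct_sum: "x \<in> carrier M \<Longrightarrow>
      \<exists>!c. (\<forall>g. c g \<in> MG g) \<and> finite {g. c g \<noteq> \<zero>\<^bsub>M\<^esub>} \<and> x = (\<Oplus>\<^bsub>M\<^esub>g\<in>{g. c g \<noteq> \<zero>\<^bsub>M\<^esub>}. c g)"

definition fin_gen :: "('a, 'c) ring_scheme \<Rightarrow> ('a, 'b, 'd) module_scheme \<Rightarrow> bool" where
  "fin_gen R M \<longleftrightarrow> (\<exists>G. finite G \<and> G \<subseteq> carrier M \<and>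
     \<Inter>{H. submodule H R M \<and> G \<subseteq> H} = carrier M)"

definition linear_map ::
  "('a, 'c) ring_scheme \<Rightarrow> ('a, 'u, 'd) module_scheme \<Rightarrow> ('a, 'v, 'e) module_scheme \<Rightarrow> ('u \<Rightarrow> 'v) \<Rightarrow> bool"
  where "linear_map R U V f \<longleftrightarrow> f \<in> hom (add_monoid U) (add_monoid V) \<and>
     (\<forall>r\<in>carrier R. \<forall>u\<in>carrier U. f (r \<odot>\<^bsub>U\<^esub> u) = r \<odot>\<^bsub>V\<^esub> f u)"

definition graded_free_fin ::
  "('a, 'c) ring_scheme \<Rightarrow> ('g::ab_group_add \<Rightarrow> 'a set) \<Rightarrow> ('a, 'f, 'd) module_scheme \<Rightarrow> ('g \<Rightarrow> 'f set) \<Rightarrow> bool"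
  where "graded_free_fin R RG F FG \<longleftrightarrow> graded_module R F RG FG \<and>
     (\<exists>B. finite B \<and> B \<subseteq> (\<Union>g. FG g) \<and>
        (\<forall>x\<in>carrier F. \<exists>!c. c \<in> B \<rightarrow>\<^sub>E carrier R \<and> x = (\<Oplus>\<^bsub>F\<^esub>b\<in>B. c b \<odot>\<^bsub>F\<^esub> b)))"

text \<open>An exact sequence
  \<open>\<dots> \<rightarrow> F 2 \<rightarrow> F 1 \<rightarrow> F 0 \<rightarrow> M \<rightarrow> 0\<close> of degree-preserving maps, with \<open>d i : F (i+1) \<rightarrow> F i\<close>,
  where all \<open>F i\<close> are free of finite rank on homogeneous bases.\<close>

locale graded_free_resolution =
  fixes R :: "('a, 'c) ring_scheme" and RG :: "int \<Rightarrow> 'a set"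
    and M :: "('a, 'b, 'e) module_scheme" and MG :: "int \<Rightarrow> 'b set"
    and F :: "nat \<Rightarrow> ('a, 'f) module" and FG :: "nat \<Rightarrow> int \<Rightarrow> 'f set"
    and d :: "nat \<Rightarrow> 'f \<Rightarrow> 'f" and eps :: "'f \<Rightarrow> 'b"
  assumes free: "graded_free_fin R RG (F i) (FG i)"
    and d_linear: "linear_map R (F (Suc i)) (F i) (d i)"
    and d_degree: "d i ` FG (Suc i) g \<subseteq> FG i g"
    and eps_linear: "linear_map R (F 0) M eps"
    and eps_degree: "eps ` FG 0 g \<subseteq> MG g"
    and eps_surj: "eps ` carrier (F 0) = carrier M"
    and exact_0: "d 0 ` carrier (F (Suc 0)) = a_kernel (F 0) M eps"
    and exact_Suc: "d (Suc i) ` carrier (F (Suc (Suc i))) = a_kernel (F (Suc i)) (F i) (d i)"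

text \<open>The module \<open>Z / B\<close> for submodules \<open>B \<subseteq> Z\<close> of \<open>M\<close>. The ring fields of a module record
  that play no role for modules are left undefined, here and below.\<close>

definition subquotient :: "('a, 'b, 'd) module_scheme \<Rightarrow> 'b set \<Rightarrow> 'b set \<Rightarrow> ('a, 'b set) module" where
  "subquotient M Z B = \<lparr>carrier = (\<lambda>z. B +>\<^bsub>M\<^esub> z) ` Z,
     monoid.mult = undefined, one = undefined, ring.zero = B, add = set_add M,
     smult = (\<lambda>a C. \<Union>x\<in>C. B +>\<^bsub>M\<^esub> (a \<odot>\<^bsub>M\<^esub> x))\<rparr>"


section \<open>Tensor products and Tor\<close>

text \<open>\<open>U \<otimes>\<^sub>R V\<close> is the free abelian group on \<open>U \<times> V\<close> modulo the usual bilinearity relations.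
  Scalars act through the second factor, so that \<open>U \<otimes>\<^sub>R V\<close> is a module over every commutative
  ring containing \<open>R\<close> over which \<open>V\<close> is a module.\<close>

definition tensor_null ::
  "('a, 'c) ring_scheme \<Rightarrow> ('a, 'u, 'd) module_scheme \<Rightarrow> ('a, 'v, 'e) module_scheme \<Rightarrow> ('u \<times> 'v \<Rightarrow>\<^sub>0 int) set"
  where "tensor_null R U V = generate (free_Abelian_group (carrier U \<times> carrier V))
     ({frag_of (u \<oplus>\<^bsub>U\<^esub> u', v) - frag_of (u, v) - frag_of (u', v) | u u' v.
         u \<in> carrier U \<and> u' \<in> carrier U \<and> v \<in> carrier V}
    \<union> {frag_of (u, v \<oplus>\<^bsub>V\<^esub> v') - frag_of (u, v) - frag_of (u, v') | u v v'.
         u \<in> carrier U \<and> v \<in> carrier V \<and> v' \<in> carrier V}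
    \<union> {frag_of (r \<odot>\<^bsub>U\<^esub> u, v) - frag_of (u, r \<odot>\<^bsub>V\<^esub> v) | r u v.
         r \<in> carrier R \<and> u \<in> carrier U \<and> v \<in> carrier V})"

definition tensor_class ::
  "('a, 'c) ring_scheme \<Rightarrow> ('a, 'u, 'd) module_scheme \<Rightarrow> ('a, 'v, 'e) module_scheme
    \<Rightarrow> ('u \<times> 'v \<Rightarrow>\<^sub>0 int) \<Rightarrow> ('u \<times> 'v \<Rightarrow>\<^sub>0 int) set"
  where "tensor_class R U V c =
     tensor_null R U V #>\<^bsub>free_Abelian_group (carrier U \<times> carrier V)\<^esub> c"

definition tensor ::
  "('a, 'c) ring_scheme \<Rightarrow> ('a, 'u, 'd) module_scheme \<Rightarrow> ('a, 'v, 'e) module_scheme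
    \<Rightarrow> ('a, ('u \<times> 'v \<Rightarrow>\<^sub>0 int) set) module"
  where "tensor R U V = \<lparr>
     carrier = rcosets\<^bsub>free_Abelian_group (carrier U \<times> carrier V)\<^esub> (tensor_null R U V),
     monoid.mult = undefined, one = undefined,
     ring.zero = tensor_null R U V,
     add = set_mult (free_Abelian_group (carrier U \<times> carrier V)),
     smult = (\<lambda>a C. \<Union>c\<in>C. tensor_class R U V (frag_extend (\<lambda>(u, v). frag_of (u, a \<odot>\<^bsub>V\<^esub> v)) c))\<rparr>"

text \<open>The map \<open>f \<otimes> id : U \<otimes> V \<rightarrow> U' \<otimes> V\<close> induced by \<open>f : U \<rightarrow> U'\<close>.\<close>

definition tensor_map ::
  "('a, 'c) ring_scheme \<Rightarrow> ('a, 'u', 'd) module_scheme \<Rightarrow> ('a, 'v, 'e) module_scheme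
    \<Rightarrow> ('u \<Rightarrow> 'u') \<Rightarrow> ('u \<times> 'v \<Rightarrow>\<^sub>0 int) set \<Rightarrow> ('u' \<times> 'v \<Rightarrow>\<^sub>0 int) set"
  where "tensor_map R U' V f C =
     (\<Union>c\<in>C. tensor_class R U' V (frag_extend (\<lambda>(u, v). frag_of (f u, v)) c))"

definition tensor_comp ::
  "('a, 'c) ring_scheme \<Rightarrow> ('a, 'u, 'd) module_scheme \<Rightarrow> (int \<Rightarrow> 'u set)
    \<Rightarrow> ('a, 'v, 'e) module_scheme \<Rightarrow> (int \<times> int \<Rightarrow> 'v set)
    \<Rightarrow> int \<times> int \<Rightarrow> ('u \<times> 'v \<Rightarrow>\<^sub>0 int) set set"
  where "tensor_comp R U UG V VG = (\<lambda>(c, d). generate (add_monoid (tensor R U V))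
     {tensor_class R U V (frag_of (u, v)) | u v k. u \<in> UG k \<and> v \<in> VG (c - k, d)})"

text \<open>\<open>Tor\<^sub>i(M, N)\<close> is the homology of \<open>F \<otimes>\<^sub>R N\<close> for a free resolution \<open>(F, d)\<close> of \<open>M\<close>.\<close>

definition Tor_cycles ::
  "('a, 'c) ring_scheme \<Rightarrow> (nat \<Rightarrow> ('a, 'f) module) \<Rightarrow> (nat \<Rightarrow> 'f \<Rightarrow> 'f) \<Rightarrow> ('a, 'v) module
    \<Rightarrow> nat \<Rightarrow> ('f \<times> 'v \<Rightarrow>\<^sub>0 int) set set"
  where "Tor_cycles R F d N i = (case i of
       0 \<Rightarrow> carrier (tensor R (F 0) N)
     | Suc j \<Rightarrow> a_kernel (tensor R (F (Suc j)) N) (tensor R (F j) N) (tensor_map R (F j) N (d j)))"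

definition Tor_boundaries ::
  "('a, 'c) ring_scheme \<Rightarrow> (nat \<Rightarrow> ('a, 'f) module) \<Rightarrow> (nat \<Rightarrow> 'f \<Rightarrow> 'f) \<Rightarrow> ('a, 'v) module
    \<Rightarrow> nat \<Rightarrow> ('f \<times> 'v \<Rightarrow>\<^sub>0 int) set set"
  where "Tor_boundaries R F d N i =
     tensor_map R (F i) N (d i) ` carrier (tensor R (F (Suc i)) N)"

definition Tor ::
  "('a, 'c) ring_scheme \<Rightarrow> (nat \<Rightarrow> ('a, 'f) module) \<Rightarrow> (nat \<Rightarrow> 'f \<Rightarrow> 'f) \<Rightarrow> ('a, 'v) module
    \<Rightarrow> nat \<Rightarrow> ('a, ('f \<times> 'v \<Rightarrow>\<^sub>0 int) set set) module"
  where "Tor R F d N i =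
     subquotient (tensor R (F i) N) (Tor_cycles R F d N i) (Tor_boundaries R F d N i)"

definition Tor_comp ::
  "('a, 'c) ring_scheme \<Rightarrow> (nat \<Rightarrow> ('a, 'f) module) \<Rightarrow> (nat \<Rightarrow> int \<Rightarrow> 'f set) \<Rightarrow> (nat \<Rightarrow> 'f \<Rightarrow> 'f)
    \<Rightarrow> ('a, 'v) module \<Rightarrow> (int \<times> int \<Rightarrow> 'v set)
    \<Rightarrow> nat \<Rightarrow> int \<times> int \<Rightarrow> ('f \<times> 'v \<Rightarrow>\<^sub>0 int) set set set"
  where "Tor_comp R F FG d N NG i g =
     (\<lambda>z. Tor_boundaries R F d N i +>\<^bsub>tensor R (F i) N\<^esub> z) `
       (Tor_cycles R F d N i \<inter> tensor_comp R (F i) (FG i) N NG g)"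


section \<open>Hom and Ext\<close>

definition hom_module ::
  "('a, 'c) ring_scheme \<Rightarrow> ('a, 'u, 'd) module_scheme \<Rightarrow> ('a, 'v, 'e) module_scheme
    \<Rightarrow> ('a, 'u \<Rightarrow> 'v) module"
  where "hom_module R U V = \<lparr>
     carrier = {f \<in> extensional (carrier U). linear_map R U V f},
     monoid.mult = undefined, one = undefined,
     ring.zero = (\<lambda>u\<in>carrier U. \<zero>\<^bsub>V\<^esub>),
     add = (\<lambda>f g. \<lambda>u\<in>carrier U. f u \<oplus>\<^bsub>V\<^esub> g u),
     smult = (\<lambda>a f. \<lambda>u\<in>carrier U. a \<odot>\<^bsub>V\<^esub> f u)\<rparr>"

definition hom_comp ::
  "('a, 'c) ring_scheme \<Rightarrow> ('a, 'u, 'd) module_scheme \<Rightarrow> (int \<Rightarrow> 'u set)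
    \<Rightarrow> ('a, 'v, 'e) module_scheme \<Rightarrow> (int \<times> int \<Rightarrow> 'v set) \<Rightarrow> int \<times> int \<Rightarrow> ('u \<Rightarrow> 'v) set"
  where "hom_comp R U UG V VG = (\<lambda>(c, d).
     {f \<in> carrier (hom_module R U V). \<forall>i. f ` UG i \<subseteq> VG (i + c, d)})"

text \<open>\<open>Ext\<^sup>i(M, N)\<close> is the cohomology of \<open>Hom\<^sub>R(F, N)\<close> for a free resolution \<open>(F, d)\<close> of \<open>M\<close>;
  the differentials are precomposition with \<open>d\<close>.\<close>

definition Ext_cocycles ::
  "('a, 'c) ring_scheme \<Rightarrow> (nat \<Rightarrow> ('a, 'f) module) \<Rightarrow> (nat \<Rightarrow> 'f \<Rightarrow> 'f) \<Rightarrow> ('a, 'v) module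
    \<Rightarrow> nat \<Rightarrow> ('f \<Rightarrow> 'v) set"
  where "Ext_cocycles R F d N i =
     a_kernel (hom_module R (F i) N) (hom_module R (F (Suc i)) N)
       (\<lambda>f. compose (carrier (F (Suc i))) f (d i))"

definition Ext_coboundaries ::
  "('a, 'c) ring_scheme \<Rightarrow> (nat \<Rightarrow> ('a, 'f) module) \<Rightarrow> (nat \<Rightarrow> 'f \<Rightarrow> 'f) \<Rightarrow> ('a, 'v) module
    \<Rightarrow> nat \<Rightarrow> ('f \<Rightarrow> 'v) set"
  where "Ext_coboundaries R F d N i = (case i of
       0 \<Rightarrow> {\<zero>\<^bsub>hom_module R (F 0) N\<^esub>}
     | Suc j \<Rightarrow> (\<lambda>f. compose (carrier (F (Suc j))) f (d j)) ` carrier (hom_module R (F j) N))"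

definition Ext ::
  "('a, 'c) ring_scheme \<Rightarrow> (nat \<Rightarrow> ('a, 'f) module) \<Rightarrow> (nat \<Rightarrow> 'f \<Rightarrow> 'f) \<Rightarrow> ('a, 'v) module
    \<Rightarrow> nat \<Rightarrow> ('a, ('f \<Rightarrow> 'v) set) module"
  where "Ext R F d N i =
     subquotient (hom_module R (F i) N) (Ext_cocycles R F d N i) (Ext_coboundaries R F d N i)"

definition Ext_comp ::
  "('a, 'c) ring_scheme \<Rightarrow> (nat \<Rightarrow> ('a, 'f) module) \<Rightarrow> (nat \<Rightarrow> int \<Rightarrow> 'f set) \<Rightarrow> (nat \<Rightarrow> 'f \<Rightarrow> 'f)
    \<Rightarrow> ('a, 'v) module \<Rightarrow> (int \<times> int \<Rightarrow> 'v set) \<Rightarrow> nat \<Rightarrow> int \<times> int \<Rightarrow> ('f \<Rightarrow> 'v) set set"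
  where "Ext_comp R F FG d N NG i g =
     (\<lambda>z. Ext_coboundaries R F d N i +>\<^bsub>hom_module R (F i) N\<^esub> z) `
       (Ext_cocycles R F d N i \<inter> hom_comp R (F i) (FG i) N NG g)"


section \<open>Strands and Krull dimension\<close>

text \<open>\<open>L\<^sub>k = \<Oplus>\<^sub>i L\<^bsub>(i,k)\<^esub>\<close> for a bigraded module \<open>L\<close> with components \<open>LG\<close>.\<close>

definition strand ::
  "('a, 'b, 'd) module_scheme \<Rightarrow> (int \<times> int \<Rightarrow> 'b set) \<Rightarrow> int \<Rightarrow> ('a, 'b, 'd) module_scheme" where
  "strand L LG k = L\<lparr>carrier := generate (add_monoid L) (\<Union>i. LG (i, k))\<rparr>"

text \<open>The supremum of the lengths of chains of prime ideals; the zero ring gets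
  \<open>Sup {} = -\<infinity>\<close>.\<close>

definition krull_dim :: "('a, 'c) ring_scheme \<Rightarrow> ereal" where
  "krull_dim R = Sup {ereal (real l) | l P.
     (\<forall>i\<le>l. primeideal (P i) R) \<and> (\<forall>i<l. P i \<subset> P (Suc i))}"

definition annihilator :: "('a, 'c) ring_scheme \<Rightarrow> ('a, 'b, 'd) module_scheme \<Rightarrow> 'a set" where
  "annihilator R L = {r \<in> carrier R. \<forall>x\<in>carrier L. r \<odot>\<^bsub>L\<^esub> x = \<zero>\<^bsub>L\<^esub>}"

definition module_dim :: "('a, 'c) ring_scheme \<Rightarrow> ('a, 'b, 'd) module_scheme \<Rightarrow> ereal" where
  "module_dim R L = krull_dim (R Quot annihilator R L)"

end

theory Submission
  imports Defs
begin

text \<open>Tor and Ext are finitely generated bigraded \<open>A\<close>-modules, and the theorem holds for every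
  such module \<open>L\<close>, for a reason that involves no dimension theory. Let \<open>L\<close> be generated by finitely
  many homogeneous elements. Beyond their degrees the strand \<open>L\<^sub>k\<close> is the sum of the \<open>y\<^sub>j L\<^bsub>k-1\<^esub>\<close>
  (\<open>layer_recursion\<close>). So an element of \<open>S\<close> that kills \<open>L\<^bsub>k-1\<^esub>\<close> kills \<open>L\<^sub>k\<close>: the annihilators of
  the strands form, from some \<open>k\<close> on, an increasing chain of ideals of the Noetherian ring \<open>S\<close>. The
  chain is stationary, and with the annihilator the Krull dimension is constant
  (\<open>strand_dim_eventually_constant\<close>). The same recursion, started below all generators where the
  strands vanish, shows that every strand is finitely generated over \<open>S\<close> (\<open>strand_fin_gen\<close>).

  It remains to see that Tor and Ext are finitely generated and bigraded (\<open>fg_bigraded_Tor\<close>,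
  \<open>fg_bigraded_Ext\<close>). If \<open>F\<close> is free on a finite homogeneous basis \<open>B\<close>, both \<open>F \<otimes>\<^sub>S N\<close> and
  \<open>Hom\<^sub>S(F, N)\<close> are copies of \<open>N\<^sup>B\<close> in which the degrees of the factor at \<open>b\<close> are shifted by
  the degree of \<open>b\<close>, up or down. The differentials of the two complexes are \<open>A\<close>-linear and preserve
  degrees, so cycles and boundaries are \<open>A\<close>-submodules that contain the components of their
  elements, and the homology is again bigraded. It is finitely generated because \<open>A\<close> is
  Noetherian. Hilbert's basis theorem (\<open>noetherian_poly_ring\<close>) is proved for the polynomial
  rings at hand, together with its consequence for submodules (\<open>submodule_of_fin_gen\<close>).\<close>

section \<open>Polynomial rings\<close>

lemma poly_ring_sel [simp]:
  "monoid.mult (poly_ring V) = (*)" "one (poly_ring V) = 1"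
  "ring.zero (poly_ring V) = 0" "add (poly_ring V) = (+)"
  by (simp_all add: poly_ring_def)

definition mpoly_const :: "'k::field \<Rightarrow> 'k mpoly" where
  "mpoly_const c = Poly_Mapping.single 0 c"

definition mpoly_var :: "pvar \<Rightarrow> ('k::field) mpoly" where
  "mpoly_var v = Poly_Mapping.single (Poly_Mapping.single v 1) 1"

lemma carrier_poly_ring:
  "f \<in> carrier (poly_ring V) \<longleftrightarrow> (\<forall>t\<in>Poly_Mapping.keys f. Poly_Mapping.keys t \<subseteq> V)"
  by (simp add: poly_ring_def)

lemma poly_ring_const [simp]: "mpoly_const c \<in> carrier (poly_ring V)"
  by (auto simp: carrier_poly_ring mpoly_const_def)

lemma poly_ring_var: "v \<in> V \<Longrightarrow> mpoly_var v \<in> carrier (poly_ring V)"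
  by (auto simp: carrier_poly_ring mpoly_var_def)

lemma poly_ring_add: "f \<in> carrier (poly_ring V) \<Longrightarrow> g \<in> carrier (poly_ring V) \<Longrightarrow> f + g \<in> carrier (poly_ring V)"
  using keys_add by (fastforce simp: carrier_poly_ring)

lemma poly_ring_mult:
  assumes "f \<in> carrier (poly_ring V)" "g \<in> carrier (poly_ring V)"
  shows "f * g \<in> carrier (poly_ring V)"
  unfolding carrier_poly_ring
proof
  fix t assume "t \<in> Poly_Mapping.keys (f * g)"
  then obtain a b where "t = a + b" "a \<in> Poly_Mapping.keys f" "b \<in> Poly_Mapping.keys g"
    using keys_mult by blast
  then show "Poly_Mapping.keys t \<subseteq> V"
    using assms keys_add[of a b] by (fastforce simp: carrier_poly_ring)
qed

lemma poly_ring_zero [simp]: "0 \<in> carrier (poly_ring V)"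
  and poly_ring_one [simp]: "1 \<in> carrier (poly_ring V)"
  by (simp_all add: carrier_poly_ring)

lemma poly_ring_uminus: "f \<in> carrier (poly_ring V) \<Longrightarrow> - f \<in> carrier (poly_ring V)"
  by (simp add: carrier_poly_ring in_keys_iff)

lemma poly_ring_mono: "V \<subseteq> V' \<Longrightarrow> carrier (poly_ring V) \<subseteq> carrier (poly_ring V')"
  by (fastforce simp: carrier_poly_ring)

lemma mpoly_const_mult: "mpoly_const c * mpoly_const c' = mpoly_const (c * c')"
  by (simp add: mpoly_const_def mult_single)

lemma mpoly_const_0 [simp]: "mpoly_const 0 = 0" and mpoly_const_1 [simp]: "mpoly_const 1 = 1"
  by (simp_all add: mpoly_const_def)

lemma cring_poly_ring: "cring (poly_ring V)"
proof (intro cringI abelian_groupI comm_monoidI)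
  fix f :: "'a mpoly" assume "f \<in> carrier (poly_ring V)"
  then show "\<exists>y\<in>carrier (poly_ring V). y \<oplus>\<^bsub>poly_ring V\<^esub> f = \<zero>\<^bsub>poly_ring V\<^esub>"
    by (intro bexI[of _ "- f"]) (simp_all add: poly_ring_uminus)
qed (auto simp: poly_ring_add poly_ring_mult algebra_simps)

text \<open>Multiplication by a constant or a variable is homogeneous, multiplication by a general
  polynomial is not. Closure of graded objects under scalars is therefore checked on these ring generators.\<close>

lemma poly_ring_induct [consumes 1, case_names const var add mult]:
  assumes f: "f \<in> carrier (poly_ring V)"
    and const: "\<And>c. P (mpoly_const c)"
    and var: "\<And>v. v \<in> V \<Longrightarrow> P (mpoly_var v)"
    and add: "\<And>f g. f \<in> carrier (poly_ring V) \<Longrightarrow> g \<in> carrier (poly_ring V) \<Longrightarrow> P f \<Longrightarrow> P g \<Longrightarrow> P (f + g)"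
    and mult: "\<And>f g. f \<in> carrier (poly_ring V) \<Longrightarrow> g \<in> carrier (poly_ring V) \<Longrightarrow> P f \<Longrightarrow> P g \<Longrightarrow> P (f * g)"
  shows "P f"
proof -
  define Q where "Q f \<longleftrightarrow> f \<in> carrier (poly_ring V) \<and> P f" for f
  have Qc: "Q (mpoly_const c)" for c by (simp add: Q_def const)
  have Qa: "Q f \<Longrightarrow> Q g \<Longrightarrow> Q (f + g)" for f g by (simp add: Q_def add poly_ring_add)
  have Qm: "Q f \<Longrightarrow> Q g \<Longrightarrow> Q (f * g)" for f g by (simp add: Q_def mult poly_ring_mult)
  (* Powers of a variable, then monomials, then sums of terms. *)
  have pow: "Q (Poly_Mapping.single (Poly_Mapping.single v e) 1)" if "v \<in> V" for v e
  proof (induction e)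
    case 0
    show ?case using Qc[of 1] by (simp add: mpoly_const_def)
  next
    case (Suc e)
    have "Poly_Mapping.single (Poly_Mapping.single v (Suc e)) 1
        = (mpoly_var v :: 'a mpoly) * Poly_Mapping.single (Poly_Mapping.single v e) 1"
      by (simp add: mpoly_var_def mult_single single_add[symmetric])
    moreover have "Q (mpoly_var v)" using that by (simp add: Q_def var poly_ring_var)
    ultimately show ?case using Qm Suc by simp
  qed
  have mono: "Poly_Mapping.keys t \<subseteq> V \<Longrightarrow> Q (Poly_Mapping.single t 1)" for t
  proof (induction t rule: update_induct)
    case const
    show ?case using Qc[of 1] by (simp add: mpoly_const_def)
  next
    case (update t a b)
    have eq: "Poly_Mapping.update a b t = Poly_Mapping.single a b + t"
      using update.hyps by (intro poly_mapping_eqI) (auto simp: lookup_update lookup_add lookup_single in_keys_iff)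
    have ks: "Poly_Mapping.keys (Poly_Mapping.update a b t) = insert a (Poly_Mapping.keys t)"
      using update.hyps by (simp add: keys_update)
    have "Poly_Mapping.single (Poly_Mapping.update a b t) (1::'a)
       = Poly_Mapping.single (Poly_Mapping.single a b) 1 * Poly_Mapping.single t 1"
      by (simp add: eq mult_single)
    then show ?case using Qm pow update ks by simp
  qed
  have "\<forall>t\<in>Poly_Mapping.keys f. Poly_Mapping.keys t \<subseteq> V \<Longrightarrow> Q f" for f :: "'a mpoly"
  proof (induction f rule: update_induct)
    case const
    show ?case using Qc[of 0] by simp
  next
    case (update f t c)
    have eq: "Poly_Mapping.update t c f = mpoly_const c * Poly_Mapping.single t 1 + f"
      using update.hyps by (intro poly_mapping_eqI)
       (auto simp: lookup_update lookup_add lookup_single in_keys_iff mpoly_const_def mult_single)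
    have ks: "Poly_Mapping.keys (Poly_Mapping.update t c f) = insert t (Poly_Mapping.keys f)"
      using update.hyps by (simp add: keys_update)
    show ?case unfolding eq using update ks by (intro Qa Qm Qc mono) auto
  qed
  then show ?thesis using f by (simp add: carrier_poly_ring Q_def)
qed


section \<open>Noetherian rings and modules\<close>

definition mspan :: "('a, 'c) ring_scheme \<Rightarrow> ('a, 'b, 'd) module_scheme \<Rightarrow> 'b set \<Rightarrow> 'b set" where
  "mspan R M G = \<Inter>{H. submodule H R M \<and> G \<subseteq> H}"

lemma fin_gen_mspan: "fin_gen R M \<longleftrightarrow> (\<exists>G. finite G \<and> G \<subseteq> carrier M \<and> mspan R M G = carrier M)"
  by (simp add: fin_gen_def mspan_def)

lemma mspan_minimal: "submodule H R M \<Longrightarrow> G \<subseteq> H \<Longrightarrow> mspan R M G \<subseteq> H"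
  by (auto simp: mspan_def)

lemma mspan_incl: "G \<subseteq> mspan R M G"
  by (auto simp: mspan_def)

lemma (in Module.module) mspan_submodule:
  assumes "G \<subseteq> carrier M"
  shows "submodule (mspan R M G) R M"
proof (rule submoduleI)
  show "mspan R M G \<subseteq> carrier M" using mspan_minimal[OF carrier_is_submodule assms] .
qed (auto simp: mspan_def submodule_def submodule_axioms_def subgroup_def a_inv_def)

lemma (in Module.module) mspan_mono:
  assumes "G \<subseteq> mspan R M G'" "G' \<subseteq> carrier M"
  shows "mspan R M G \<subseteq> mspan R M G'"
  using mspan_minimal[OF mspan_submodule] assms by blast

lemma (in Module.module) submodule_zero: "submodule H R M \<Longrightarrow> \<zero>\<^bsub>M\<^esub> \<in> H"
  by (metis submodule.axioms(1) subgroup.one_closed monoid.select_convs(2))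

lemma (in Module.module) mspan_insert:
  assumes g: "g \<in> carrier M" and G: "G \<subseteq> carrier M" and x: "x \<in> mspan R M (insert g G)"
  obtains r s where "r \<in> carrier R" "s \<in> mspan R M G" "x = r \<odot>\<^bsub>M\<^esub> g \<oplus>\<^bsub>M\<^esub> s"
proof -
  let ?K = "{r \<odot>\<^bsub>M\<^esub> g \<oplus>\<^bsub>M\<^esub> s | r s. r \<in> carrier R \<and> s \<in> mspan R M G}"
  note sub = submoduleE[OF mspan_submodule[OF G]]
  have "submodule ?K R M"
  proof (rule submoduleI)
    fix y z assume "y \<in> ?K"
      and "z \<in> ?K"
    then obtain r s r' s' where
      "r \<in> carrier R" "s \<in> mspan R M G" "r' \<in> carrier R" "s' \<in> mspan R M G"
      "y = r \<odot>\<^bsub>M\<^esub> g \<oplus>\<^bsub>M\<^esub> s" "z = r' \<odot>\<^bsub>M\<^esub> g \<oplus>\<^bsub>M\<^esub> s'" by auto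
    moreover from this have "y \<oplus>\<^bsub>M\<^esub> z = (r \<oplus>\<^bsub>R\<^esub> r') \<odot>\<^bsub>M\<^esub> g \<oplus>\<^bsub>M\<^esub> (s \<oplus>\<^bsub>M\<^esub> s')"
      using g sub(1) by (simp add: smult_l_distr subset_iff M.a_ac)
    ultimately show "y \<oplus>\<^bsub>M\<^esub> z \<in> ?K"
      using sub(5) by blast
  next
    fix a y assume a: "a \<in> carrier R" and "y \<in> ?K"
    then obtain r s where *: "r \<in> carrier R" "s \<in> mspan R M G" "y = r \<odot>\<^bsub>M\<^esub> g \<oplus>\<^bsub>M\<^esub> s" by auto
    then have "a \<odot>\<^bsub>M\<^esub> y = (a \<otimes>\<^bsub>R\<^esub> r) \<odot>\<^bsub>M\<^esub> g \<oplus>\<^bsub>M\<^esub> a \<odot>\<^bsub>M\<^esub> s"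
      using a g sub(1) by (simp add: smult_r_distr smult_assoc1 subset_iff)
    then show "a \<odot>\<^bsub>M\<^esub> y \<in> ?K"
      using sub(4) a * by blast
  next
    fix y assume "y \<in> ?K"
    then obtain r s where *: "r \<in> carrier R" "s \<in> mspan R M G" "y = r \<odot>\<^bsub>M\<^esub> g \<oplus>\<^bsub>M\<^esub> s" by auto
    then have "\<ominus>\<^bsub>M\<^esub> y = (\<ominus>\<^bsub>R\<^esub> r) \<odot>\<^bsub>M\<^esub> g \<oplus>\<^bsub>M\<^esub> \<ominus>\<^bsub>M\<^esub> s"
      using g sub(1) by (simp add: smult_l_minus M.minus_add subset_iff)
    then show "\<ominus>\<^bsub>M\<^esub> y \<in> ?K"
      using sub(3) * by blast
  next
    have "\<zero>\<^bsub>M\<^esub> = \<zero>\<^bsub>R\<^esub> \<odot>\<^bsub>M\<^esub> g \<oplus>\<^bsub>M\<^esub> \<zero>\<^bsub>M\<^esub>" using g by simp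
    then show "\<zero>\<^bsub>M\<^esub> \<in> ?K"
      using submodule_zero[OF mspan_submodule[OF G]] by blast
  qed (use g sub(1) in auto)
  moreover have "insert g G \<subseteq> ?K"
  proof -
    have "g = \<one>\<^bsub>R\<^esub> \<odot>\<^bsub>M\<^esub> g \<oplus>\<^bsub>M\<^esub> \<zero>\<^bsub>M\<^esub>" using g by simp
    moreover have "y = \<zero>\<^bsub>R\<^esub> \<odot>\<^bsub>M\<^esub> g \<oplus>\<^bsub>M\<^esub> y" if "y \<in> G" for y using that G g by auto
    ultimately show ?thesis
      using submodule_zero[OF mspan_submodule[OF G]] mspan_incl[of G R M] by blast
  qed
  ultimately show thesis using x mspan_minimal that by blast
qed

text \<open>By induction on the number of generators of the ambient module. The coefficients at the new
  generator \<open>g\<close> of the elements of \<open>H\<close> form an ideal. Finitely many elements of \<open>H\<close> realise generators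
  of this ideal; subtracting a combination of them from an element of \<open>H\<close> leaves an element of \<open>H\<close>
  in the span of the old generators.\<close>

theorem (in Module.module) submodule_of_fin_gen:
  assumes R: "noetherian_ring R"
    and G: "finite G" "G \<subseteq> carrier M" and H: "submodule H R M" "H \<subseteq> mspan R M G"
  shows "\<exists>G'. finite G' \<and> G' \<subseteq> H \<and> mspan R M G' = H"
  using G H
proof (induction G arbitrary: H)
  case empty
  have "submodule {\<zero>\<^bsub>M\<^esub>} R M" by (rule submoduleI) auto
  then have "H \<subseteq> {\<zero>\<^bsub>M\<^esub>}" using empty.prems(3) mspan_minimal[of "{\<zero>\<^bsub>M\<^esub>}" R M "{}"] by blast
  moreover have "mspan R M {} \<subseteq> H" using empty.prems(2) mspan_minimal by blast
  moreover have "\<zero>\<^bsub>M\<^esub> \<in> mspan R M {}" using submodule_zero mspan_submodule by blast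
  ultimately show ?case by (intro exI[of _ "{}"]) auto
next
  case (insert g G)
  interpret N: noetherian_ring R by fact
  have g: "g \<in> carrier M" and G: "G \<subseteq> carrier M" using insert.prems by auto
  note subH = submoduleE[OF insert.prems(2)]
  note subG = submoduleE[OF mspan_submodule[OF G]]
  have sub_int: "submodule (H \<inter> mspan R M G) R M"
  proof (rule submoduleI)
    show "H \<inter> mspan R M G \<subseteq> carrier M" using subH(1) by blast
    show "\<zero>\<^bsub>M\<^esub> \<in> H \<inter> mspan R M G"
      using submodule_zero[OF insert.prems(2)] submodule_zero[OF mspan_submodule[OF G]] by simp
  qed (simp_all add: subH(3-5) subG(3-5))
  then obtain G1 where G1: "finite G1" "G1 \<subseteq> H \<inter> mspan R M G" "mspan R M G1 = H \<inter> mspan R M G"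
    using insert.IH[OF G sub_int] by blast
  (* The coefficient of g need not be determined by the element: r belongs to the ideal as soon as
     some expression of an element of H' has coefficient r. *)
  define lead where "lead H' = {r \<in> carrier R. \<exists>s\<in>mspan R M G. r \<odot>\<^bsub>M\<^esub> g \<oplus>\<^bsub>M\<^esub> s \<in> H'}" for H'
  have lead_ideal: "ideal (lead H') R" if H': "submodule H' R M" for H'
  proof -
    note s' = submoduleE[OF H']
    have z: "\<zero>\<^bsub>R\<^esub> \<in> lead H'"
      using submodule_zero[OF H'] submodule_zero[OF mspan_submodule[OF G]] g
      by (auto simp: lead_def intro!: bexI[of _ "\<zero>\<^bsub>M\<^esub>"])
    have a: "x \<oplus>\<^bsub>R\<^esub> y \<in> lead H'" if xy: "x \<in> lead H'" "y \<in> lead H'" for x y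
    proof -
      obtain s t where st: "s \<in> mspan R M G" "t \<in> mspan R M G" "x \<odot>\<^bsub>M\<^esub> g \<oplus>\<^bsub>M\<^esub> s \<in> H'"
        "y \<odot>\<^bsub>M\<^esub> g \<oplus>\<^bsub>M\<^esub> t \<in> H'" "x \<in> carrier R" "y \<in> carrier R" using xy by (auto simp: lead_def)
      have "(x \<odot>\<^bsub>M\<^esub> g \<oplus>\<^bsub>M\<^esub> s) \<oplus>\<^bsub>M\<^esub> (y \<odot>\<^bsub>M\<^esub> g \<oplus>\<^bsub>M\<^esub> t) = (x \<oplus>\<^bsub>R\<^esub> y) \<odot>\<^bsub>M\<^esub> g \<oplus>\<^bsub>M\<^esub> (s \<oplus>\<^bsub>M\<^esub> t)"
        using st subG(1) g by (simp add: smult_l_distr subset_iff M.a_ac)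
      then show ?thesis using st subG(5) s'(5) by (auto simp: lead_def) metis
    qed
    have m: "r \<otimes>\<^bsub>R\<^esub> x \<in> lead H'" if xr: "x \<in> lead H'" "r \<in> carrier R" for x r
    proof -
      obtain s where st: "s \<in> mspan R M G" "x \<odot>\<^bsub>M\<^esub> g \<oplus>\<^bsub>M\<^esub> s \<in> H'" "x \<in> carrier R"
        using xr by (auto simp: lead_def)
      have "r \<odot>\<^bsub>M\<^esub> (x \<odot>\<^bsub>M\<^esub> g \<oplus>\<^bsub>M\<^esub> s) = (r \<otimes>\<^bsub>R\<^esub> x) \<odot>\<^bsub>M\<^esub> g \<oplus>\<^bsub>M\<^esub> r \<odot>\<^bsub>M\<^esub> s"
        using st subG(1) g xr by (simp add: smult_r_distr smult_assoc1 subset_iff)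
      then show ?thesis using st subG(4) s'(4) xr by (auto simp: lead_def) metis
    qed
    have car: "lead H' \<subseteq> carrier R" by (auto simp: lead_def)
    have inv: "\<ominus>\<^bsub>R\<^esub> x \<in> lead H'" if "x \<in> lead H'" for x
      using m[OF that, of "\<ominus>\<^bsub>R\<^esub> \<one>\<^bsub>R\<^esub>"] that car by (auto simp: R.l_minus)
    have "subgroup (lead H') (add_monoid R)"
      using z a car inv by (unfold_locales) (auto simp: a_inv_def)
    then show ?thesis
      using m car by (intro idealI) (auto simp: R.ring_axioms R.m_comm subset_iff)
  qed
  obtain A where A: "A \<subseteq> carrier R" "finite A" "lead H = Idl\<^bsub>R\<^esub> A"
    using N.finetely_gen[OF lead_ideal[OF insert.prems(2)]] by blast
  have "\<forall>a\<in>A. \<exists>s. s \<in> mspan R M G \<and> a \<odot>\<^bsub>M\<^esub> g \<oplus>\<^bsub>M\<^esub> s \<in> H"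
    using R.genideal_self[OF A(1)] A(3) by (auto simp: lead_def)
  then obtain s where s: "\<And>a. a \<in> A \<Longrightarrow> s a \<in> mspan R M G" "\<And>a. a \<in> A \<Longrightarrow> a \<odot>\<^bsub>M\<^esub> g \<oplus>\<^bsub>M\<^esub> s a \<in> H"
    by metis
  define G2 where "G2 = G1 \<union> (\<lambda>a. a \<odot>\<^bsub>M\<^esub> g \<oplus>\<^bsub>M\<^esub> s a) ` A"
  have G2: "finite G2" "G2 \<subseteq> H" "G2 \<subseteq> carrier M"
    using G1 A s subH(1) by (auto simp: G2_def)
  have sub2: "submodule (mspan R M G2) R M" by (rule mspan_submodule[OF G2(3)])
  have inH: "mspan R M G2 \<subseteq> H" using mspan_minimal[OF insert.prems(2) G2(2)] .
  have "A \<subseteq> lead (mspan R M G2)"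
    using A(1) s(1) mspan_incl[of G2 R M] unfolding lead_def G2_def by blast
  then have lead: "lead H \<subseteq> lead (mspan R M G2)"
    unfolding A(3) by (rule R.genideal_minimal[OF lead_ideal[OF sub2]])
  have int2: "H \<inter> mspan R M G \<subseteq> mspan R M G2"
    unfolding G1(3)[symmetric] using G2(3) mspan_incl[of G2 R M] by (intro mspan_mono) (auto simp: G2_def)
  have "H \<subseteq> mspan R M G2"
  proof
    fix h assume h: "h \<in> H"
    then obtain r t where rt: "r \<in> carrier R" "t \<in> mspan R M G" "h = r \<odot>\<^bsub>M\<^esub> g \<oplus>\<^bsub>M\<^esub> t"
      using mspan_insert[OF g G] insert.prems(3) by blast
    then have "r \<in> lead H" using h by (auto simp: lead_def)
    then obtain u where u: "u \<in> mspan R M G" "r \<odot>\<^bsub>M\<^esub> g \<oplus>\<^bsub>M\<^esub> u \<in> mspan R M G2"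
      using lead by (auto simp: lead_def)
    have cu: "u \<in> carrier M" "t \<in> carrier M" using u rt subG(1) by auto
    have "\<ominus>\<^bsub>M\<^esub> (r \<odot>\<^bsub>M\<^esub> g \<oplus>\<^bsub>M\<^esub> u) \<oplus>\<^bsub>M\<^esub> h = t \<oplus>\<^bsub>M\<^esub> \<ominus>\<^bsub>M\<^esub> u"
    proof -
      have "\<ominus>\<^bsub>M\<^esub> (r \<odot>\<^bsub>M\<^esub> g \<oplus>\<^bsub>M\<^esub> u) \<oplus>\<^bsub>M\<^esub> h
          = (\<ominus>\<^bsub>M\<^esub> (r \<odot>\<^bsub>M\<^esub> g) \<oplus>\<^bsub>M\<^esub> (r \<odot>\<^bsub>M\<^esub> g)) \<oplus>\<^bsub>M\<^esub> (t \<oplus>\<^bsub>M\<^esub> \<ominus>\<^bsub>M\<^esub> u)"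
        using cu rt(1) g unfolding rt(3) by (simp add: M.minus_add M.a_ac)
      then show ?thesis using cu rt(1) g by (simp add: M.l_neg)
    qed
    moreover have "\<ominus>\<^bsub>M\<^esub> (r \<odot>\<^bsub>M\<^esub> g \<oplus>\<^bsub>M\<^esub> u) \<oplus>\<^bsub>M\<^esub> h \<in> H"
      using subH(5)[OF subH(3)[OF subsetD[OF inH u(2)]] h] .
    ultimately have "t \<oplus>\<^bsub>M\<^esub> \<ominus>\<^bsub>M\<^esub> u \<in> mspan R M G2"
      using subG(5)[OF rt(2) subG(3)[OF u(1)]] int2 by auto
    moreover have "h = (r \<odot>\<^bsub>M\<^esub> g \<oplus>\<^bsub>M\<^esub> u) \<oplus>\<^bsub>M\<^esub> (t \<oplus>\<^bsub>M\<^esub> \<ominus>\<^bsub>M\<^esub> u)"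
    proof -
      have "(r \<odot>\<^bsub>M\<^esub> g \<oplus>\<^bsub>M\<^esub> u) \<oplus>\<^bsub>M\<^esub> (t \<oplus>\<^bsub>M\<^esub> \<ominus>\<^bsub>M\<^esub> u) = (r \<odot>\<^bsub>M\<^esub> g \<oplus>\<^bsub>M\<^esub> t) \<oplus>\<^bsub>M\<^esub> (u \<oplus>\<^bsub>M\<^esub> \<ominus>\<^bsub>M\<^esub> u)"
        using cu rt(1) g by (simp add: M.a_ac)
      then show ?thesis using cu rt g by (simp add: M.r_neg)
    qed
    ultimately show "h \<in> mspan R M G2" using submoduleE(5)[OF sub2] u by simp
  qed
  then show ?case using G2 inH by blast
qed

section \<open>Hilbert's basis theorem\<close>

lemma ideal_poly_ring_iff:
  "ideal I (poly_ring V) \<longleftrightarrow> I \<subseteq> carrier (poly_ring V) \<and> 0 \<in> I \<and> (\<forall>x\<in>I. \<forall>y\<in>I. x + y \<in> I)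
     \<and> (\<forall>r\<in>carrier (poly_ring V). \<forall>x\<in>I. r * x \<in> I)" (is "?l \<longleftrightarrow> ?r")
proof
  assume ?l
  then interpret ideal I "poly_ring V" .
  have "0 \<in> I" using additive_subgroup.zero_closed[OF is_additive_subgroup] by simp
  moreover have "x + y \<in> I" if "x \<in> I" "y \<in> I" for x y using additive_subgroup.a_closed[OF is_additive_subgroup that] by simp
  moreover have "r * x \<in> I" if "x \<in> I" "r \<in> carrier (poly_ring V)" for r x
    using I_l_closed[OF that] by simp
  ultimately show ?r using a_subset by blast
next
  assume r: ?r
  interpret C: cring "poly_ring V" by (rule cring_poly_ring)
  have m: "\<ominus>\<^bsub>poly_ring V\<^esub> x \<in> I" if "x \<in> I" for x
  proof -
    have "\<ominus>\<^bsub>poly_ring V\<^esub> x = (\<ominus>\<^bsub>poly_ring V\<^esub> 1) * x"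
      using C.l_minus[of 1 x] that r by auto
    moreover have "\<ominus>\<^bsub>poly_ring V\<^esub> 1 \<in> carrier (poly_ring V)" by (intro C.a_inv_closed) simp
    ultimately show ?thesis using r that by simp
  qed
  have "subgroup I (add_monoid (poly_ring V))"
    using r m by (unfold_locales) (auto simp: a_inv_def)
  then show ?l
  proof (intro idealI)
    fix a x :: "'a mpoly" assume "a \<in> I" "x \<in> carrier (poly_ring V)"
    then have "x * a \<in> I" using r by blast
    then show "x \<otimes>\<^bsub>poly_ring V\<^esub> a \<in> I" "a \<otimes>\<^bsub>poly_ring V\<^esub> x \<in> I"
      by (simp_all add: mult.commute[of a x])
  qed (rule C.ring_axioms)
qed

text \<open>The polynomials in all variables, to be regarded as a module over each polynomial ring. Viewed
  over the smaller of two rings, it has the polynomials of bounded degree in the additional variable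
  as a finitely generated submodule, to which \<open>submodule_of_fin_gen\<close> applies.\<close>

definition all_polys :: "(('k::field) mpoly, 'k mpoly) module" where
  "all_polys = \<lparr>carrier = UNIV, monoid.mult = (*), one = 1, ring.zero = 0, add = (+), smult = (*)\<rparr>"

lemma all_polys_sel [simp]:
  "carrier all_polys = UNIV" "ring.zero all_polys = 0" "add all_polys = (+)" "smult all_polys = (*)"
  by (simp_all add: all_polys_def)

lemma module_all_polys: "Module.module (poly_ring V) all_polys"
proof (intro moduleI cring_poly_ring abelian_groupI)
  fix x :: "'a mpoly"
  show "\<exists>y\<in>carrier all_polys. y \<oplus>\<^bsub>all_polys\<^esub> x = \<zero>\<^bsub>all_polys\<^esub>"
    by (intro bexI[of _ "- x"]) auto
qed (auto simp: algebra_simps)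

lemma submodule_all_polysI:
  assumes "0 \<in> H" "\<And>x y. x \<in> H \<Longrightarrow> y \<in> H \<Longrightarrow> x + y \<in> H"
    and s: "\<And>r x. r \<in> carrier (poly_ring V) \<Longrightarrow> x \<in> H \<Longrightarrow> r * x \<in> H"
  shows "submodule H (poly_ring V) all_polys"
proof -
  interpret Module.module "poly_ring V" all_polys by (rule module_all_polys)
  show ?thesis
  proof (rule submoduleI)
    fix x assume x: "x \<in> H"
    have "\<ominus>\<^bsub>all_polys\<^esub> x = - x"
      using M.minus_equality[of "- x" x] by simp
    moreover have "(- 1) * x \<in> H" by (intro s x poly_ring_uminus) simp
    ultimately show "\<ominus>\<^bsub>all_polys\<^esub> x \<in> H" by simp
  qed (use assms in auto)
qed

text \<open>The sums \<open>c\<^sub>0 + c\<^sub>1 v + \<dots> + c\<^bsub>d-1\<^esub> v\<^bsup>d-1\<^esup>\<close> with coefficients in the polynomial ring over \<open>V\<close>.\<close>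

primrec below_degree :: "pvar set \<Rightarrow> pvar \<Rightarrow> nat \<Rightarrow> ('k::field) mpoly set" where
  "below_degree V v 0 = {0}"
| "below_degree V v (Suc d) = {c * mpoly_var v ^ d + q | c q. c \<in> carrier (poly_ring V) \<and> q \<in> below_degree V v d}"

lemma below_degree_SucI:
  "f = c * mpoly_var v ^ d + q \<Longrightarrow> c \<in> carrier (poly_ring V) \<Longrightarrow> q \<in> below_degree V v d
    \<Longrightarrow> f \<in> below_degree V v (Suc d)"
  by auto

lemma below_degree_zero: "0 \<in> below_degree V v d"
  by (induction d) (auto intro!: exI[of _ 0])

lemma below_degree_add: "f \<in> below_degree V v d \<Longrightarrow> g \<in> below_degree V v d \<Longrightarrow> f + g \<in> below_degree V v d"
proof (induction d arbitrary: f g)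
  case (Suc d)
  then obtain c q c' q' where "f = c * mpoly_var v ^ d + q" "g = c' * mpoly_var v ^ d + q'"
    "c \<in> carrier (poly_ring V)" "c' \<in> carrier (poly_ring V)" "q \<in> below_degree V v d" "q' \<in> below_degree V v d" by auto
  then show ?case
    by (intro below_degree_SucI[of _ "c + c'" v d "q + q'"] Suc.IH poly_ring_add) (simp_all add: algebra_simps)
qed simp

lemma below_degree_smult: "r \<in> carrier (poly_ring V) \<Longrightarrow> f \<in> below_degree V v d \<Longrightarrow> r * f \<in> below_degree V v d"
proof (induction d arbitrary: f)
  case (Suc d)
  then obtain c q where "f = c * mpoly_var v ^ d + q"
    "c \<in> carrier (poly_ring V)" "q \<in> below_degree V v d" by auto
  then show ?case using Suc.prems
    by (intro below_degree_SucI[of _ "r * c" v d "r * q"] Suc.IH poly_ring_mult) (simp_all add: algebra_simps)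
qed simp

lemma below_degree_var: "f \<in> below_degree V v d \<Longrightarrow> mpoly_var v * f \<in> below_degree V v (Suc d)"
proof (induction d arbitrary: f)
  case 0
  then show ?case by (auto intro!: exI[of _ 0])
next
  case (Suc d)
  then obtain c q where cq: "f = c * mpoly_var v ^ d + q"
    "c \<in> carrier (poly_ring V)" "q \<in> below_degree V v d" by auto
  have "mpoly_var v * f = c * mpoly_var v ^ Suc d + mpoly_var v * q"
    by (simp add: cq algebra_simps)
  then show ?case using below_degree_SucI[OF _ cq(2) Suc.IH[OF cq(3)]] by blast
qed

lemma below_degree_mono: "d \<le> e \<Longrightarrow> below_degree V v d \<subseteq> below_degree V v e"
proof (induction rule: dec_induct)
  case (step e)
  have "q \<in> below_degree V v (Suc e)" if "q \<in> below_degree V v e" for q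
    using below_degree_SucI[of q 0 v e q V] that by simp
  then show ?case using step by blast
qed simp

lemma below_degree_var_power: "f \<in> below_degree V v d \<Longrightarrow> mpoly_var v ^ e * f \<in> below_degree V v (e + d)"
proof (induction e)
  case (Suc e)
  have "mpoly_var v * (mpoly_var v ^ e * f) \<in> below_degree V v (Suc (e + d))"
    using below_degree_var Suc by blast
  then show ?case by (simp only: power_Suc mult.assoc add_Suc)
qed simp

lemma below_degree_mult:
  assumes g: "g \<in> below_degree V v e"
  shows "f \<in> below_degree V v d \<Longrightarrow> f * g \<in> below_degree V v (d + e)"
proof (induction d arbitrary: f)
  case 0
  then show ?case by (simp add: below_degree_zero)
next
  case (Suc d)
  then obtain c q where cq: "f = c * mpoly_var v ^ d + q"
    "c \<in> carrier (poly_ring V)" "q \<in> below_degree V v d" by auto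
  have "f * g = c * (mpoly_var v ^ d * g) + q * g" by (simp add: cq algebra_simps)
  moreover have "c * (mpoly_var v ^ d * g) \<in> below_degree V v (d + e)"
    by (intro below_degree_smult below_degree_var_power cq g)
  ultimately have "f * g \<in> below_degree V v (d + e)"
    using below_degree_add Suc.IH[OF cq(3)] by simp
  then show ?case using below_degree_mono[of "d + e" "Suc d + e" V v] by auto
qed

lemma below_degree_exists:
  assumes "f \<in> carrier (poly_ring (insert v V))"
  obtains d where "f \<in> below_degree V v d"
proof -
  have base: "c \<in> carrier (poly_ring V) \<Longrightarrow> c \<in> below_degree V v (Suc 0)" for c
    by simp
  have "\<exists>d. f \<in> below_degree V v d"
    using assms
  proof (induction f rule: poly_ring_induct)
    case (const c)
    show ?case using base poly_ring_const by blast
  next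
    case (var w)
    show ?case
    proof (cases "w = v")
      case True
      have "mpoly_var v * 1 \<in> below_degree V v (Suc (Suc 0))"
        by (intro below_degree_var base) simp
      then show ?thesis using True by (auto simp del: below_degree.simps)
    next
      case False
      then show ?thesis using var base poly_ring_var[of w V] by blast
    qed
  next
    case (add f g)
    then obtain d e where "f \<in> below_degree V v d" "g \<in> below_degree V v e" by auto
    then have "f + g \<in> below_degree V v (max d e)"
      using below_degree_mono[of d "max d e" V v] below_degree_mono[of e "max d e" V v]
      by (intro below_degree_add) auto
    then show ?case by blast
  next
    case (mult f g)
    then show ?case using below_degree_mult by blast
  qed
  then show thesis using that by blast
qed

lemma below_degree_span:
  "below_degree V v d \<subseteq> mspan (poly_ring V) all_polys ((\<lambda>e. mpoly_var v ^ e) ` {..<d})"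
proof (induction d)
  case 0
  interpret Module.module "poly_ring V" all_polys by (rule module_all_polys)
  show ?case using submodule_zero[OF mspan_submodule[of "{}"]] by simp
next
  case (Suc d)
  interpret Module.module "poly_ring V" "all_polys :: ('a mpoly, 'a mpoly) module" by (rule module_all_polys)
  let ?S = "mspan (poly_ring V) all_polys ((\<lambda>e. mpoly_var v ^ e :: 'a mpoly) ` {..<Suc d})"
  note s = submoduleE[OF mspan_submodule[of "(\<lambda>e. mpoly_var v ^ e :: 'a mpoly) ` {..<Suc d}"]]
  have "mpoly_var v ^ d \<in> ?S"
    by (rule subsetD[OF mspan_incl]) simp
  then have "c * mpoly_var v ^ d \<in> ?S" if "c \<in> carrier (poly_ring V)" for c
    using s(4) that by simp
  moreover have "below_degree V v d \<subseteq> ?S"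
  proof (rule order_trans[OF Suc mspan_mono])
    show "(\<lambda>e. mpoly_var v ^ e) ` {..<d} \<subseteq> ?S"
      by (rule order_trans[OF _ mspan_incl]) auto
  qed simp
  ultimately show ?case using s(5) by (auto simp: subset_iff)
qed

text \<open>Hilbert's argument. The ideals of leading coefficients in degree \<open>d\<close> of the elements of \<open>I\<close>
  increase with \<open>d\<close>, because \<open>I\<close> is stable under multiplication by the new variable, and are
  stationary from some degree \<open>D\<close> on. From degree \<open>D\<close> upwards, finitely many elements of degree \<open>D\<close>
  suffice to remove the leading term of an element of \<open>I\<close>. The elements of degree
  below \<open>D\<close> form a submodule of a finitely generated module over the smaller ring.\<close>

lemma noetherian_insert_var:
  assumes R: "noetherian_ring (poly_ring V :: ('k::field) mpoly ring)"
  shows "noetherian_ring (poly_ring (insert v V) :: 'k mpoly ring)"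
proof (rule ring.noetherian_ringI)
  let ?R = "poly_ring V :: 'k mpoly ring"
  let ?T = "poly_ring (insert v V) :: 'k mpoly ring"
  let ?x = "mpoly_var v :: 'k mpoly"
  interpret T: cring ?T by (rule cring_poly_ring)
  interpret RM: Module.module ?R all_polys by (rule module_all_polys)
  interpret N: noetherian_ring ?R by (rule R)
  show "ring ?T" by (rule T.ring_axioms)
  fix I assume "ideal I ?T"
  then have I: "I \<subseteq> carrier ?T" "0 \<in> I" "\<And>f g. f \<in> I \<Longrightarrow> g \<in> I \<Longrightarrow> f + g \<in> I"
    "\<And>r f. r \<in> carrier ?T \<Longrightarrow> f \<in> I \<Longrightarrow> r * f \<in> I" by (auto simp: ideal_poly_ring_iff)
  have RT: "carrier ?R \<subseteq> carrier ?T" by (rule poly_ring_mono) blast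
  have xT: "?x ^ e \<in> carrier ?T" for e
    by (induction e) (auto intro!: poly_ring_mult poly_ring_var)
  define lead where "lead J d = {c \<in> carrier ?R. \<exists>q\<in>below_degree V v d. c * ?x ^ d + q \<in> J}" for J d
  have lead_add: "c + c' \<in> lead J d" if J: "ideal J ?T" and c: "c \<in> lead J d" "c' \<in> lead J d" for J c c' d
  proof -
    obtain q q' where q: "q \<in> below_degree V v d" "q' \<in> below_degree V v d"
      "c * ?x ^ d + q \<in> J" "c' * ?x ^ d + q' \<in> J" "c \<in> carrier ?R" "c' \<in> carrier ?R"
      using c by (auto simp: lead_def)
    have "(c + c') * ?x ^ d + (q + q') = (c * ?x ^ d + q) + (c' * ?x ^ d + q')" by (simp add: algebra_simps)
    also have "\<dots> \<in> J" using J q by (simp add: ideal_poly_ring_iff)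
    finally show ?thesis
      unfolding lead_def using below_degree_add[OF q(1,2)] poly_ring_add[OF q(5,6)] by blast
  qed
  have lead_mult: "r * c \<in> lead J d" if J: "ideal J ?T" and c: "c \<in> lead J d" "r \<in> carrier ?R" for J r c d
  proof -
    obtain q where q: "q \<in> below_degree V v d" "c * ?x ^ d + q \<in> J" "c \<in> carrier ?R"
      using c by (auto simp: lead_def)
    have "(r * c) * ?x ^ d + r * q = r * (c * ?x ^ d + q)" by (simp add: algebra_simps)
    also have "\<dots> \<in> J" using J q c RT by (auto simp: ideal_poly_ring_iff)
    finally show ?thesis
      unfolding lead_def using below_degree_smult[OF c(2) q(1)] poly_ring_mult[OF c(2) q(3)] by blast
  qed
  have lead_ideal: "ideal (lead J d) ?R" if J: "ideal J ?T" for J d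
  proof -
    have "0 \<in> lead J d"
      using J below_degree_zero[of V v d] by (auto simp: lead_def ideal_poly_ring_iff intro!: bexI[of _ 0])
    then show ?thesis using lead_add[OF J] lead_mult[OF J]
      by (auto simp: ideal_poly_ring_iff) (auto simp: lead_def)
  qed
  have lead_Suc: "lead J d \<subseteq> lead J (Suc d)" if J: "ideal J ?T" for J d
  proof
    fix c assume "c \<in> lead J d"
    then obtain q where q: "q \<in> below_degree V v d" "c * ?x ^ d + q \<in> J" "c \<in> carrier ?R"
      by (auto simp: lead_def)
    have "c * ?x ^ Suc d + ?x * q = ?x * (c * ?x ^ d + q)" by (simp add: algebra_simps)
    also have "\<dots> \<in> J" using J q xT[of 1] by (simp add: ideal_poly_ring_iff)
    finally show "c \<in> lead J (Suc d)"
      unfolding lead_def using below_degree_var[OF q(1)] q(3) by blast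
  qed
  have lead_mono: "d \<le> e \<Longrightarrow> lead J d \<subseteq> lead J e" if "ideal J ?T" for J d e
    by (induction rule: dec_induct) (use lead_Suc[OF that] in blast)+
  have Iid: "ideal I ?T" by fact
  have "(\<Union>d. lead I d) \<in> range (lead I)"
  proof (rule N.ideal_chain_is_trivial)
    show "subset.chain {J. ideal J ?R} (range (lead I))"
      unfolding subset_chain_def
    proof (intro conjI ballI)
      fix J J' assume "J \<in> range (lead I)" "J' \<in> range (lead I)"
      then obtain d e where "J = lead I d" "J' = lead I e" by blast
      then show "J \<subseteq> J' \<or> J' \<subseteq> J" using lead_mono[OF Iid] nat_le_linear[of d e] by blast
    qed (use lead_ideal[OF Iid] in auto)
  qed simp
  then obtain D where D: "\<And>d. lead I d \<subseteq> lead I D" by blast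
  obtain A where A: "A \<subseteq> carrier ?R" "finite A" "lead I D = Idl\<^bsub>?R\<^esub> A"
    using N.finetely_gen[OF lead_ideal[OF Iid]] by blast
  have "\<forall>a\<in>A. \<exists>q. q \<in> below_degree V v D \<and> a * ?x ^ D + q \<in> I"
    using RM.R.genideal_self[OF A(1)] A(3) by (auto simp: lead_def)
  then obtain q where q: "\<And>a. a \<in> A \<Longrightarrow> q a \<in> below_degree V v D" "\<And>a. a \<in> A \<Longrightarrow> a * ?x ^ D + q a \<in> I"
    by metis
  have sub: "submodule (I \<inter> below_degree V v D) ?R all_polys"
    using I RT by (intro submodule_all_polysI) (auto simp: below_degree_zero below_degree_add below_degree_smult)
  have span: "I \<inter> below_degree V v D \<subseteq> mspan ?R all_polys ((\<lambda>e. ?x ^ e) ` {..<D})"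
    using below_degree_span by blast
  obtain G where G: "finite G" "G \<subseteq> I \<inter> below_degree V v D"
    "mspan ?R all_polys G = I \<inter> below_degree V v D"
    using RM.submodule_of_fin_gen[OF R, OF _ _ sub span] by (metis (no_types) all_polys_sel(1) finite_imageI finite_lessThan subset_UNIV)
  (* The generators of I: those of its part of degree below D over the smaller ring, and one element
     of degree D for each generator of the ideal of leading coefficients. *)
  define B where "B = G \<union> (\<lambda>a. a * ?x ^ D + q a) ` A"
  have B: "finite B" "B \<subseteq> I" "B \<subseteq> carrier ?T" using G A q I(1) by (auto simp: B_def)
  let ?J = "Idl\<^bsub>?T\<^esub> B"
  have J: "ideal ?J ?T" by (rule T.genideal_ideal[OF B(3)])
  have J': "?J \<subseteq> carrier ?T" "0 \<in> ?J" "\<And>f g. f \<in> ?J \<Longrightarrow> g \<in> ?J \<Longrightarrow> f + g \<in> ?J"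
    "\<And>r f. r \<in> carrier ?T \<Longrightarrow> f \<in> ?J \<Longrightarrow> r * f \<in> ?J" using J unfolding ideal_poly_ring_iff by blast+
  have BJ: "B \<subseteq> ?J" by (rule T.genideal_self[OF B(3)])
  have "?J \<subseteq> I" by (rule T.genideal_minimal[OF Iid B(2)])
  moreover have "submodule ?J ?R all_polys"
    using J' RT by (intro submodule_all_polysI) blast+
  then have low: "I \<inter> below_degree V v D \<subseteq> ?J"
    unfolding G(3)[symmetric] using BJ by (intro mspan_minimal) (auto simp: B_def)
  have "A \<subseteq> lead ?J D"
    using A(1) q(1) BJ unfolding lead_def B_def by blast
  then have top: "lead I D \<subseteq> lead ?J D"
    unfolding A(3) by (rule RM.R.genideal_minimal[OF lead_ideal[OF J]])
  have high: "f \<in> I \<Longrightarrow> f \<in> below_degree V v (D + e) \<Longrightarrow> f \<in> ?J" for f e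
  proof (induction e arbitrary: f)
    case 0
    then show ?case using low by auto
  next
    case (Suc e)
    then obtain c p where cp: "f = c * ?x ^ (D + e) + p" "c \<in> carrier ?R" "p \<in> below_degree V v (D + e)" by auto
    then have "c \<in> lead I (D + e)" using Suc.prems by (auto simp: lead_def)
    then have "c \<in> lead ?J (D + e)" using D top lead_mono[OF J, of D "D + e"] by auto
    then obtain p' where p': "p' \<in> below_degree V v (D + e)" "c * ?x ^ (D + e) + p' \<in> ?J"
      by (auto simp: lead_def)
    let ?h = "c * ?x ^ (D + e) + p'"
    (* The element ?h of the ideal generated by B has the leading term of f. *)
    have fh: "f = ?h + (f + (- 1) * ?h)" by simp
    have m1: "- 1 \<in> carrier ?T" "- 1 \<in> carrier ?R" by (simp_all add: poly_ring_uminus)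
    have "f + (- 1) * ?h \<in> I"
      using I(3,4) m1 Suc.prems(1) p'(2) \<open>?J \<subseteq> I\<close> by blast
    moreover have "f + (- 1) * ?h = p + (- 1) * p'" by (simp add: cp)
    moreover have "p + (- 1) * p' \<in> below_degree V v (D + e)"
      by (intro below_degree_add below_degree_smult cp p' m1)
    ultimately have "f + (- 1) * ?h \<in> ?J" using Suc.IH by metis
    then show ?case using J'(3)[OF p'(2)] fh by metis
  qed
  have "I \<subseteq> ?J"
  proof
    fix f assume f: "f \<in> I"
    then obtain d where "f \<in> below_degree V v d" using I(1) below_degree_exists by blast
    then have "f \<in> below_degree V v (D + d)" using below_degree_mono[of d "D + d" V v] by auto
    then show "f \<in> ?J" using high f by blast
  qed
  ultimately show "\<exists>A\<subseteq>carrier ?T. finite A \<and> I = Idl\<^bsub>?T\<^esub> A" using B by blast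
qed

theorem noetherian_poly_ring:
  assumes "finite V"
  shows "noetherian_ring (poly_ring V :: ('k::field) mpoly ring)"
  using assms
proof (induction V)
  case empty
  let ?K = "poly_ring {} :: 'k mpoly ring"
  interpret C: cring ?K by (rule cring_poly_ring)
  show ?case
  proof (rule C.noetherian_ringI)
    fix I assume I: "ideal I ?K"
    then have I': "I \<subseteq> carrier ?K" "0 \<in> I" "\<And>r f. r \<in> carrier ?K \<Longrightarrow> f \<in> I \<Longrightarrow> r * f \<in> I"
      unfolding ideal_poly_ring_iff by blast+
    (* The polynomials without variables form a field, whose only ideals are 0 and the whole ring. *)
    have car: "f = mpoly_const (Poly_Mapping.lookup f 0)" if "f \<in> carrier ?K" for f
    proof (rule poly_mapping_eqI)
      fix t show "Poly_Mapping.lookup f t = Poly_Mapping.lookup (mpoly_const (Poly_Mapping.lookup f 0)) t"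
        using that by (cases "t = 0") (auto simp: carrier_poly_ring mpoly_const_def lookup_single in_keys_iff)
    qed
    show "\<exists>A\<subseteq>carrier ?K. finite A \<and> I = Idl\<^bsub>?K\<^esub> A"
    proof (cases "I = {0}")
      case True
      then show ?thesis using C.genideal_zero by (intro exI[of _ "{0}"]) auto
    next
      case False
      then obtain f where f: "f \<in> I" "f \<noteq> 0" using I' by blast
      then have "Poly_Mapping.lookup f 0 \<noteq> 0"
        using car[of f] I'(1) mpoly_const_0 by (metis subsetD)
      then have "mpoly_const (inverse (Poly_Mapping.lookup f 0)) * f = 1"
        using car[of f] I'(1) f(1) by (metis mpoly_const_1 mpoly_const_mult left_inverse subsetD)
      then have "1 \<in> I" using I'(3)[OF poly_ring_const f(1)] by metis
      then have "I = carrier ?K" using I'(1) I'(3)[of _ 1] by auto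
      then show ?thesis using C.genideal_one by (intro exI[of _ "{1}"]) auto
    qed
  qed
next
  case (insert v V)
  then show ?case using noetherian_insert_var by blast
qed

section \<open>Homogeneous components\<close>

lemma subgroup_add_zero: "subgroup H (add_monoid M) \<Longrightarrow> \<zero>\<^bsub>M\<^esub> \<in> H"
  using subgroup.one_closed by fastforce

lemma subgroup_add_add: "subgroup H (add_monoid M) \<Longrightarrow> x \<in> H \<Longrightarrow> y \<in> H \<Longrightarrow> x \<oplus>\<^bsub>M\<^esub> y \<in> H"
  using subgroup.m_closed by fastforce

lemma subgroup_add_minus: "subgroup H (add_monoid M) \<Longrightarrow> x \<in> H \<Longrightarrow> \<ominus>\<^bsub>M\<^esub> x \<in> H"
  using subgroup.m_inv_closed by (fastforce simp: a_inv_def)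

lemma subgroup_add_subset: "subgroup H (add_monoid M) \<Longrightarrow> H \<subseteq> carrier M"
  using subgroup.subset by fastforce

lemma (in abelian_group) subgroup_addI:
  assumes "H \<subseteq> carrier G" "\<zero> \<in> H" "\<And>x y. x \<in> H \<Longrightarrow> y \<in> H \<Longrightarrow> x \<oplus> y \<in> H" "\<And>x. x \<in> H \<Longrightarrow> \<ominus> x \<in> H"
  shows "subgroup H (add_monoid G)"
  using assms by (intro subgroup.intro) (auto simp: a_inv_def)

lemma (in abelian_group) subgroup_finsum:
  assumes H: "subgroup H (add_monoid G)" and c: "\<And>i. i \<in> I \<Longrightarrow> c i \<in> H"
  shows "finsum G c I \<in> H"
  using c
proof (induction I rule: infinite_finite_induct)
  case (insert i I)
  then have "c \<in> I \<rightarrow> carrier G" "c i \<in> carrier G" using subgroup_add_subset[OF H] by auto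
  then show ?case using insert subgroup_add_add[OF H] by simp
qed (simp_all add: subgroup_add_zero[OF H])

context graded_module
begin

definition component :: "'b \<Rightarrow> 'g \<Rightarrow> 'b" where
  "component x = (THE c. (\<forall>g. c g \<in> MG g) \<and> finite {g. c g \<noteq> \<zero>\<^bsub>M\<^esub>} \<and> x = (\<Oplus>\<^bsub>M\<^esub>g\<in>{g. c g \<noteq> \<zero>\<^bsub>M\<^esub>}. c g))"

lemma comp_subset: "MG g \<subseteq> carrier M"
  by (rule subgroup_add_subset[OF comp_subgroup])

lemma comp_carrier: "x \<in> MG g \<Longrightarrow> x \<in> carrier M"
  using comp_subset by blast

lemmas comp_zero = subgroup_add_zero[OF comp_subgroup]
lemmas comp_add = subgroup_add_add[OF comp_subgroup]
lemmas comp_minus = subgroup_add_minus[OF comp_subgroup]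

lemma component_props:
  assumes "x \<in> carrier M"
  shows "(\<forall>g. component x g \<in> MG g) \<and> finite {g. component x g \<noteq> \<zero>\<^bsub>M\<^esub>}
    \<and> x = (\<Oplus>\<^bsub>M\<^esub>g\<in>{g. component x g \<noteq> \<zero>\<^bsub>M\<^esub>}. component x g)"
  unfolding component_def by (rule theI'[OF direct_sum[OF assms]])

lemma component_in: "x \<in> carrier M \<Longrightarrow> component x g \<in> MG g"
  using component_props by blast

lemma component_closed: "x \<in> carrier M \<Longrightarrow> component x g \<in> carrier M"
  using component_in comp_carrier by blast

lemma finite_components: "x \<in> carrier M \<Longrightarrow> finite {g. component x g \<noteq> \<zero>\<^bsub>M\<^esub>}"
  using component_props by blast

lemma sum_components: "x \<in> carrier M \<Longrightarrow> x = (\<Oplus>\<^bsub>M\<^esub>g\<in>{g. component x g \<noteq> \<zero>\<^bsub>M\<^esub>}. component x g)"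
  using component_props by blast

lemma sum_components_superset:
  assumes "x \<in> carrier M" "finite I" "{g. component x g \<noteq> \<zero>\<^bsub>M\<^esub>} \<subseteq> I"
  shows "x = (\<Oplus>\<^bsub>M\<^esub>g\<in>I. component x g)"
proof -
  have "x = (\<Oplus>\<^bsub>M\<^esub>g\<in>{g. component x g \<noteq> \<zero>\<^bsub>M\<^esub>}. component x g)" by (rule sum_components[OF assms(1)])
  also have "\<dots> = (\<Oplus>\<^bsub>M\<^esub>g\<in>I. component x g)"
    by (rule M.add.finprod_mono_neutral_cong_left) (use assms in \<open>auto simp: component_closed\<close>)
  finally show ?thesis .
qed

lemma component_eqI:
  assumes I: "finite I" and c: "\<And>g. g \<in> I \<Longrightarrow> c g \<in> MG g" and x: "x = (\<Oplus>\<^bsub>M\<^esub>g\<in>I. c g)"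
  shows "component x g = (if g \<in> I then c g else \<zero>\<^bsub>M\<^esub>)"
proof -
  define c' where "c' g = (if g \<in> I then c g else \<zero>\<^bsub>M\<^esub>)" for g
  have fin: "finite {g. c' g \<noteq> \<zero>\<^bsub>M\<^esub>}" by (rule finite_subset[OF _ I]) (auto simp: c'_def split: if_splits)
  have cc: "c \<in> I \<rightarrow> carrier M" using c comp_carrier by blast
  then have xc: "x \<in> carrier M" unfolding x by (rule M.finsum_closed)
  have "x = (\<Oplus>\<^bsub>M\<^esub>g\<in>{g. c' g \<noteq> \<zero>\<^bsub>M\<^esub>}. c' g)"
    unfolding x
  proof (rule M.add.finprod_mono_neutral_cong_right[OF I _ _ _ cc])
    show "{g. c' g \<noteq> \<zero>\<^bsub>M\<^esub>} \<subseteq> I" by (auto simp: c'_def split: if_splits)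
    show "c g = \<zero>\<^bsub>M\<^esub>" if "g \<in> I - {g. c' g \<noteq> \<zero>\<^bsub>M\<^esub>}" for g
      using that by (auto simp: c'_def)
    show "c g = c' g" if "g \<in> {g. c' g \<noteq> \<zero>\<^bsub>M\<^esub>}" for g
      using that by (auto simp: c'_def split: if_splits)
  qed
  moreover have "\<forall>g. c' g \<in> MG g" using c comp_zero by (simp add: c'_def)
  ultimately have c_props: "(\<forall>g. c' g \<in> MG g) \<and> finite {g. c' g \<noteq> \<zero>\<^bsub>M\<^esub>} \<and> x = (\<Oplus>\<^bsub>M\<^esub>g\<in>{g. c' g \<noteq> \<zero>\<^bsub>M\<^esub>}. c' g)"
    using fin by (intro conjI)
  have "component x = c'"
    unfolding component_def by (rule the1_equality, rule direct_sum[OF xc], rule c_props)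
  then show ?thesis by (simp add: c'_def)
qed

lemma component_homogeneous:
  assumes "x \<in> MG g"
  shows "component x h = (if h = g then x else \<zero>\<^bsub>M\<^esub>)"
  using component_eqI[of "{g}" "\<lambda>_. x" x h] assms comp_carrier[OF assms] by simp

lemma component_zero: "component \<zero>\<^bsub>M\<^esub> g = \<zero>\<^bsub>M\<^esub>"
  using component_homogeneous[OF comp_zero] by auto

lemma component_add:
  assumes x: "x \<in> carrier M" and y: "y \<in> carrier M"
  shows "component (x \<oplus>\<^bsub>M\<^esub> y) g = component x g \<oplus>\<^bsub>M\<^esub> component y g"
proof -
  let ?I = "{g. component x g \<noteq> \<zero>\<^bsub>M\<^esub>} \<union> {g. component y g \<noteq> \<zero>\<^bsub>M\<^esub>}"
  have I: "finite ?I" using x y finite_components by simp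
  have "x \<oplus>\<^bsub>M\<^esub> y = (\<Oplus>\<^bsub>M\<^esub>g\<in>?I. component x g) \<oplus>\<^bsub>M\<^esub> (\<Oplus>\<^bsub>M\<^esub>g\<in>?I. component y g)"
    using sum_components_superset[OF x I] sum_components_superset[OF y I] by auto
  also have "\<dots> = (\<Oplus>\<^bsub>M\<^esub>g\<in>?I. component x g \<oplus>\<^bsub>M\<^esub> component y g)"
    by (rule M.finsum_addf[symmetric]) (use x y component_closed in auto)
  finally have "component (x \<oplus>\<^bsub>M\<^esub> y) g = (if g \<in> ?I then component x g \<oplus>\<^bsub>M\<^esub> component y g else \<zero>\<^bsub>M\<^esub>)"
    by (intro component_eqI I) (simp_all add: comp_add component_in x y)
  then show ?thesis by (auto split: if_splits)
qed

lemma component_minus: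
  assumes x: "x \<in> carrier M"
  shows "component (\<ominus>\<^bsub>M\<^esub> x) g = \<ominus>\<^bsub>M\<^esub> component x g"
proof -
  have "component (\<ominus>\<^bsub>M\<^esub> x) g \<oplus>\<^bsub>M\<^esub> component x g = \<zero>\<^bsub>M\<^esub>"
    using component_add[of "\<ominus>\<^bsub>M\<^esub> x" x] x component_zero by (simp add: M.l_neg)
  then show ?thesis
    using M.minus_equality component_closed x by simp
qed

lemma component_smult:
  assumes a: "a \<in> carrier R" "a \<in> RG g" and x: "x \<in> carrier M"
  shows "component (a \<odot>\<^bsub>M\<^esub> x) h = a \<odot>\<^bsub>M\<^esub> component x (h - g)"
proof -
  let ?I = "{h. component x h \<noteq> \<zero>\<^bsub>M\<^esub>}"
  have I: "finite ?I" using x finite_components by simp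
  have cl: "component x \<in> ?I \<rightarrow> carrier M" using component_closed x by auto
  have "a \<odot>\<^bsub>M\<^esub> x = (\<Oplus>\<^bsub>M\<^esub>h\<in>?I. a \<odot>\<^bsub>M\<^esub> component x h)"
    using sum_components[OF x] finsum_smult_ldistr[OF I a(1) cl] by simp
  also have "\<dots> = (\<Oplus>\<^bsub>M\<^esub>h\<in>((\<lambda>h. g + h) ` ?I). a \<odot>\<^bsub>M\<^esub> component x (h - g))"
    by (subst M.add.finprod_reindex) (use a x component_closed in auto)
  finally have "component (a \<odot>\<^bsub>M\<^esub> x) h
      = (if h \<in> (\<lambda>h. g + h) ` ?I then a \<odot>\<^bsub>M\<^esub> component x (h - g) else \<zero>\<^bsub>M\<^esub>)"
  proof (intro component_eqI)
    show "a \<odot>\<^bsub>M\<^esub> component x (k - g) \<in> MG k" for k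
      using comp_smult[OF a(2) component_in[OF x], of "k - g"] by simp
  qed (simp add: I)
  moreover have "component x (h - g) = \<zero>\<^bsub>M\<^esub>" if "h \<notin> (\<lambda>h. g + h) ` ?I"
  proof (rule ccontr)
    assume "component x (h - g) \<noteq> \<zero>\<^bsub>M\<^esub>"
    then have "g + (h - g) \<in> (\<lambda>h. g + h) ` ?I" by blast
    then show False using that by simp
  qed
  ultimately show ?thesis using a by simp
qed

lemma mem_if_components_mem:
  assumes H: "subgroup H (add_monoid M)" and x: "x \<in> carrier M" and c: "\<And>g. component x g \<in> H"
  shows "x \<in> H"
  by (subst sum_components[OF x]) (rule M.subgroup_finsum[OF H c])

end

text \<open>Given candidates \<open>pr g\<close> for the projections onto the components, uniqueness of a decomposition
  follows by applying them to it, and existence has to be known for additive generators only: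
  being the finite sum of one's projections is inherited by sums.\<close>

lemma graded_moduleI:
  fixes RG :: "'g::ab_group_add \<Rightarrow> 'a set"
  assumes M: "Module.module R M"
    and sub: "\<And>g. subgroup (MG g) (add_monoid M)"
    and smult: "\<And>a x g h. a \<in> RG g \<Longrightarrow> x \<in> MG h \<Longrightarrow> a \<odot>\<^bsub>M\<^esub> x \<in> MG (g + h)"
    and pr_add: "\<And>g x y. x \<in> carrier M \<Longrightarrow> y \<in> carrier M \<Longrightarrow> pr g (x \<oplus>\<^bsub>M\<^esub> y) = pr g x \<oplus>\<^bsub>M\<^esub> pr g y"
    and pr_in: "\<And>g x. x \<in> carrier M \<Longrightarrow> pr g x \<in> MG g"
    and pr_same: "\<And>g x. x \<in> MG g \<Longrightarrow> pr g x = x"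
    and pr_other: "\<And>g h x. x \<in> MG g \<Longrightarrow> h \<noteq> g \<Longrightarrow> pr h x = \<zero>\<^bsub>M\<^esub>"
    and gen: "carrier M \<subseteq> generate (add_monoid M) (\<Union>g. MG g)"
  shows "graded_module R M RG MG"
proof -
  interpret Module.module R M by (rule M)
  have car: "x \<in> MG g \<Longrightarrow> x \<in> carrier M" for x g using subgroup_add_subset[OF sub] by blast
  have pr_car: "x \<in> carrier M \<Longrightarrow> pr g x \<in> carrier M" for g x using pr_in car by blast
  have pr_zero: "pr g \<zero>\<^bsub>M\<^esub> = \<zero>\<^bsub>M\<^esub>" for g
    using pr_same subgroup_add_zero[OF sub] by blast
  have pr_sum: "pr g (finsum M c I) = (\<Oplus>\<^bsub>M\<^esub>i\<in>I. pr g (c i))"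
    if "finite I" "c \<in> I \<rightarrow> carrier M" for I and c :: "'g \<Rightarrow> 'c" and g
    using that
    by (induction I) (auto simp: pr_zero pr_add pr_car Pi_def)
  (* Asking for equality over every finite superset J of I makes two decompositions comparable. *)
  define decomposed where "decomposed I x \<longleftrightarrow> finite I \<and> (\<forall>g. g \<notin> I \<longrightarrow> pr g x = \<zero>\<^bsub>M\<^esub>)
      \<and> (\<forall>J. finite J \<longrightarrow> I \<subseteq> J \<longrightarrow> x = (\<Oplus>\<^bsub>M\<^esub>g\<in>J. pr g x)) \<and> x \<in> carrier M" for I x
  have homogeneous: "decomposed {g} x" if g: "x \<in> MG g" for g x
  proof -
    have "x = (\<Oplus>\<^bsub>M\<^esub>h\<in>J. pr h x)" if "finite J" "{g} \<subseteq> J" for J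
    proof -
      have "(\<Oplus>\<^bsub>M\<^esub>h\<in>J. pr h x) = (\<Oplus>\<^bsub>M\<^esub>h\<in>{g}. x)"
        by (rule M.add.finprod_mono_neutral_cong_right)
          (use that pr_other[OF g] pr_same[OF g] car[OF g] pr_car in auto)
      then show ?thesis using car[OF g] by simp
    qed
    then show ?thesis using pr_other[OF g] car[OF g] by (simp add: decomposed_def)
  qed
  have ex: "\<exists>I. decomposed I x" if "x \<in> generate (add_monoid M) (\<Union>g. MG g)" for x
    using that
  proof induction
    case one
    show ?case
      using homogeneous[OF subgroup_add_zero[OF sub]] by auto
  next
    case (incl x)
    then show ?case using homogeneous by blast
  next
    case (inv x)
    then obtain g where "x \<in> MG g" by blast
    then have "inv\<^bsub>add_monoid M\<^esub> x \<in> MG g" using subgroup_add_minus[OF sub] by (simp add: a_inv_def)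
    then show ?case using homogeneous by blast
  next
    case (eng x y)
    from eng.IH(1) obtain I where
      I: "finite I" "\<forall>g. g \<notin> I \<longrightarrow> pr g x = \<zero>\<^bsub>M\<^esub>" "\<forall>J. finite J \<longrightarrow> I \<subseteq> J \<longrightarrow> x = (\<Oplus>\<^bsub>M\<^esub>g\<in>J. pr g x)" "x \<in> carrier M"
      unfolding decomposed_def by (elim exE conjE) (rule that)
    from eng.IH(2) obtain J where
      J: "finite J" "\<forall>g. g \<notin> J \<longrightarrow> pr g y = \<zero>\<^bsub>M\<^esub>" "\<forall>I. finite I \<longrightarrow> J \<subseteq> I \<longrightarrow> y = (\<Oplus>\<^bsub>M\<^esub>g\<in>I. pr g y)" "y \<in> carrier M"
      unfolding decomposed_def by (elim exE conjE) (rule that)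
    have "x \<oplus>\<^bsub>M\<^esub> y = (\<Oplus>\<^bsub>M\<^esub>g\<in>K. pr g (x \<oplus>\<^bsub>M\<^esub> y))" if "finite K" "I \<union> J \<subseteq> K" for K
    proof -
      have "(\<Oplus>\<^bsub>M\<^esub>g\<in>K. pr g (x \<oplus>\<^bsub>M\<^esub> y)) = (\<Oplus>\<^bsub>M\<^esub>g\<in>K. pr g x \<oplus>\<^bsub>M\<^esub> pr g y)"
        by (rule M.finsum_cong') (use I(4) J(4) pr_add pr_car in auto)
      also have "\<dots> = (\<Oplus>\<^bsub>M\<^esub>g\<in>K. pr g x) \<oplus>\<^bsub>M\<^esub> (\<Oplus>\<^bsub>M\<^esub>g\<in>K. pr g y)"
        by (rule M.finsum_addf) (use I(4) J(4) pr_car in auto)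
      also have "(\<Oplus>\<^bsub>M\<^esub>g\<in>K. pr g x) = x" using I(3) that by simp
      also have "(\<Oplus>\<^bsub>M\<^esub>g\<in>K. pr g y) = y" using J(3) that by simp
      finally show ?thesis by (rule sym)
    qed
    moreover have "pr g (x \<oplus>\<^bsub>M\<^esub> y) = \<zero>\<^bsub>M\<^esub>" if "g \<notin> I \<union> J" for g
      using that I(2,4) J(2,4) pr_add by simp
    moreover have "x \<oplus>\<^bsub>M\<^esub> y \<in> carrier M" "finite (I \<union> J)" using I J by auto
    moreover have "x \<otimes>\<^bsub>add_monoid M\<^esub> y = x \<oplus>\<^bsub>M\<^esub> y" by simp
    ultimately have "decomposed (I \<union> J) (x \<otimes>\<^bsub>add_monoid M\<^esub> y)"
      unfolding decomposed_def by simp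
    then show ?case by blast
  qed
  show ?thesis
  proof (intro graded_module.intro graded_module_axioms.intro M sub smult)
    fix x assume x: "x \<in> carrier M"
    then obtain I where I: "finite I" "\<forall>g. g \<notin> I \<longrightarrow> pr g x = \<zero>\<^bsub>M\<^esub>"
      "\<forall>J. finite J \<longrightarrow> I \<subseteq> J \<longrightarrow> x = (\<Oplus>\<^bsub>M\<^esub>g\<in>J. pr g x)"
      using ex[OF subsetD[OF gen x]] unfolding decomposed_def by blast
    let ?S = "{g. pr g x \<noteq> \<zero>\<^bsub>M\<^esub>}"
    have S: "finite ?S" by (rule finite_subset[OF _ I(1)]) (use I(2) in auto)
    have "(\<Oplus>\<^bsub>M\<^esub>g\<in>I. pr g x) = (\<Oplus>\<^bsub>M\<^esub>g\<in>?S. pr g x)"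
      by (rule M.add.finprod_mono_neutral_cong_right) (use I pr_car x in auto)
    then have eq: "x = (\<Oplus>\<^bsub>M\<^esub>g\<in>?S. pr g x)" using I by auto
    show "\<exists>!c. (\<forall>g. c g \<in> MG g) \<and> finite {g. c g \<noteq> \<zero>\<^bsub>M\<^esub>} \<and> x = (\<Oplus>\<^bsub>M\<^esub>g\<in>{g. c g \<noteq> \<zero>\<^bsub>M\<^esub>}. c g)"
    proof (rule ex1I[of _ "\<lambda>g. pr g x"])
      show "(\<forall>g. pr g x \<in> MG g) \<and> finite ?S \<and> x = (\<Oplus>\<^bsub>M\<^esub>g\<in>?S. pr g x)"
        using pr_in x S eq by blast
    next
      fix c assume c: "(\<forall>g. c g \<in> MG g) \<and> finite {g. c g \<noteq> \<zero>\<^bsub>M\<^esub>} \<and> x = (\<Oplus>\<^bsub>M\<^esub>g\<in>{g. c g \<noteq> \<zero>\<^bsub>M\<^esub>}. c g)"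
      let ?C = "{g. c g \<noteq> \<zero>\<^bsub>M\<^esub>}"
      have cc: "c g \<in> carrier M" for g using c car by blast
      show "c = (\<lambda>g. pr g x)"
      proof
        fix h
        have fC: "finite (insert h ?C)" using c by simp
        have other: "pr h (c g) = \<zero>\<^bsub>M\<^esub>" if "g \<noteq> h" for g
          using pr_other[of "c g" g h] c that by blast
        have same: "pr h (c h) = c h" using pr_same c by blast
        have "x = (\<Oplus>\<^bsub>M\<^esub>g\<in>?C. c g)" using c by blast
        also have "\<dots> = (\<Oplus>\<^bsub>M\<^esub>g\<in>insert h ?C. c g)"
          by (rule M.add.finprod_mono_neutral_cong_left) (use fC cc in auto)
        finally have "pr h x = (\<Oplus>\<^bsub>M\<^esub>g\<in>insert h ?C. pr h (c g))"
          using pr_sum[OF fC] cc by simp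
        also have "\<dots> = (\<Oplus>\<^bsub>M\<^esub>g\<in>{h}. c g)"
          by (rule M.add.finprod_mono_neutral_cong_right)
            (use fC other same cc pr_car in auto)
        finally show "c h = pr h x" using cc by simp
      qed
    qed
  qed
qed

text \<open>The components of the members of a finite set of generators generate as well, and there are
  finitely many of them.\<close>

lemma (in graded_module) homogeneous_generators:
  assumes "fin_gen R M"
  obtains G where "finite G" "G \<subseteq> (\<Union>g. MG g)" "mspan R M G = carrier M"
proof -
  obtain G where G: "finite G" "G \<subseteq> carrier M" "mspan R M G = carrier M"
    using assms by (auto simp: fin_gen_mspan)
  define G' where "G' = (\<Union>x\<in>G. component x ` {g. component x g \<noteq> \<zero>\<^bsub>M\<^esub>})"
  have G': "finite G'"
    using G finite_components unfolding G'_def by blast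
  have "component x g \<in> (\<Union>h. MG h)" if "x \<in> G" for x g
    using component_in[of x g] G(2) that by blast
  then have G'h: "G' \<subseteq> (\<Union>g. MG g)" unfolding G'_def by blast
  have G'c: "G' \<subseteq> carrier M" using G component_closed by (auto simp: G'_def)
  have s: "submodule (mspan R M G') R M" by (rule mspan_submodule[OF G'c])
  have "G \<subseteq> mspan R M G'"
  proof
    fix x assume x: "x \<in> G"
    then have xc: "x \<in> carrier M" using G by blast
    have "component x g \<in> mspan R M G'" for g
      using x mspan_incl[of G' R M] submodule_zero[OF s]
      by (cases "component x g = \<zero>\<^bsub>M\<^esub>") (auto simp: G'_def)
    then show "x \<in> mspan R M G'"
      by (rule mem_if_components_mem[OF submodule.axioms(1)[OF s] xc])
  qed
  then have "carrier M \<subseteq> mspan R M G'" using mspan_mono[OF _ G'c] G(3) by blast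
  moreover have "mspan R M G' \<subseteq> carrier M" using submoduleE(1)[OF s] .
  ultimately show thesis using that G' G'h by blast
qed

text \<open>The induction principle for homogeneous elements: the elements whose components all lie in the
  family \<open>H\<close> form a submodule, since multiplication by a constant or a variable maps components to
  components; so it is enough that this submodule contains homogeneous generators.\<close>

lemma components_in_family:
  fixes w :: "pvar \<Rightarrow> 'g::ab_group_add" and RG :: "'g \<Rightarrow> ('k::field) mpoly set"
  assumes gr: "graded_module (poly_ring V) M RG MG"
    and const: "\<And>c. mpoly_const c \<in> RG 0" and var: "\<And>v. v \<in> V \<Longrightarrow> mpoly_var v \<in> RG (w v)"
    and gen: "G \<subseteq> carrier M" "mspan (poly_ring V) M G = carrier M"
    and G: "\<And>x. x \<in> G \<Longrightarrow> \<exists>g. x \<in> MG g \<and> x \<in> H g"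
    and H: "\<And>g. subgroup (H g) (add_monoid M)"
    and H_const: "\<And>c g x. x \<in> H g \<Longrightarrow> mpoly_const c \<odot>\<^bsub>M\<^esub> x \<in> H g"
    and H_var: "\<And>v g x. v \<in> V \<Longrightarrow> x \<in> H g \<Longrightarrow> mpoly_var v \<odot>\<^bsub>M\<^esub> x \<in> H (w v + g)"
    and x: "x \<in> carrier M"
  shows "graded_module.component M MG x g \<in> H g"
proof -
  interpret graded_module "poly_ring V" M RG MG by (rule gr)
  define K where "K = {x \<in> carrier M. \<forall>g. component x g \<in> H g}"
  have smult: "a \<odot>\<^bsub>M\<^esub> x \<in> K" if "a \<in> carrier (poly_ring V)" "x \<in> K" for a x
    using that
  proof (induction a arbitrary: x rule: poly_ring_induct)
    case (const c)
    then show ?case using assms(2) H_const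
      by (auto simp: K_def component_smult[of _ 0])
  next
    case (var v)
    have "component (mpoly_var v \<odot>\<^bsub>M\<^esub> x) g \<in> H g" for g
      using component_smult[OF poly_ring_var assms(3), of v x g] var H_var[of v "component x (g - w v)" "g - w v"]
      by (simp add: K_def)
    then show ?case using var poly_ring_var by (auto simp: K_def)
  next
    case (add a b)
    then have "(a \<oplus>\<^bsub>poly_ring V\<^esub> b) \<odot>\<^bsub>M\<^esub> x = a \<odot>\<^bsub>M\<^esub> x \<oplus>\<^bsub>M\<^esub> b \<odot>\<^bsub>M\<^esub> x"
      by (intro smult_l_distr) (auto simp: K_def)
    moreover have "a \<odot>\<^bsub>M\<^esub> x \<in> K" "b \<odot>\<^bsub>M\<^esub> x \<in> K" using add by auto
    ultimately show ?case using subgroup_add_add[OF H] by (simp add: K_def component_add)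
  next
    case (mult a b)
    then have "(a \<otimes>\<^bsub>poly_ring V\<^esub> b) \<odot>\<^bsub>M\<^esub> x = a \<odot>\<^bsub>M\<^esub> (b \<odot>\<^bsub>M\<^esub> x)"
      by (intro smult_assoc1) (auto simp: K_def)
    then show ?case using mult by simp
  qed
  have "submodule K (poly_ring V) M"
    using subgroup_add_zero[OF H] subgroup_add_add[OF H] subgroup_add_minus[OF H] smult
    by (intro submoduleI) (auto simp: K_def component_zero component_add component_minus)
  moreover have "G \<subseteq> K"
  proof
    fix x assume xG: "x \<in> G"
    then obtain h where h: "x \<in> MG h" "x \<in> H h" using G by blast
    then show "x \<in> K"
      using subgroup_add_zero[OF H] comp_carrier[OF h(1)] by (auto simp: K_def component_homogeneous)
  qed
  ultimately have "carrier M \<subseteq> K" using gen(2) mspan_minimal by blast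
  then show ?thesis using x by (auto simp: K_def)
qed

section \<open>Restriction of scalars and of the carrier\<close>

lemma module_restrict_scalars:
  assumes "Module.module (poly_ring V') M" "V \<subseteq> V'"
  shows "Module.module (poly_ring V) M"
proof -
  interpret Module.module "poly_ring V'" M by fact
  have c: "a \<in> carrier (poly_ring V) \<Longrightarrow> a \<in> carrier (poly_ring V')" for a
    using poly_ring_mono[OF assms(2)] by blast
  show ?thesis
    using smult_l_distr smult_r_distr smult_assoc1 smult_one
    by (intro moduleI cring_poly_ring M.abelian_group_axioms) (auto dest!: c)
qed

context Module.module
begin

lemma submodule_restrict_carrier:
  assumes "submodule W R M" "submodule H R M" "H \<subseteq> W"
  shows "submodule H R (M\<lparr>carrier := W\<rparr>)"
  using M.add.subgroup_incl[OF submodule.axioms(1) submodule.axioms(1), OF assms(2,1,3)] submoduleE(4)[OF assms(2)]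
  by (intro submodule.intro submodule_axioms.intro) simp_all

lemma submodule_extend_carrier:
  assumes "submodule W R M" "submodule H R (M\<lparr>carrier := W\<rparr>)"
  shows "submodule H R M"
  using M.add.incl_subgroup[OF submodule.axioms(1)[OF assms(1)], of H]
    submodule.axioms(1)[OF assms(2)] submodule.smult_closed[OF assms(2)]
  by (intro submodule.intro submodule_axioms.intro) simp_all

lemma mspan_restrict_carrier:
  assumes W: "submodule W R M" and G: "G \<subseteq> W"
  shows "mspan R (M\<lparr>carrier := W\<rparr>) G = mspan R M G"
proof
  have Gc: "G \<subseteq> carrier M" using G submoduleE(1)[OF W] by blast
  have "mspan R M G \<subseteq> W" by (rule mspan_minimal[OF W G])
  then show "mspan R (M\<lparr>carrier := W\<rparr>) G \<subseteq> mspan R M G"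
    by (intro mspan_minimal[OF submodule_restrict_carrier] mspan_incl W mspan_submodule Gc)
  show "mspan R M G \<subseteq> mspan R (M\<lparr>carrier := W\<rparr>) G"
    using submodule_extend_carrier[OF W] unfolding mspan_def by blast
qed

end

text \<open>The component maps of \<open>M\<close> restrict to such a submodule and are its projections.\<close>

lemma (in graded_module) graded_submodule:
  assumes W: "submodule W R M" and comp: "\<And>x g. x \<in> W \<Longrightarrow> component x g \<in> W"
    and RG: "\<And>g. RG g \<subseteq> carrier R"
  shows "graded_module R (M\<lparr>carrier := W\<rparr>) RG (\<lambda>g. W \<inter> MG g)"
proof (rule graded_moduleI[where pr = "\<lambda>g x. component x g"])
  note s = submoduleE[OF W]
  let ?W = "M\<lparr>carrier := W\<rparr>"
  have WM: "x \<in> W \<Longrightarrow> x \<in> carrier M" for x using s(1) by blast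
  have sub: "subgroup (W \<inter> MG g) (add_monoid M)" for g
    using submodule.axioms(1)[OF W] comp_subgroup by (rule M.add.subgroups_Inter_pair)
  show "Module.module R ?W" using submodule.submodule_is_module[OF W module_axioms] .
  show "subgroup (W \<inter> MG g) (add_monoid ?W)" for g
    using M.add.subgroup_incl[OF sub submodule.axioms(1)[OF W]] by simp
  show "a \<odot>\<^bsub>?W\<^esub> x \<in> W \<inter> MG (g + h)" if "a \<in> RG g" "x \<in> W \<inter> MG h" for a x g h
    using that s(4)[OF subsetD[OF RG]] comp_smult by auto
  show "component (x \<oplus>\<^bsub>?W\<^esub> y) g = component x g \<oplus>\<^bsub>?W\<^esub> component y g"
    if "x \<in> carrier ?W" "y \<in> carrier ?W" for g x y
    using that WM by (simp add: component_add)
  show "component x g \<in> W \<inter> MG g" if "x \<in> carrier ?W" for g x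
    using that WM comp component_in by simp
  show "component x g = x" if "x \<in> W \<inter> MG g" for g x
    using that component_homogeneous[of x g] by simp
  show "component x h = \<zero>\<^bsub>?W\<^esub>" if "x \<in> W \<inter> MG g" "h \<noteq> g" for g h x
    using that component_homogeneous[of x g] by simp
  show "carrier ?W \<subseteq> generate (add_monoid ?W) (\<Union>g. W \<inter> MG g)"
  proof
    fix x assume x: "x \<in> carrier ?W"
    have "(\<Union>g. W \<inter> MG g) \<subseteq> W" by blast
    then have eq: "generate (add_monoid ?W) (\<Union>g. W \<inter> MG g) = generate (add_monoid M) (\<Union>g. W \<inter> MG g)"
      using M.add.generate_consistent[OF _ submodule.axioms(1)[OF W]] by simp
    have gs: "subgroup (generate (add_monoid M) (\<Union>g. W \<inter> MG g)) (add_monoid M)"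
      using s(1) by (intro M.add.generate_is_subgroup) auto
    have "component x g \<in> generate (add_monoid M) (\<Union>g. W \<inter> MG g)" for g
      using component_in[of x g] comp[of x g] x WM[of x] by (intro generate.incl) auto
    then show "x \<in> generate (add_monoid ?W) (\<Union>g. W \<inter> MG g)"
      unfolding eq using mem_if_components_mem[OF gs WM[of x]] x by simp
  qed
qed


section \<open>Strands of bigraded modules\<close>

lemma mon_deg_zero [simp]: "mon_deg w 0 = 0"
  by (simp add: mon_deg_def)

lemma mon_deg_single [simp]: "mon_deg w (Poly_Mapping.single v (Suc 0)) = w v"
  by (simp add: mon_deg_def)

lemma polyS_const: "mpoly_const c \<in> polyS_comp n 0"
  using poly_ring_const by (auto simp: polyS_comp_def polyS_def mpoly_const_def)

lemma polyS_var: "v \<in> VarX ` {1..n} \<Longrightarrow> mpoly_var v \<in> polyS_comp n 1"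
  using poly_ring_var[of v "VarX ` {1..n}"] by (auto simp: polyS_comp_def polyS_def mpoly_var_def)

lemma polyA_const: "mpoly_const c \<in> polyA_comp n m p 0"
  using poly_ring_const by (auto simp: polyA_comp_def polyA_def mpoly_const_def zero_prod_def)

lemma polyA_var:
  "v \<in> VarX ` {1..n} \<union> VarY ` {1..m} \<Longrightarrow> mpoly_var v \<in> polyA_comp n m p (var_bideg p v)"
  using poly_ring_var[of v "VarX ` {1..n} \<union> VarY ` {1..m}"]
  by (simp add: polyA_comp_def polyA_def mpoly_var_def)

lemma polyA_comp_carrier: "polyA_comp n m p g \<subseteq> carrier (polyA n m)"
  by (auto simp: polyA_comp_def)

lemma polyS_subset_polyA: "carrier (polyS n) \<subseteq> carrier (polyA n m)"
  unfolding polyS_def polyA_def by (rule poly_ring_mono) blast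

lemma polyS_comp_polyA_comp: "polyS_comp n i \<subseteq> polyA_comp n m p (i, 0)"
proof
  fix f :: "'a mpoly" assume f: "f \<in> polyS_comp n i"
  have "mon_deg (fst \<circ> var_bideg p) t = mon_deg (\<lambda>_. 1) t \<and> mon_deg (snd \<circ> var_bideg p) t = 0"
    if t: "t \<in> Poly_Mapping.keys f" for t
  proof -
    have "Poly_Mapping.keys t \<subseteq> VarX ` {1..n}"
      using f t by (auto simp: polyS_comp_def polyS_def carrier_poly_ring)
    then have "(fst \<circ> var_bideg p) v = 1 \<and> (snd \<circ> var_bideg p) v = 0" if "v \<in> Poly_Mapping.keys t" for v
      using that by auto
    then show ?thesis
      unfolding mon_deg_def by (auto intro!: sum.cong sum.neutral)
  qed
  then show "f \<in> polyA_comp n m p (i, 0)"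
    using f polyS_subset_polyA[of n m] by (auto simp: polyS_comp_def polyA_comp_def)
qed

text \<open>The modules to which the theorem applies in general, with Tor and Ext as special cases.\<close>

locale fg_bigraded = graded_module "polyA n m" L "polyA_comp n m p" LG
  for n m :: nat and p :: "nat \<Rightarrow> nat"
    and L :: "(('k::field) mpoly, 'b, 'd) module_scheme" and LG :: "int \<times> int \<Rightarrow> 'b set" +
  assumes fg: "fin_gen (polyA n m) L"
begin

definition layer :: "int \<Rightarrow> 'b set" where
  "layer k = generate (add_monoid L) (\<Union>i. LG (i, k))"

lemma carrier_strand: "carrier (strand L LG k) = layer k"
  by (simp add: strand_def layer_def)

lemma subgroup_layer: "subgroup (layer k) (add_monoid L)"
  unfolding layer_def using comp_subset by (intro M.add.generate_is_subgroup) auto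

lemma layer_carrier: "x \<in> layer k \<Longrightarrow> x \<in> carrier L"
  using subgroup_add_subset[OF subgroup_layer] by blast

text \<open>Membership in a strand can be read off from the bigraded components, which makes the
  strands accessible to the induction principle \<open>components_in_family\<close>.\<close>

lemma layer_iff: "x \<in> layer k \<longleftrightarrow> x \<in> carrier L \<and> (\<forall>i l. l \<noteq> k \<longrightarrow> component x (i, l) = \<zero>\<^bsub>L\<^esub>)"
proof
  define H where "H = {x \<in> carrier L. \<forall>i l. l \<noteq> k \<longrightarrow> component x (i, l) = \<zero>\<^bsub>L\<^esub>}"
  have "subgroup H (add_monoid L)"
    by (rule M.subgroup_addI) (auto simp: H_def component_zero component_add component_minus)
  moreover have "(\<Union>i. LG (i, k)) \<subseteq> H"
    using component_homogeneous comp_carrier by (fastforce simp: H_def)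
  ultimately have "layer k \<subseteq> H"
    unfolding layer_def by (rule M.add.generate_subgroup_incl[rotated])
  then show "x \<in> layer k \<Longrightarrow> x \<in> carrier L \<and> (\<forall>i l. l \<noteq> k \<longrightarrow> component x (i, l) = \<zero>\<^bsub>L\<^esub>)"
    by (auto simp: H_def)
next
  assume x: "x \<in> carrier L \<and> (\<forall>i l. l \<noteq> k \<longrightarrow> component x (i, l) = \<zero>\<^bsub>L\<^esub>)"
  have "component x g \<in> layer k" for g
  proof (cases "snd g = k")
    case True
    then show ?thesis
      unfolding layer_def using component_in[of x g] x by (intro generate.incl) (cases g, auto)
  next
    case False
    then show ?thesis using x subgroup_add_zero[OF subgroup_layer] by (cases g) auto
  qed
  then show "x \<in> layer k" by (rule mem_if_components_mem[OF subgroup_layer conjunct1[OF x]])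
qed

lemma comp_layer: "LG (i, k) \<subseteq> layer k"
  unfolding layer_def by (auto intro: generate.incl)

sublocale S: Module.module "polyS n" L
  unfolding polyS_def by (rule module_restrict_scalars[OF module_axioms[unfolded polyA_def]]) blast

lemma smult_layer:
  assumes a: "a \<in> polyA_comp n m p (i, j)" and x: "x \<in> layer k"
  shows "a \<odot>\<^bsub>L\<^esub> x \<in> layer (j + k)"
proof -
  have ac: "a \<in> carrier (polyA n m)" using a polyA_comp_carrier by blast
  have "component (a \<odot>\<^bsub>L\<^esub> x) (i', l) = \<zero>\<^bsub>L\<^esub>" if "l \<noteq> j + k" for i' l
    using component_smult[OF ac a layer_carrier[OF x], of "(i', l)"] that x ac by (auto simp: layer_iff)
  then show ?thesis using ac x by (auto simp: layer_iff)
qed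

lemma var_y_layer:
  assumes "j \<in> {1..m}" "x \<in> layer k"
  shows "mpoly_var (VarY j) \<odot>\<^bsub>L\<^esub> x \<in> layer (k + 1)"
proof -
  have "mpoly_var (VarY j) \<in> polyA_comp n m p (int (p j), 1)"
    using polyA_var[of "VarY j" n m p] assms by simp
  then show ?thesis using smult_layer[OF _ assms(2)] by (simp add: add.commute)
qed

lemma submodule_layer: "submodule (layer k) (polyS n) L"
proof (intro submodule.intro submodule_axioms.intro subgroup_layer)
  fix a :: "'k mpoly" and x assume "a \<in> carrier (polyS n)" "x \<in> layer k"
  then show "a \<odot>\<^bsub>L\<^esub> x \<in> layer k"
    unfolding polyS_def
  proof (induction a arbitrary: x rule: poly_ring_induct)
    case (const c)
    have "(mpoly_const c :: 'k mpoly) \<in> polyA_comp n m p (0, 0)"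
      using polyA_const by (auto simp: zero_prod_def)
    then show ?case using smult_layer const by fastforce
  next
    case (var v)
    then have "(mpoly_var v :: 'k mpoly) \<in> polyA_comp n m p (1, 0)"
      using polyS_var polyS_comp_polyA_comp by blast
    then show ?case using smult_layer var by fastforce
  next
    case (add a b)
    then have "(a + b) \<odot>\<^bsub>L\<^esub> x = a \<odot>\<^bsub>L\<^esub> x \<oplus>\<^bsub>L\<^esub> b \<odot>\<^bsub>L\<^esub> x"
      using S.smult_l_distr[of a b x] layer_carrier by (simp add: polyS_def)
    then show ?case using add subgroup_add_add[OF subgroup_layer] by simp
  next
    case (mult a b)
    then have "(a * b) \<odot>\<^bsub>L\<^esub> x = a \<odot>\<^bsub>L\<^esub> (b \<odot>\<^bsub>L\<^esub> x)"
      using S.smult_assoc1[of a b x] layer_carrier by (simp add: polyS_def)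
    then show ?case using mult by simp
  qed
qed

lemma strand_graded: "graded_module (polyS n) (strand L LG k) (polyS_comp n) (\<lambda>j. LG (j, k))"
proof (rule graded_moduleI[where pr = "\<lambda>j x. component x (j, k)"])
  let ?W = "strand L LG k"
  have W: "?W = L\<lparr>carrier := layer k\<rparr>" by (simp add: strand_def layer_def)
  note sub = submodule.axioms(1)[OF submodule_layer]
  show "Module.module (polyS n) ?W"
    unfolding W using submodule.submodule_is_module[OF submodule_layer S.module_axioms] .
  show "subgroup (LG (j, k)) (add_monoid ?W)" for j
    using M.add.subgroup_incl[OF comp_subgroup sub comp_layer] by (simp add: W)
  show "a \<odot>\<^bsub>?W\<^esub> x \<in> LG (i + j, k)" if "a \<in> polyS_comp n i" "x \<in> LG (j, k)" for a x i j
    using comp_smult[OF subsetD[OF polyS_comp_polyA_comp that(1)] that(2)] by (simp add: W)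
  show "component (x \<oplus>\<^bsub>?W\<^esub> y) (j, k) = component x (j, k) \<oplus>\<^bsub>?W\<^esub> component y (j, k)"
    if "x \<in> carrier ?W" "y \<in> carrier ?W" for j x y
    using that layer_carrier by (simp add: W component_add)
  show "component x (j, k) \<in> LG (j, k)" if "x \<in> carrier ?W" for j x
    using that layer_carrier component_in by (simp add: W)
  show "component x (j, k) = x" if "x \<in> LG (j, k)" for j x
    using that component_homogeneous[of x "(j, k)"] by simp
  show "component x (i, k) = \<zero>\<^bsub>?W\<^esub>" if "x \<in> LG (j, k)" "i \<noteq> j" for i j x
    using that component_homogeneous[of x "(j, k)"] by (simp add: W)
  have "(\<Union>i. LG (i, k)) \<subseteq> layer k" using comp_layer by blast
  then show "carrier ?W \<subseteq> generate (add_monoid ?W) (\<Union>j. LG (j, k))"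
    using M.add.generate_consistent[OF _ sub] by (simp add: W layer_def)
qed

text \<open>In an expression of an element of \<open>L\<^sub>k\<close> in terms of homogeneous generators, a monomial that involves
  some \<open>y\<^sub>j\<close> can be split as \<open>y\<^sub>j\<close> times a monomial, and the rest of the product lies in
  \<open>L\<^bsub>k-1\<^esub>\<close>; the other coefficients lie in \<open>S\<close>. Here \<open>G k\<close> are the generators of \<open>y\<close>-degree \<open>k\<close>, and \<open>l\<close>
  and \<open>u\<close> bound these degrees. Below \<open>l\<close> the recursion alone would not force the strands to vanish,
  so this is part of the claim.\<close>

lemma layer_recursion:
  obtains G :: "int \<Rightarrow> 'b set" and l u where
    "\<And>k. finite (G k)" "\<And>k. G k \<subseteq> layer k" "\<And>k. u < k \<Longrightarrow> G k = {}"
    "\<And>k. k < l \<Longrightarrow> layer k = {\<zero>\<^bsub>L\<^esub>}"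
    "\<And>k. l \<le> k \<Longrightarrow> layer k
       = mspan (polyS n) L (G k \<union> (\<Union>j\<in>{1..m}. (\<lambda>x. mpoly_var (VarY j) \<odot>\<^bsub>L\<^esub> x) ` layer (k - 1)))"
proof -
  obtain B where B: "finite B" "B \<subseteq> (\<Union>g. LG g)" "mspan (polyA n m) L B = carrier L"
    using homogeneous_generators[OF fg] by blast
  have "\<forall>x\<in>B. \<exists>g. x \<in> LG g" using B by blast
  then obtain dg where dg: "\<And>x. x \<in> B \<Longrightarrow> x \<in> LG (dg x)" by metis
  obtain l where l: "\<And>x. x \<in> B \<Longrightarrow> l \<le> snd (dg x)"
  proof (rule that)
    show "Min ((snd \<circ> dg) ` B) \<le> snd (dg x)" if "x \<in> B" for x
      using Min_le[of "(snd \<circ> dg) ` B" "snd (dg x)"] that B(1) by auto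
  qed
  obtain u where u: "\<And>x. x \<in> B \<Longrightarrow> snd (dg x) \<le> u"
  proof (rule that)
    show "snd (dg x) \<le> Max ((snd \<circ> dg) ` B)" if "x \<in> B" for x
      using Max_ge[of "(snd \<circ> dg) ` B" "snd (dg x)"] that B(1) by auto
  qed
  define G where "G k = {x \<in> B. snd (dg x) = k}" for k
  define gens where "gens k = G k \<union> (\<Union>j\<in>{1..m}. (\<lambda>x. mpoly_var (VarY j) \<odot>\<^bsub>L\<^esub> x) ` layer (k - 1))" for k
  (* The claim is that the strands equal U. The family U, constant in the first degree, is stable
     under the variables and contains the generators, so it contains all components. *)
  define U where "U k = (if k < l then {\<zero>\<^bsub>L\<^esub>} else mspan (polyS n) L (gens k))" for k
  have G_layer: "G k \<subseteq> layer k" for k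
  proof
    fix x assume "x \<in> G k"
    then have "x \<in> LG (fst (dg x), k)" using dg by (auto simp: G_def)
    then show "x \<in> layer k" using comp_layer by blast
  qed
  have gens_layer: "gens k \<subseteq> layer k" for k
    using G_layer var_y_layer[of _ _ "k - 1"] by (auto simp: gens_def)
  have gens_car: "gens k \<subseteq> carrier L" for k using gens_layer layer_carrier by blast
  have U_sub: "submodule (U k) (polyS n) L" for k
    unfolding U_def using S.mspan_submodule[OF gens_car] by (auto intro!: S.submoduleI)
  have U_layer: "U k \<subseteq> layer k" for k
    using mspan_minimal[OF submodule_layer gens_layer] subgroup_add_zero[OF subgroup_layer] by (auto simp: U_def)
  let ?V = "VarX ` {1..n} \<union> VarY ` {1..m}"
  have comp_U: "component x g \<in> U (snd g)" if "x \<in> carrier L" for x g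
  proof (rule components_in_family[where V = ?V and RG = "polyA_comp n m p" and w = "var_bideg p" and G = B
        and H = "\<lambda>g. U (snd g)", OF graded_module_axioms[unfolded polyA_def] polyA_const polyA_var])
    show "B \<subseteq> carrier L" using B(2) comp_subset by blast
    show "mspan (poly_ring ?V) L B = carrier L" using B(3) by (simp add: polyA_def)
    show "\<exists>g. x \<in> LG g \<and> x \<in> U (snd g)" if "x \<in> B" for x
    proof -
      have "x \<in> gens (snd (dg x))" using that by (simp add: gens_def G_def)
      then have "x \<in> U (snd (dg x))" using l[OF that] mspan_incl[of "gens (snd (dg x))" "polyS n" L] by (auto simp: U_def)
      then show ?thesis using dg[OF that] by blast
    qed
    show "subgroup (U (snd g)) (add_monoid L)" for g using submodule.axioms(1)[OF U_sub] .
    show "mpoly_const c \<odot>\<^bsub>L\<^esub> x \<in> U (snd g)" if "x \<in> U (snd g)" for c g x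
      using S.submoduleE(4)[OF U_sub _ that, of "mpoly_const c"] by (simp add: polyS_def)
    show "mpoly_var v \<odot>\<^bsub>L\<^esub> x \<in> U (snd (var_bideg p v + g))" if v: "v \<in> ?V" and x: "x \<in> U (snd g)" for v g x
    proof -
      consider i where "v = VarX i" "i \<in> {1..n}" | j where "v = VarY j" "j \<in> {1..m}" using v by blast
      then show ?thesis
      proof cases
        case 1
        then have "mpoly_var v \<in> carrier (polyS n)" using poly_ring_var[of v "VarX ` {1..n}"] by (simp add: polyS_def)
        then show ?thesis using S.submoduleE(4)[OF U_sub _ x, of "mpoly_var v"] 1 by simp
      next
        case 2
        have vc: "(mpoly_var v :: 'k mpoly) \<in> carrier (polyA n m)"
          using poly_ring_var[OF v] by (simp add: polyA_def)
        show ?thesis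
        proof (cases "snd g < l")
          case True
          then have "x = \<zero>\<^bsub>L\<^esub>" using x by (simp add: U_def)
          then have "mpoly_var v \<odot>\<^bsub>L\<^esub> x = \<zero>\<^bsub>L\<^esub>" using vc by simp
          then show ?thesis using subgroup_add_zero[OF submodule.axioms(1)[OF U_sub]] by simp
        next
          case False
          have "x \<in> layer (1 + snd g - 1)" using x U_layer by auto
          then have "mpoly_var v \<odot>\<^bsub>L\<^esub> x \<in> gens (1 + snd g)" using 2 by (auto simp: gens_def)
          then show ?thesis
            using False 2 mspan_incl[of "gens (1 + snd g)" "polyS n" L] by (auto simp: U_def)
        qed
      qed
    qed
  qed (use that in auto)
  have layer_U: "layer k = U k" for k
  proof
    show "layer k \<subseteq> U k"
    proof
      fix x assume x: "x \<in> layer k"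
      have z: "\<zero>\<^bsub>L\<^esub> \<in> U k" using subgroup_add_zero[OF submodule.axioms(1)[OF U_sub]] .
      have "component x g \<in> U k" for g
        using comp_U[OF layer_carrier[OF x], of g] x z by (cases "snd g = k"; cases g) (auto simp: layer_iff)
      then show "x \<in> U k"
        by (rule mem_if_components_mem[OF submodule.axioms(1)[OF U_sub] layer_carrier[OF x]])
    qed
  qed (rule U_layer)
  show thesis
  proof (rule that[of G u l])
    show "finite (G k)" for k using B(1) by (simp add: G_def)
    show "G k = {}" if "u < k" for k using u that by (fastforce simp: G_def)
    show "layer k = {\<zero>\<^bsub>L\<^esub>}" if "k < l" for k using layer_U[of k] that by (simp add: U_def)
    show "layer k = mspan (polyS n) L (G k \<union> (\<Union>j\<in>{1..m}. (\<lambda>x. mpoly_var (VarY j) \<odot>\<^bsub>L\<^esub> x) ` layer (k - 1)))"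
      if "l \<le> k" for k using layer_U[of k] that by (simp add: U_def gens_def)
  qed (rule G_layer)
qed

end

lemma noetherian_polyS: "noetherian_ring (polyS n :: ('k::field) mpoly ring)"
  unfolding polyS_def by (rule noetherian_poly_ring) simp

lemma noetherian_polyA: "noetherian_ring (polyA n m :: ('k::field) mpoly ring)"
  unfolding polyA_def by (rule noetherian_poly_ring) simp

lemma (in Module.module) submodule_smult_preimage:
  assumes r: "r \<in> carrier R" and H: "submodule H R M"
  shows "submodule {x \<in> carrier M. r \<odot>\<^bsub>M\<^esub> x \<in> H} R M"
proof (rule submoduleI)
  note s = submoduleE[OF H]
  fix a x assume a: "a \<in> carrier R" and x: "x \<in> {x \<in> carrier M. r \<odot>\<^bsub>M\<^esub> x \<in> H}"
  have "r \<odot>\<^bsub>M\<^esub> (a \<odot>\<^bsub>M\<^esub> x) = a \<odot>\<^bsub>M\<^esub> (r \<odot>\<^bsub>M\<^esub> x)"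
    using a x r smult_assoc1 R.m_comm by (metis (no_types, lifting) mem_Collect_eq)
  then show "a \<odot>\<^bsub>M\<^esub> x \<in> {x \<in> carrier M. r \<odot>\<^bsub>M\<^esub> x \<in> H}" using a x s(4) by simp
qed (use r submodule_zero[OF H] submoduleE[OF H] in \<open>auto simp: smult_r_distr smult_r_minus\<close>)

context fg_bigraded
begin

lemma var_y_carrier: "j \<in> {1..m} \<Longrightarrow> (mpoly_var (VarY j) :: 'k mpoly) \<in> carrier (polyA n m)"
  unfolding polyA_def by (rule poly_ring_var) simp

lemma smult_var_y_commute:
  assumes "r \<in> carrier (polyS n)" "j \<in> {1..m}" "x \<in> carrier L"
  shows "r \<odot>\<^bsub>L\<^esub> (mpoly_var (VarY j) \<odot>\<^bsub>L\<^esub> x) = mpoly_var (VarY j) \<odot>\<^bsub>L\<^esub> (r \<odot>\<^bsub>L\<^esub> x)"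
proof -
  have r: "r \<in> carrier (polyA n m)" using assms(1) polyS_subset_polyA by blast
  show ?thesis
    using smult_assoc1[OF r var_y_carrier assms(3)] smult_assoc1[OF var_y_carrier r assms(3)] assms(2)
      R.m_comm[OF r var_y_carrier] by simp
qed

text \<open>Upward induction along \<open>layer_recursion\<close> from the degrees where the strands vanish: if \<open>D\<close> generates
  one strand, the products \<open>y\<^sub>j D\<close> and the generators of the next degree generate the next one,
  because multiplication by \<open>y\<^sub>j\<close> is \<open>S\<close>-linear.\<close>

lemma layer_fin_gen: "\<exists>D. finite D \<and> D \<subseteq> layer k \<and> mspan (polyS n) L D = layer k"
proof -
  obtain G l u where G: "\<And>k. finite (G k)" "\<And>k. G k \<subseteq> layer k"
    and low: "\<And>k. k < l \<Longrightarrow> layer k = {\<zero>\<^bsub>L\<^esub>}"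
    and rec: "\<And>k. l \<le> k \<Longrightarrow> layer k
       = mspan (polyS n) L (G k \<union> (\<Union>j\<in>{1..m}. (\<lambda>x. mpoly_var (VarY j) \<odot>\<^bsub>L\<^esub> x) ` layer (k - 1)))"
    using layer_recursion by metis
  have base: "\<exists>D. finite D \<and> D \<subseteq> layer k \<and> mspan (polyS n) L D = layer k" if "k < l" for k
  proof -
    have "submodule {\<zero>\<^bsub>L\<^esub>} (polyS n) L" by (rule S.submoduleI) auto
    then have "mspan (polyS n) L {\<zero>\<^bsub>L\<^esub>} = {\<zero>\<^bsub>L\<^esub>}"
      by (intro equalityI mspan_incl mspan_minimal subset_refl)
    then show ?thesis using low[OF that] by (intro exI[of _ "{\<zero>\<^bsub>L\<^esub>}"]) simp
  qed
  have step: "\<exists>D. finite D \<and> D \<subseteq> layer (k + 1) \<and> mspan (polyS n) L D = layer (k + 1)"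
    if k: "l - 1 \<le> k" and IH: "\<exists>D. finite D \<and> D \<subseteq> layer k \<and> mspan (polyS n) L D = layer k" for k
  proof -
    obtain D where D: "finite D" "D \<subseteq> layer k" "mspan (polyS n) L D = layer k" using IH by blast
    define D' where "D' = G (k + 1) \<union> (\<Union>j\<in>{1..m}. (\<lambda>x. mpoly_var (VarY j) \<odot>\<^bsub>L\<^esub> x) ` D)"
    have D': "finite D'" "D' \<subseteq> layer (k + 1)"
      using G[of "k + 1"] D var_y_layer by (auto simp: D'_def)
    then have D'c: "D' \<subseteq> carrier L" using layer_carrier by blast
    have sub: "submodule (mspan (polyS n) L D') (polyS n) L" by (rule S.mspan_submodule[OF D'c])
    note s = S.submoduleE[OF sub]
    have "mpoly_var (VarY j) \<odot>\<^bsub>L\<^esub> x \<in> mspan (polyS n) L D'" if j: "j \<in> {1..m}" and x: "x \<in> layer k" for j x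
    proof -
      let ?H = "{x \<in> carrier L. mpoly_var (VarY j) \<odot>\<^bsub>L\<^esub> x \<in> mspan (polyS n) L D'}"
      have "submodule ?H (polyS n) L"
        using s subgroup_add_zero[OF submodule.axioms(1)[OF sub]] var_y_carrier[OF j] smult_var_y_commute[OF _ j, symmetric]
        by (intro S.submoduleI) (auto simp: smult_r_distr smult_r_minus)
      moreover have "D \<subseteq> ?H"
      proof
        fix x assume x: "x \<in> D"
        then have "mpoly_var (VarY j) \<odot>\<^bsub>L\<^esub> x \<in> D'" using j unfolding D'_def by blast
        then have "mpoly_var (VarY j) \<odot>\<^bsub>L\<^esub> x \<in> mspan (polyS n) L D'" by (rule subsetD[OF mspan_incl])
        then show "x \<in> ?H" using layer_carrier[OF subsetD[OF D(2) x]] by simp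
      qed
      ultimately have "layer k \<subseteq> ?H" unfolding D(3)[symmetric] by (rule mspan_minimal)
      then show ?thesis using x by blast
    qed
    then have "G (k + 1) \<union> (\<Union>j\<in>{1..m}. (\<lambda>x. mpoly_var (VarY j) \<odot>\<^bsub>L\<^esub> x) ` layer (k + 1 - 1)) \<subseteq> mspan (polyS n) L D'"
      using mspan_incl[of D' "polyS n" L] by (auto simp: D'_def)
    then have "layer (k + 1) \<subseteq> mspan (polyS n) L D'"
      using rec[of "k + 1"] k by (simp add: mspan_minimal[OF sub])
    moreover have "mspan (polyS n) L D' \<subseteq> layer (k + 1)" by (rule mspan_minimal[OF submodule_layer D'(2)])
    ultimately show ?thesis using D' by blast
  qed
  show ?thesis
  proof (cases "k < l")
    case False
    then have "l - 1 \<le> k" by simp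
    then show ?thesis by (induction k rule: int_ge_induct) (use base step in auto)
  qed (rule base)
qed

lemma strand_fin_gen: "fin_gen (polyS n) (strand L LG k)"
proof -
  obtain D where "finite D" "D \<subseteq> layer k" "mspan (polyS n) L D = layer k" using layer_fin_gen by blast
  then show ?thesis
    unfolding fin_gen_mspan using S.mspan_restrict_carrier[OF submodule_layer, of D k]
    by (intro exI[of _ D]) (simp add: strand_def layer_def)
qed

text \<open>Beyond the degrees of the generators each strand is obtained from the previous one by
  multiplication with the variables \<open>y\<^sub>j\<close>, so that annihilators can only grow; since \<open>S\<close> is
  Noetherian, they become constant. The dimension depends on the annihilator alone.\<close>

lemma strand_dim_eventually_constant:
  "\<exists>\<delta>. \<forall>\<^sub>F k in at_top. module_dim (polyS n) (strand L LG k) = \<delta>"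
proof -
  obtain G l u where G: "\<And>k. u < k \<Longrightarrow> G k = {}"
    and rec: "\<And>k. l \<le> k \<Longrightarrow> layer k
       = mspan (polyS n) L (G k \<union> (\<Union>j\<in>{1..m}. (\<lambda>x. mpoly_var (VarY j) \<odot>\<^bsub>L\<^esub> x) ` layer (k - 1)))"
    using layer_recursion by metis
  define k0 where "k0 = max l u"
  define ann where "ann k = annihilator (polyS n) (strand L LG k)" for k
  have ann: "ann k = {r \<in> carrier (polyS n). \<forall>x\<in>layer k. r \<odot>\<^bsub>L\<^esub> x = \<zero>\<^bsub>L\<^esub>}" for k
    by (simp add: ann_def annihilator_def carrier_strand) (simp add: strand_def)
  have step: "ann k \<subseteq> ann (k + 1)" if k: "k0 \<le> k" for k
  proof
    fix r assume "r \<in> ann k"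
    then have r: "r \<in> carrier (polyS n)" "\<And>x. x \<in> layer k \<Longrightarrow> r \<odot>\<^bsub>L\<^esub> x = \<zero>\<^bsub>L\<^esub>" by (auto simp: ann)
    let ?H = "{x \<in> carrier L. r \<odot>\<^bsub>L\<^esub> x \<in> {\<zero>\<^bsub>L\<^esub>}}"
    have "submodule ?H (polyS n) L"
      by (intro S.submodule_smult_preimage r S.submoduleI) auto
    moreover have "(\<Union>j\<in>{1..m}. (\<lambda>x. mpoly_var (VarY j) \<odot>\<^bsub>L\<^esub> x) ` layer k) \<subseteq> ?H"
      using layer_carrier var_y_carrier r(2) smult_var_y_commute[OF r(1)] by auto
    ultimately have "layer (k + 1) \<subseteq> ?H"
      using rec[of "k + 1"] G[of "k + 1"] k by (simp add: k0_def mspan_minimal)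
    then show "r \<in> ann (k + 1)" using r by (auto simp: ann)
  qed
  have mono: "ann k \<subseteq> ann k'" if "k0 \<le> k" "k \<le> k'" for k k'
    using that(2,1) by (induction k' rule: int_ge_induct) (simp, metis order_trans step)
  have ideal: "ideal (ann k) (polyS n)" for k
    unfolding polyS_def ideal_poly_ring_iff
  proof (intro conjI ballI)
    show "ann k \<subseteq> carrier (poly_ring (VarX ` {1..n}))" by (auto simp: ann polyS_def)
    show "0 \<in> ann k" using S.smult_l_null layer_carrier by (auto simp: ann polyS_def)
    show "r + r' \<in> ann k" if "r \<in> ann k" "r' \<in> ann k" for r r'
      using that S.smult_l_distr[of r r'] layer_carrier poly_ring_add
      by (auto simp: ann polyS_def)
    show "r * r' \<in> ann k" if "r \<in> carrier (poly_ring (VarX ` {1..n}))" "r' \<in> ann k" for r r'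
      using that S.smult_assoc1[of r r'] layer_carrier poly_ring_mult
      by (auto simp: ann polyS_def)
  qed
  interpret N: noetherian_ring "polyS n :: 'k mpoly ring" by (rule noetherian_polyS)
  have "(\<Union>k\<in>{k0..}. ann k) \<in> ann ` {k0..}"
  proof (rule N.ideal_chain_is_trivial)
    show "subset.chain {I. ideal I (polyS n)} (ann ` {k0..})"
      unfolding subset_chain_def
    proof (intro conjI ballI)
      fix I I' assume "I \<in> ann ` {k0..}" "I' \<in> ann ` {k0..}"
      then obtain k k' where "I = ann k" "I' = ann k'" "k0 \<le> k" "k0 \<le> k'" by auto
      then show "I \<subseteq> I' \<or> I' \<subseteq> I" using mono[of k k'] mono[of k' k] linear[of k k'] by blast
    qed (use ideal in auto)
  qed auto
  then obtain k1 where k1: "k0 \<le> k1" "(\<Union>k\<in>{k0..}. ann k) = ann k1" by auto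
  have ann_eq: "ann k = ann k1" if "k1 \<le> k" for k
  proof
    show "ann k1 \<subseteq> ann k" by (rule mono[OF k1(1) that])
    have "k \<in> {k0..}" using k1(1) that by simp
    then show "ann k \<subseteq> ann k1" unfolding k1(2)[symmetric] by (rule UN_upper)
  qed
  have "module_dim (polyS n) (strand L LG k) = krull_dim (polyS n Quot ann k1)" if "k1 \<le> k" for k
    using ann_eq[OF that] by (simp add: module_dim_def ann_def)
  then show ?thesis by (auto simp: eventually_at_top_linorder)
qed

end

section \<open>Images and powers of graded modules\<close>

text \<open>The target \<open>M'\<close> is a mere record with operations on its carrier. The module axioms pass to it
  along \<open>f\<close>. Subquotients, tensor products and modules of homomorphisms are recognised as
  modules in this way.\<close>

locale module_surjection = Module.module R M for R :: "('a, 'r) ring_scheme" (structure) and M :: "('a, 'b, 'd) module_scheme" (structure) +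
  fixes M' :: "('a, 'c, 'e) module_scheme" and f :: "'b \<Rightarrow> 'c"
  assumes image: "carrier M' = f ` carrier M"
    and f_zero: "f \<zero>\<^bsub>M\<^esub> = \<zero>\<^bsub>M'\<^esub>"
    and f_add: "\<And>x y. x \<in> carrier M \<Longrightarrow> y \<in> carrier M \<Longrightarrow> f (x \<oplus>\<^bsub>M\<^esub> y) = f x \<oplus>\<^bsub>M'\<^esub> f y"
    and f_smult: "\<And>a x. a \<in> carrier R \<Longrightarrow> x \<in> carrier M \<Longrightarrow> f (a \<odot>\<^bsub>M\<^esub> x) = a \<odot>\<^bsub>M'\<^esub> f x"
begin

lemma module_image: "Module.module R M'"
proof (intro moduleI R.is_cring abelian_groupI)
  have lift: "\<exists>u. u \<in> carrier M \<and> x = f u" if "x \<in> carrier M'" for x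
    using that image by blast
  have f_closed: "u \<in> carrier M \<Longrightarrow> f u \<in> carrier M'" for u
    using image by blast
  show "\<zero>\<^bsub>M'\<^esub> \<in> carrier M'" using f_closed[OF M.zero_closed] by (simp add: f_zero)
  fix x assume "x \<in> carrier M'"
  then obtain u where u: "u \<in> carrier M" and x: "x = f u" using lift by blast
  show "\<zero>\<^bsub>M'\<^esub> \<oplus>\<^bsub>M'\<^esub> x = x"
    unfolding x f_zero[symmetric] using f_add[OF M.zero_closed u] u by simp
  have "f (\<ominus>\<^bsub>M\<^esub> u) \<oplus>\<^bsub>M'\<^esub> x = \<zero>\<^bsub>M'\<^esub>"
    unfolding x using f_add[OF M.a_inv_closed[OF u] u] f_zero u by (simp add: M.l_neg)
  then show "\<exists>y\<in>carrier M'. y \<oplus>\<^bsub>M'\<^esub> x = \<zero>\<^bsub>M'\<^esub>"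
    using f_closed[OF M.a_inv_closed[OF u]] by blast
  show "\<one>\<^bsub>R\<^esub> \<odot>\<^bsub>M'\<^esub> x = x"
    unfolding x using f_smult[OF R.one_closed u] u by simp
  fix a assume a: "a \<in> carrier R"
  show "a \<odot>\<^bsub>M'\<^esub> x \<in> carrier M'"
    unfolding x using f_smult[OF a u] f_closed[OF smult_closed[OF a u]] by simp
  fix b assume b: "b \<in> carrier R"
  show "(a \<oplus>\<^bsub>R\<^esub> b) \<odot>\<^bsub>M'\<^esub> x = a \<odot>\<^bsub>M'\<^esub> x \<oplus>\<^bsub>M'\<^esub> b \<odot>\<^bsub>M'\<^esub> x"
    unfolding x using f_smult[OF R.a_closed[OF a b] u] f_smult[OF a u] f_smult[OF b u]
      f_add[OF smult_closed[OF a u] smult_closed[OF b u]] smult_l_distr[OF a b u] by simp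
  show "(a \<otimes>\<^bsub>R\<^esub> b) \<odot>\<^bsub>M'\<^esub> x = a \<odot>\<^bsub>M'\<^esub> (b \<odot>\<^bsub>M'\<^esub> x)"
    unfolding x using f_smult[OF R.m_closed[OF a b] u] f_smult[OF b u] f_smult[OF a smult_closed[OF b u]]
      smult_assoc1[OF a b u] by simp
next
  have lift: "\<exists>u. u \<in> carrier M \<and> x = f u" if "x \<in> carrier M'" for x
    using that image by blast
  have f_closed: "u \<in> carrier M \<Longrightarrow> f u \<in> carrier M'" for u
    using image by blast
  fix x y assume "x \<in> carrier M'" "y \<in> carrier M'"
  then obtain u v where u: "u \<in> carrier M" and x: "x = f u" and v: "v \<in> carrier M" and y: "y = f v"
    using lift by blast
  show "x \<oplus>\<^bsub>M'\<^esub> y \<in> carrier M'"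
    unfolding x y using f_add[OF u v] f_closed[OF M.a_closed[OF u v]] by simp
  show "x \<oplus>\<^bsub>M'\<^esub> y = y \<oplus>\<^bsub>M'\<^esub> x"
    unfolding x y using f_add[OF u v] f_add[OF v u] M.a_comm[OF u v] by simp
  show "a \<odot>\<^bsub>M'\<^esub> (x \<oplus>\<^bsub>M'\<^esub> y) = a \<odot>\<^bsub>M'\<^esub> x \<oplus>\<^bsub>M'\<^esub> a \<odot>\<^bsub>M'\<^esub> y" if a: "a \<in> carrier R" for a
    unfolding x y using f_add[OF u v] f_smult[OF a M.a_closed[OF u v]] f_smult[OF a u] f_smult[OF a v]
      f_add[OF smult_closed[OF a u] smult_closed[OF a v]] smult_r_distr[OF a u v] by simp
  fix z assume "z \<in> carrier M'"
  then obtain w where w: "w \<in> carrier M" and z: "z = f w" using lift by blast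
  show "x \<oplus>\<^bsub>M'\<^esub> y \<oplus>\<^bsub>M'\<^esub> z = x \<oplus>\<^bsub>M'\<^esub> (y \<oplus>\<^bsub>M'\<^esub> z)"
    unfolding x y z using f_add[OF u v] f_add[OF v w] f_add[OF M.a_closed[OF u v] w]
      f_add[OF u M.a_closed[OF v w]] M.a_assoc[OF u v w] by simp
qed

sublocale I: Module.module R M' by (rule module_image)

lemma f_closed: "x \<in> carrier M \<Longrightarrow> f x \<in> carrier M'"
  by (simp add: image)

lemma f_minus: "x \<in> carrier M \<Longrightarrow> f (\<ominus>\<^bsub>M\<^esub> x) = \<ominus>\<^bsub>M'\<^esub> f x"
  using I.M.minus_equality[of "f (\<ominus>\<^bsub>M\<^esub> x)" "f x"] f_closed f_add[of "\<ominus>\<^bsub>M\<^esub> x" x] f_zero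
  by (simp add: M.l_neg)

lemma submodule_preimage:
  assumes H: "submodule H R M'"
  shows "submodule {x \<in> carrier M. f x \<in> H} R M"
  using I.submoduleE[OF H] I.submodule_zero[OF H]
  by (intro submoduleI) (auto simp: f_zero f_add f_minus f_smult)

lemma subgroup_image:
  assumes H: "subgroup H (add_monoid M)"
  shows "subgroup (f ` H) (add_monoid M')"
proof (rule I.M.subgroup_addI)
  have HM: "x \<in> H \<Longrightarrow> x \<in> carrier M" for x using subgroup_add_subset[OF H] by blast
  show "f ` H \<subseteq> carrier M'" using HM f_closed by blast
  show "\<zero>\<^bsub>M'\<^esub> \<in> f ` H" using subgroup_add_zero[OF H] f_zero by (metis image_eqI)
  show "x \<oplus>\<^bsub>M'\<^esub> y \<in> f ` H" if xy: "x \<in> f ` H" "y \<in> f ` H" for x y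
  proof -
    obtain u v where uv: "u \<in> H" "v \<in> H" "x = f u" "y = f v" using xy by blast
    then show ?thesis using f_add[OF HM HM, of u v] subgroup_add_add[OF H uv(1,2)] uv(3,4)
      by (metis image_eqI)
  qed
  show "\<ominus>\<^bsub>M'\<^esub> x \<in> f ` H" if x: "x \<in> f ` H" for x
  proof -
    obtain u where u: "u \<in> H" "x = f u" using x by blast
    then show ?thesis using f_minus[OF HM, of u] subgroup_add_minus[OF H u(1)] u
      by (metis image_eqI)
  qed
qed

lemma fin_gen_image:
  assumes "fin_gen R M"
  shows "fin_gen R M'"
proof -
  obtain G where G: "finite G" "G \<subseteq> carrier M" "mspan R M G = carrier M"
    using assms by (auto simp: fin_gen_mspan)
  have Gc: "f ` G \<subseteq> carrier M'" using G f_closed by blast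
  note sub = I.mspan_submodule[OF Gc]
  have "G \<subseteq> {x \<in> carrier M. f x \<in> mspan R M' (f ` G)}"
    using G(2) mspan_incl[of "f ` G" R M'] by blast
  then have "mspan R M G \<subseteq> {x \<in> carrier M. f x \<in> mspan R M' (f ` G)}"
    by (rule mspan_minimal[OF submodule_preimage[OF sub]])
  then have "carrier M \<subseteq> {x \<in> carrier M. f x \<in> mspan R M' (f ` G)}" using G(3) by simp
  then have "carrier M' \<subseteq> mspan R M' (f ` G)" using image by auto
  then show ?thesis unfolding fin_gen_mspan
    using G(1) Gc I.submoduleE(1)[OF sub] by (intro exI[of _ "f ` G"]) auto
qed

text \<open>Under the assumption on the kernel, the component maps of \<open>M\<close> descend to \<open>M'\<close> and are
  projections there.\<close>

lemma graded_image:
  fixes RG :: "'g::ab_group_add \<Rightarrow> 'a set"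
  assumes gr: "graded_module R M RG MG" and RG: "\<And>g. RG g \<subseteq> carrier R"
    and ker: "\<And>x g. x \<in> carrier M \<Longrightarrow> f x = \<zero>\<^bsub>M'\<^esub> \<Longrightarrow> f (graded_module.component M MG x g) = \<zero>\<^bsub>M'\<^esub>"
  shows "graded_module R M' RG (\<lambda>g. f ` MG g)"
proof -
  interpret graded_module R M RG MG by (rule gr)
  define lift where "lift y = (SOME x. x \<in> carrier M \<and> f x = y)" for y
  have lift: "lift y \<in> carrier M" "f (lift y) = y" if "y \<in> carrier M'" for y
  proof -
    from that[unfolded image] obtain x where "y = f x" "x \<in> carrier M" by (rule imageE)
    then have "\<exists>x. x \<in> carrier M \<and> f x = y" by auto
    from someI_ex[OF this] show "lift y \<in> carrier M" "f (lift y) = y" by (simp_all add: lift_def)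
  qed
  define pr where "pr g y = f (component (lift y) g)" for g y
  have pr: "pr g (f x) = f (component x g)" if x: "x \<in> carrier M" for g x
  proof -
    let ?y = "lift (f x)"
    have y: "?y \<in> carrier M" "f ?y = f x" using lift[OF f_closed[OF x]] .
    have c: "component x g \<in> carrier M" "component ?y g \<in> carrier M"
      using component_closed[OF x] component_closed[OF y(1)] .
    have "f (?y \<oplus>\<^bsub>M\<^esub> \<ominus>\<^bsub>M\<^esub> x) = \<zero>\<^bsub>M'\<^esub>"
      using x y f_closed[OF x] by (simp add: f_add f_minus I.M.r_neg)
    then have "f (component (?y \<oplus>\<^bsub>M\<^esub> \<ominus>\<^bsub>M\<^esub> x) g) = \<zero>\<^bsub>M'\<^esub>" using x y ker by simp
    then have "f (component ?y g) \<oplus>\<^bsub>M'\<^esub> \<ominus>\<^bsub>M'\<^esub> f (component x g) = \<zero>\<^bsub>M'\<^esub>"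
      using x y c by (simp add: component_add component_minus f_add f_minus)
    then have "\<ominus>\<^bsub>M'\<^esub> (\<ominus>\<^bsub>M'\<^esub> f (component x g)) = f (component ?y g)"
      by (rule I.M.minus_equality) (use c f_closed in auto)
    then show ?thesis using c f_closed by (simp add: pr_def)
  qed
  show ?thesis
  proof (rule graded_moduleI[where pr = pr])
    show "Module.module R M'" by (rule module_image)
    show "subgroup (f ` MG g) (add_monoid M')" for g by (rule subgroup_image[OF comp_subgroup])
    show "a \<odot>\<^bsub>M'\<^esub> y \<in> f ` MG (g + h)" if a: "a \<in> RG g" and y: "y \<in> f ` MG h" for a y g h
    proof -
      obtain x where "x \<in> MG h" "y = f x" using y by blast
      moreover have "a \<in> carrier R" using a RG by blast
      ultimately show ?thesis
        using f_smult[of a x] comp_smult[OF a, of x h] comp_carrier[of x h] by (intro image_eqI[of _ f]) simp_all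
    qed
    show "pr g (y \<oplus>\<^bsub>M'\<^esub> y') = pr g y \<oplus>\<^bsub>M'\<^esub> pr g y'" if "y \<in> carrier M'" "y' \<in> carrier M'" for g y y'
    proof -
      obtain x x' where "x \<in> carrier M" "x' \<in> carrier M" "y = f x" "y' = f x'"
        using \<open>y \<in> carrier M'\<close> \<open>y' \<in> carrier M'\<close> unfolding image by (elim imageE) (rule that)
      then show ?thesis
        using pr[of "x \<oplus>\<^bsub>M\<^esub> x'" g] by (simp add: f_add pr component_add component_closed)
    qed
    show "pr g y \<in> f ` MG g" if "y \<in> carrier M'" for g y
      using component_in lift(1)[OF that] unfolding pr_def by blast
    show "pr g y = y" if "y \<in> f ` MG g" for g y
      using that comp_carrier component_homogeneous by (fastforce simp: pr)
    show "pr h y = \<zero>\<^bsub>M'\<^esub>" if "y \<in> f ` MG g" "h \<noteq> g" for g h y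
      using that comp_carrier component_homogeneous f_zero by (fastforce simp: pr)
    show "carrier M' \<subseteq> generate (add_monoid M') (\<Union>g. f ` MG g)"
    proof
      fix y assume "y \<in> carrier M'"
      then obtain x where x: "x \<in> carrier M" "y = f x" unfolding image by (elim imageE) (rule that)
      let ?H = "generate (add_monoid M') (\<Union>g. f ` MG g)"
      have H: "subgroup ?H (add_monoid M')"
        using comp_carrier f_closed by (intro I.M.add.generate_is_subgroup) auto
      have pre: "subgroup {x \<in> carrier M. f x \<in> ?H} (add_monoid M)"
        using subgroup_add_zero[OF H] subgroup_add_add[OF H] subgroup_add_minus[OF H]
        by (intro M.subgroup_addI) (auto simp: f_zero f_add f_minus)
      have "component x g \<in> {x \<in> carrier M. f x \<in> ?H}" for g
        using component_in[OF x(1), of g] component_closed[OF x(1)] by (auto intro!: generate.incl)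
      then have "x \<in> {x \<in> carrier M. f x \<in> ?H}" by (rule mem_if_components_mem[OF pre x(1)])
      then show "y \<in> ?H" using x(2) by simp
    qed
  qed
qed

end

text \<open>The image of the decomposition of \<open>x\<close> is a decomposition of its image, hence the only one.\<close>

lemma component_map:
  assumes M: "graded_module R M RG MG" and M': "graded_module R' M' RG' MG'"
    and h_add: "\<And>x y. x \<in> carrier M \<Longrightarrow> y \<in> carrier M \<Longrightarrow> h (x \<oplus>\<^bsub>M\<^esub> y) = h x \<oplus>\<^bsub>M'\<^esub> h y"
    and h_zero: "h \<zero>\<^bsub>M\<^esub> = \<zero>\<^bsub>M'\<^esub>"
    and h_comp: "\<And>g x. x \<in> MG g \<Longrightarrow> h x \<in> MG' g"
    and x: "x \<in> carrier M"
  shows "graded_module.component M' MG' (h x) g = h (graded_module.component M MG x g)"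
proof -
  interpret M: graded_module R M RG MG by (rule M)
  interpret M': graded_module R' M' RG' MG' by (rule M')
  let ?I = "{g. M.component x g \<noteq> \<zero>\<^bsub>M\<^esub>}"
  have I: "finite ?I" by (rule M.finite_components[OF x])
  have c: "M.component x g \<in> carrier M" "h (M.component x g) \<in> carrier M'" for g
    using M.component_closed[OF x] M'.comp_carrier[OF h_comp[OF M.component_in[OF x]]] by auto
  have "h (\<Oplus>\<^bsub>M\<^esub>g\<in>J. M.component x g) = (\<Oplus>\<^bsub>M'\<^esub>g\<in>J. h (M.component x g))" if "finite J" for J
    using that
  proof (induction J)
    case (insert g J)
    then show ?case
      using c h_add[OF c(1)[of g], of "finsum M (M.component x) J"] by (simp add: Pi_def)
  qed (simp add: h_zero)
  then have "h x = (\<Oplus>\<^bsub>M'\<^esub>g\<in>?I. h (M.component x g))"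
    using I M.sum_components[OF x] by metis
  then have "M'.component (h x) g = (if g \<in> ?I then h (M.component x g) else \<zero>\<^bsub>M'\<^esub>)"
    using h_comp M.component_in[OF x] I by (intro M'.component_eqI) auto
  then show ?thesis using h_zero by auto
qed

lemma (in graded_module) component_submodule:
  assumes W: "submodule W R M" and comp: "\<And>x g. x \<in> W \<Longrightarrow> component x g \<in> W"
    and RG: "\<And>g. RG g \<subseteq> carrier R" and x: "x \<in> W"
  shows "graded_module.component (M\<lparr>carrier := W\<rparr>) (\<lambda>g. W \<inter> MG g) x g = component x g"
  using component_map[OF graded_submodule[OF W comp RG] graded_module_axioms, of "\<lambda>x. x" x g] x by simp

text \<open>The grading passes to \<open>Z\<close> by restriction and from there to the quotient. That \<open>A\<close> is Noetherian
  makes \<open>Z\<close> finitely generated.\<close>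

lemma (in fg_bigraded) fg_bigraded_subquotient:
  assumes Z: "submodule Z (polyA n m) L" "\<And>x g. x \<in> Z \<Longrightarrow> component x g \<in> Z"
    and B: "submodule B (polyA n m) L" "\<And>x g. x \<in> B \<Longrightarrow> component x g \<in> B"
  shows "fg_bigraded n m p (subquotient L Z B) (\<lambda>g. (\<lambda>z. B +>\<^bsub>L\<^esub> z) ` (Z \<inter> LG g))"
proof -
  let ?Z = "L\<lparr>carrier := Z\<rparr>"
  note sZ = submoduleE[OF Z(1)] and sB = submoduleE[OF B(1)]
  interpret B: abelian_subgroup B L
    using submodule.axioms(1)[OF B(1)] by (intro abelian_subgroupI3 additive_subgroup.intro M.abelian_group_axioms)
  have ZL: "z \<in> Z \<Longrightarrow> z \<in> carrier L" for z using sZ(1) by blast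
  have mem: "z \<in> B +>\<^bsub>L\<^esub> z" if "z \<in> Z" for z using B.a_rcos_self ZL[OF that] .
  have zero: "B +>\<^bsub>L\<^esub> \<zero>\<^bsub>L\<^esub> = B" using sB(1) by (rule M.a_coset_add_zero)
  have sm: "(\<Union>x\<in>B +>\<^bsub>L\<^esub> z. B +>\<^bsub>L\<^esub> a \<odot>\<^bsub>L\<^esub> x) = B +>\<^bsub>L\<^esub> a \<odot>\<^bsub>L\<^esub> z"
    if a: "a \<in> carrier (polyA n m)" and z: "z \<in> Z" for a z
  proof -
    have "B +>\<^bsub>L\<^esub> a \<odot>\<^bsub>L\<^esub> x = B +>\<^bsub>L\<^esub> a \<odot>\<^bsub>L\<^esub> z" if "x \<in> B +>\<^bsub>L\<^esub> z" for x
    proof -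
      obtain b where b: "b \<in> B" "x = b \<oplus>\<^bsub>L\<^esub> z" using \<open>x \<in> B +>\<^bsub>L\<^esub> z\<close> by (auto simp: a_r_coset_def')
      have bc: "b \<in> carrier L" using b sB(1) by blast
      have "a \<odot>\<^bsub>L\<^esub> x = a \<odot>\<^bsub>L\<^esub> b \<oplus>\<^bsub>L\<^esub> a \<odot>\<^bsub>L\<^esub> z" unfolding b(2) using a bc ZL[OF z] by (rule smult_r_distr)
      then have "a \<odot>\<^bsub>L\<^esub> x \<in> B +>\<^bsub>L\<^esub> a \<odot>\<^bsub>L\<^esub> z" using sB(4)[OF a b(1)] by (auto simp: a_r_coset_def')
      then show ?thesis using B.a_repr_independence' a ZL[OF z] by (metis smult_closed)
    qed
    then show ?thesis using mem[OF z] by blast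
  qed
  interpret Z: graded_module "polyA n m" ?Z "polyA_comp n m p" "\<lambda>g. Z \<inter> LG g"
    by (rule graded_submodule[OF Z polyA_comp_carrier])
  interpret q: module_surjection "polyA n m" ?Z "subquotient L Z B" "\<lambda>z. B +>\<^bsub>L\<^esub> z"
  proof (intro module_surjection.intro module_surjection_axioms.intro Z.module_axioms)
    show "B +>\<^bsub>L\<^esub> \<zero>\<^bsub>?Z\<^esub> = \<zero>\<^bsub>subquotient L Z B\<^esub>" using zero by (simp add: subquotient_def)
    show "B +>\<^bsub>L\<^esub> (x \<oplus>\<^bsub>?Z\<^esub> y) = (B +>\<^bsub>L\<^esub> x) \<oplus>\<^bsub>subquotient L Z B\<^esub> (B +>\<^bsub>L\<^esub> y)"
      if "x \<in> carrier ?Z" "y \<in> carrier ?Z" for x y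
      using that B.a_rcos_sum[of x y] ZL by (simp add: subquotient_def)
    show "B +>\<^bsub>L\<^esub> (a \<odot>\<^bsub>?Z\<^esub> x) = a \<odot>\<^bsub>subquotient L Z B\<^esub> (B +>\<^bsub>L\<^esub> x)"
      if "a \<in> carrier (polyA n m)" "x \<in> carrier ?Z" for a x
      using that sm by (simp add: subquotient_def)
  qed (simp add: subquotient_def)
  have "graded_module (polyA n m) (subquotient L Z B) (polyA_comp n m p) (\<lambda>g. (\<lambda>z. B +>\<^bsub>L\<^esub> z) ` (Z \<inter> LG g))"
  proof (rule q.graded_image[OF Z.graded_module_axioms polyA_comp_carrier])
    fix x g assume x: "x \<in> carrier ?Z" "B +>\<^bsub>L\<^esub> x = \<zero>\<^bsub>subquotient L Z B\<^esub>"
    then have xZ: "x \<in> Z" and "x \<in> B" using mem by (auto simp: subquotient_def)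
    then have "component x g \<in> B" using B(2) by blast
    moreover have "Z.component x g = component x g"
      by (rule component_submodule[OF Z polyA_comp_carrier xZ])
    ultimately show "B +>\<^bsub>L\<^esub> Z.component x g = \<zero>\<^bsub>subquotient L Z B\<^esub>"
      using B.a_rcos_const by (simp add: subquotient_def)
  qed
  moreover have "fin_gen (polyA n m) ?Z"
  proof -
    obtain G where "finite G" "G \<subseteq> carrier L" "mspan (polyA n m) L G = carrier L"
      using fg by (auto simp: fin_gen_mspan)
    then obtain G' where "finite G'" "G' \<subseteq> Z" "mspan (polyA n m) L G' = Z"
      using submodule_of_fin_gen[OF noetherian_polyA _ _ Z(1)] sZ(1) by metis
    then show ?thesis
      unfolding fin_gen_mspan using mspan_restrict_carrier[OF Z(1)] by (intro exI[of _ G']) simp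
  qed
  ultimately show ?thesis
    using q.fin_gen_image by (intro fg_bigraded.intro fg_bigraded_axioms.intro)
qed

text \<open>The direct power \<open>N\<^sup>B\<close>, the common model of \<open>F \<otimes> N\<close> and \<open>Hom(F, N)\<close> for \<open>F\<close> free with basis \<open>B\<close>.\<close>

definition power_module :: "'i set \<Rightarrow> ('a, 'b, 'd) module_scheme \<Rightarrow> ('a, 'i \<Rightarrow> 'b) module" where
  "power_module B N = \<lparr>carrier = B \<rightarrow>\<^sub>E carrier N, monoid.mult = undefined, one = undefined,
     ring.zero = (\<lambda>b\<in>B. \<zero>\<^bsub>N\<^esub>), add = (\<lambda>x y. \<lambda>b\<in>B. x b \<oplus>\<^bsub>N\<^esub> y b), smult = (\<lambda>a x. \<lambda>b\<in>B. a \<odot>\<^bsub>N\<^esub> x b)\<rparr>"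

lemma power_module_sel [simp]:
  "carrier (power_module B N) = B \<rightarrow>\<^sub>E carrier N" "\<zero>\<^bsub>power_module B N\<^esub> = (\<lambda>b\<in>B. \<zero>\<^bsub>N\<^esub>)"
  "x \<oplus>\<^bsub>power_module B N\<^esub> y = (\<lambda>b\<in>B. x b \<oplus>\<^bsub>N\<^esub> y b)" "a \<odot>\<^bsub>power_module B N\<^esub> x = (\<lambda>b\<in>B. a \<odot>\<^bsub>N\<^esub> x b)"
  by (simp_all add: power_module_def)

lemma module_power:
  assumes "Module.module R N"
  shows "Module.module R (power_module B N)"
proof -
  interpret Module.module R N by fact
  show ?thesis
  proof (intro moduleI R.is_cring abelian_groupI)
    fix x assume x: "x \<in> carrier (power_module B N)"
    show "\<exists>y\<in>carrier (power_module B N). y \<oplus>\<^bsub>power_module B N\<^esub> x = \<zero>\<^bsub>power_module B N\<^esub>"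
      using x by (intro bexI[of _ "\<lambda>b\<in>B. \<ominus>\<^bsub>N\<^esub> x b"]) (auto simp: M.l_neg PiE_iff)
  qed (auto simp: PiE_iff extensional_def fun_eq_iff M.a_ac smult_l_distr smult_r_distr smult_assoc1)
qed

definition power_single :: "'i set \<Rightarrow> ('a, 'b, 'd) module_scheme \<Rightarrow> 'i \<Rightarrow> 'b \<Rightarrow> 'i \<Rightarrow> 'b" where
  "power_single B N b y = (\<lambda>b'\<in>B. if b' = b then y else \<zero>\<^bsub>N\<^esub>)"

lemma mem_if_singles_mem:
  assumes N: "abelian_group N" and B: "finite B" and H: "subgroup H (add_monoid (power_module B N))"
    and x: "x \<in> carrier (power_module B N)" and single: "\<And>b. b \<in> B \<Longrightarrow> power_single B N b (x b) \<in> H"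
  shows "x \<in> H"
proof -
  interpret N: abelian_group N by fact
  have xN: "b \<in> B \<Longrightarrow> x b \<in> carrier N" for b using x by auto
  have "(\<lambda>b\<in>B. if b \<in> C then x b else \<zero>\<^bsub>N\<^esub>) \<in> H" if "finite C" "C \<subseteq> B" for C
    using that
  proof (induction C)
    case empty
    then show ?case using subgroup_add_zero[OF H] by (simp add: restrict_def)
  next
    case (insert c C)
    have eq: "(\<lambda>b\<in>B. if b \<in> insert c C then x b else \<zero>\<^bsub>N\<^esub>)
        = (\<lambda>b\<in>B. if b \<in> C then x b else \<zero>\<^bsub>N\<^esub>) \<oplus>\<^bsub>power_module B N\<^esub> power_single B N c (x c)"
      using insert xN by (auto simp: power_single_def fun_eq_iff)
    show ?case
      unfolding eq by (rule subgroup_add_add[OF H insert.IH single]) (use insert.prems in auto)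
  qed
  from this[OF B subset_refl] show ?thesis
    using x by (simp add: PiE_iff extensional_restrict cong: restrict_cong)
qed

text \<open>The grading of the factor at \<open>b\<close> is shifted by \<open>s b\<close>. Everything is checked on the elements
  \<open>power_single B N b y\<close>, which generate additively because \<open>B\<close> is finite.\<close>

lemma fg_bigraded_power:
  fixes s :: "'i \<Rightarrow> int \<times> int"
  assumes N: "fg_bigraded n m p N NG" and B: "finite B"
  shows "fg_bigraded n m p (power_module B N) (\<lambda>g. \<Pi>\<^sub>E b\<in>B. NG (g + s b))"
proof -
  interpret N: fg_bigraded n m p N NG by (rule N)
  let ?P = "power_module B N"
  interpret P: Module.module "polyA n m" ?P by (rule module_power[OF N.module_axioms])
  have minus: "\<ominus>\<^bsub>?P\<^esub> x = (\<lambda>b\<in>B. \<ominus>\<^bsub>N\<^esub> x b)" if "x \<in> carrier ?P" for x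
    using that by (intro P.M.minus_equality) (auto simp: N.M.l_neg PiE_iff)
  have cN: "y \<in> NG g \<Longrightarrow> y \<in> carrier N" for y g by (rule N.comp_carrier)
  have sub: "subgroup (\<Pi>\<^sub>E b\<in>B. NG (g + s b)) (add_monoid ?P)" for g
  proof (rule P.M.subgroup_addI)
    show sb: "(\<Pi>\<^sub>E b\<in>B. NG (g + s b)) \<subseteq> carrier ?P"
      unfolding power_module_sel by (intro PiE_mono N.comp_subset)
    show "\<ominus>\<^bsub>?P\<^esub> x \<in> (\<Pi>\<^sub>E b\<in>B. NG (g + s b))" if "x \<in> (\<Pi>\<^sub>E b\<in>B. NG (g + s b))" for x
      using that minus[OF subsetD[OF sb that]] N.comp_minus by (auto simp: PiE_iff)
  qed (auto simp: N.comp_zero N.comp_add PiE_iff)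
  have single_comp: "power_single B N b y \<in> (\<Pi>\<^sub>E b'\<in>B. NG (h - s b + s b'))" if "y \<in> NG h" for b y h
    using that N.comp_zero by (auto simp: power_single_def PiE_iff)
  have single_zero: "power_single B N b \<zero>\<^bsub>N\<^esub> = \<zero>\<^bsub>?P\<^esub>" for b by (auto simp: power_single_def)
  have single_add: "power_single B N b (y \<oplus>\<^bsub>N\<^esub> z) = power_single B N b y \<oplus>\<^bsub>?P\<^esub> power_single B N b z"
    if "y \<in> carrier N" "z \<in> carrier N" for b y z
    using that by (auto simp: power_single_def fun_eq_iff)
  have single_car: "power_single B N b y \<in> carrier ?P" if "y \<in> carrier N" for b y
    using that by (auto simp: power_single_def)
  have single_minus: "power_single B N b (\<ominus>\<^bsub>N\<^esub> y) = \<ominus>\<^bsub>?P\<^esub> power_single B N b y" if "y \<in> carrier N" for b y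
  proof -
    have z: "\<ominus>\<^bsub>N\<^esub> \<zero>\<^bsub>N\<^esub> = \<zero>\<^bsub>N\<^esub>" by (rule N.M.minus_equality) simp_all
    show ?thesis
      unfolding minus[OF single_car[OF that]] by (auto simp: power_single_def fun_eq_iff) (simp only: z)
  qed
  have single_smult: "power_single B N b (a \<odot>\<^bsub>N\<^esub> y) = a \<odot>\<^bsub>?P\<^esub> power_single B N b y"
    if "a \<in> carrier (polyA n m)" for a b y
    using that by (auto simp: power_single_def fun_eq_iff)
  have gr: "graded_module (polyA n m) ?P (polyA_comp n m p) (\<lambda>g. \<Pi>\<^sub>E b\<in>B. NG (g + s b))"
  proof (rule graded_moduleI[where pr = "\<lambda>g x. \<lambda>b\<in>B. N.component (x b) (g + s b)"])
    show "a \<odot>\<^bsub>?P\<^esub> x \<in> (\<Pi>\<^sub>E b\<in>B. NG (g + h + s b))"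
      if "a \<in> polyA_comp n m p g" "x \<in> (\<Pi>\<^sub>E b\<in>B. NG (h + s b))" for a x g h
      using that N.comp_smult by (auto simp: PiE_iff add.assoc)
    show "(\<lambda>b\<in>B. N.component ((x \<oplus>\<^bsub>?P\<^esub> y) b) (g + s b))
        = (\<lambda>b\<in>B. N.component (x b) (g + s b)) \<oplus>\<^bsub>?P\<^esub> (\<lambda>b\<in>B. N.component (y b) (g + s b))"
      if "x \<in> carrier ?P" "y \<in> carrier ?P" for g x y
      using that by (auto simp: PiE_iff fun_eq_iff N.component_add)
    show "(\<lambda>b\<in>B. N.component (x b) (g + s b)) \<in> (\<Pi>\<^sub>E b\<in>B. NG (g + s b))" if "x \<in> carrier ?P" for g x
      using that by (auto simp: PiE_iff N.component_in)
    show "(\<lambda>b\<in>B. N.component (x b) (g + s b)) = x" if x: "x \<in> (\<Pi>\<^sub>E b\<in>B. NG (g + s b))" for g x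
    proof (rule extensionalityI[where A = B])
      show "(\<lambda>b\<in>B. N.component (x b) (g + s b)) b = x b" if "b \<in> B" for b
        using N.component_homogeneous[OF PiE_mem[OF x that], of "g + s b"] that by simp
    qed (use x in \<open>auto simp: PiE_iff\<close>)
    show "(\<lambda>b\<in>B. N.component (x b) (h + s b)) = \<zero>\<^bsub>?P\<^esub>"
      if x: "x \<in> (\<Pi>\<^sub>E b\<in>B. NG (g + s b))" and "h \<noteq> g" for g h x
    proof -
      have "N.component (x b) (h + s b) = \<zero>\<^bsub>N\<^esub>" if "b \<in> B" for b
        using N.component_homogeneous[OF PiE_mem[OF x that], of "h + s b"] \<open>h \<noteq> g\<close> by simp
      then show ?thesis by auto
    qed
    show "carrier ?P \<subseteq> generate (add_monoid ?P) (\<Union>g. \<Pi>\<^sub>E b\<in>B. NG (g + s b))" (is "_ \<subseteq> ?H")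
    proof
      fix x assume x: "x \<in> carrier ?P"
      have H: "subgroup ?H (add_monoid ?P)"
        using subgroup_add_subset[OF sub] by (intro P.M.add.generate_is_subgroup) auto
      show "x \<in> ?H"
      proof (rule mem_if_singles_mem[OF N.M.abelian_group_axioms B H x])
        fix b assume "b \<in> B"
        then have xb: "x b \<in> carrier N" using x by auto
        have "subgroup {y \<in> carrier N. power_single B N b y \<in> ?H} (add_monoid N)"
          using subgroup_add_zero[OF H] subgroup_add_add[OF H] subgroup_add_minus[OF H]
          by (intro N.M.subgroup_addI) (auto simp: single_zero single_add single_minus simp del: power_module_sel)
        then have "x b \<in> {y \<in> carrier N. power_single B N b y \<in> ?H}"
        proof (rule N.mem_if_components_mem[OF _ xb])
          fix h
          have "power_single B N b (N.component (x b) h) \<in> ?H"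
            using single_comp[OF N.component_in[OF xb]] by (intro generate.incl) blast
          then show "N.component (x b) h \<in> {y \<in> carrier N. power_single B N b y \<in> ?H}"
            using N.component_closed[OF xb] by simp
        qed
        then show "power_single B N b (x b) \<in> ?H" by simp
      qed
    qed
  qed (rule P.module_axioms sub)+
  have "fin_gen (polyA n m) ?P"
  proof -
    obtain G where G: "finite G" "G \<subseteq> carrier N" "mspan (polyA n m) N G = carrier N"
      using N.fg by (auto simp: fin_gen_mspan)
    define G' where "G' = (\<Union>b\<in>B. power_single B N b ` G)"
    have G': "finite G'" "G' \<subseteq> carrier ?P" using G B single_car unfolding G'_def by blast+
    have H: "submodule (mspan (polyA n m) ?P G') (polyA n m) ?P" (is "submodule ?H _ _")
      by (rule P.mspan_submodule[OF G'(2)])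
    have "carrier ?P \<subseteq> ?H"
    proof
      fix x assume x: "x \<in> carrier ?P"
      show "x \<in> ?H"
      proof (rule mem_if_singles_mem[OF N.M.abelian_group_axioms B submodule.axioms(1)[OF H] x])
        fix b assume b: "b \<in> B"
        have "submodule {y \<in> carrier N. power_single B N b y \<in> ?H} (polyA n m) N"
          using P.submodule_zero[OF H] P.submoduleE(3,4,5)[OF H]
          by (intro N.submoduleI) (auto simp: single_zero single_add single_minus single_smult simp del: power_module_sel)
        moreover have "G \<subseteq> {y \<in> carrier N. power_single B N b y \<in> ?H}"
          using G(2) b mspan_incl[of G' "polyA n m" ?P] unfolding G'_def by blast
        ultimately have "carrier N \<subseteq> {y \<in> carrier N. power_single B N b y \<in> ?H}"
          unfolding G(3)[symmetric] by (rule mspan_minimal)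
        then show "power_single B N b (x b) \<in> ?H" using x b by auto
      qed
    qed
    then show ?thesis
      unfolding fin_gen_mspan using G' P.submoduleE(1)[OF H] by (intro exI[of _ G']) auto
  qed
  then show ?thesis using gr by (intro fg_bigraded.intro fg_bigraded_axioms.intro)
qed

section \<open>Tensor products\<close>

locale tensor_product = U: Module.module R U + V: Module.module R V
  for R :: "('a, 'r) ring_scheme" and U :: "('a, 'u, 'x) module_scheme" and V :: "('a, 'v, 'y) module_scheme"
begin

abbreviation Fr :: "('u \<times> 'v \<Rightarrow>\<^sub>0 int) monoid" where
  "Fr \<equiv> free_Abelian_group (carrier U \<times> carrier V)"

abbreviation cl :: "('u \<times> 'v \<Rightarrow>\<^sub>0 int) \<Rightarrow> ('u \<times> 'v \<Rightarrow>\<^sub>0 int) set" where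
  "cl \<equiv> tensor_class R U V"

sublocale Fr: comm_group Fr by (rule abelian_free_Abelian_group)

lemma Fr_add: "c \<in> carrier Fr \<Longrightarrow> c' \<in> carrier Fr \<Longrightarrow> c + c' \<in> carrier Fr"
  using Fr.m_closed by simp

lemma Fr_minus: "c \<in> carrier Fr \<Longrightarrow> - c \<in> carrier Fr"
  by simp

lemma Fr_diff: "c \<in> carrier Fr \<Longrightarrow> c' \<in> carrier Fr \<Longrightarrow> c - c' \<in> carrier Fr"
  using Fr_add[OF _ Fr_minus] by simp

lemma Fr_frag_of: "u \<in> carrier U \<Longrightarrow> v \<in> carrier V \<Longrightarrow> frag_of (u, v) \<in> carrier Fr"
  by simp

lemma null_subgroup: "subgroup (tensor_null R U V) Fr"
  unfolding tensor_null_def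
  by (rule Fr.generate_is_subgroup) (auto simp del: carrier_free_Abelian_group_iff intro!: Fr_diff Fr_frag_of)

lemma null_carrier: "z \<in> tensor_null R U V \<Longrightarrow> z \<in> carrier Fr"
  using subgroup.subset[OF null_subgroup] by blast

lemma null_zero: "0 \<in> tensor_null R U V"
  using subgroup.one_closed[OF null_subgroup] by simp

lemma null_add: "z \<in> tensor_null R U V \<Longrightarrow> z' \<in> tensor_null R U V \<Longrightarrow> z + z' \<in> tensor_null R U V"
  using subgroup.m_closed[OF null_subgroup] by simp

lemma null_minus: "z \<in> tensor_null R U V \<Longrightarrow> - z \<in> tensor_null R U V"
  using subgroup.m_inv_closed[OF null_subgroup, of z] null_carrier[of z] by simp

text \<open>Additive maps on the free abelian group need to be tested on the bilinearity relations only. With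
  \<open>H\<close> the relations of another tensor product this gives induced maps, with \<open>H\<close> trivial
  it gives additive maps out of the tensor product.\<close>

lemma null_hom_image:
  assumes G: "group G" and E: "E \<in> hom Fr G" and H: "subgroup H G"
    and rel1: "\<And>u u' v. u \<in> carrier U \<Longrightarrow> u' \<in> carrier U \<Longrightarrow> v \<in> carrier V \<Longrightarrow>
      E (frag_of (u \<oplus>\<^bsub>U\<^esub> u', v) - frag_of (u, v) - frag_of (u', v)) \<in> H"
    and rel2: "\<And>u v v'. u \<in> carrier U \<Longrightarrow> v \<in> carrier V \<Longrightarrow> v' \<in> carrier V \<Longrightarrow>
      E (frag_of (u, v \<oplus>\<^bsub>V\<^esub> v') - frag_of (u, v) - frag_of (u, v')) \<in> H"
    and rel3: "\<And>r u v. r \<in> carrier R \<Longrightarrow> u \<in> carrier U \<Longrightarrow> v \<in> carrier V \<Longrightarrow>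
      E (frag_of (r \<odot>\<^bsub>U\<^esub> u, v) - frag_of (u, r \<odot>\<^bsub>V\<^esub> v)) \<in> H"
    and z: "z \<in> tensor_null R U V"
  shows "E z \<in> H"
proof -
  interpret E: group_hom Fr G E
    by (intro group_hom.intro group_hom_axioms.intro Fr.group_axioms G E)
  interpret H: subgroup H G by (rule H)
  have E_zero: "E 0 = \<one>\<^bsub>G\<^esub>" using E.hom_one by simp
  have E_add: "E (a + b) = E a \<otimes>\<^bsub>G\<^esub> E b" if "a \<in> carrier Fr" "b \<in> carrier Fr" for a b
    using E.hom_mult[OF that] by simp
  have "subgroup {c \<in> carrier Fr. E c \<in> H} Fr"
  proof (rule Fr.subgroupI)
    have "0 \<in> {c \<in> carrier Fr. E c \<in> H}" using E_zero H.one_closed Fr.one_closed by simp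
    then show "{c \<in> carrier Fr. E c \<in> H} \<noteq> {}" by blast
    show "inv\<^bsub>Fr\<^esub> a \<in> {c \<in> carrier Fr. E c \<in> H}" if "a \<in> {c \<in> carrier Fr. E c \<in> H}" for a
      using that E.hom_inv[of a] Fr.inv_closed[of a] H.m_inv_closed by auto
    show "a \<otimes>\<^bsub>Fr\<^esub> b \<in> {c \<in> carrier Fr. E c \<in> H}"
      if "a \<in> {c \<in> carrier Fr. E c \<in> H}" "b \<in> {c \<in> carrier Fr. E c \<in> H}" for a b
      using that E_add[of a b] Fr_add[of a b] H.m_closed by (simp del: carrier_free_Abelian_group_iff)
  qed blast
  then have "tensor_null R U V \<subseteq> {c \<in> carrier Fr. E c \<in> H}"
    unfolding tensor_null_def
    using rel1 rel2 rel3
    by (intro Fr.generate_subgroup_incl) (auto simp del: carrier_free_Abelian_group_iff intro!: Fr_diff Fr_frag_of)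
  then show ?thesis using z by blast
qed

lemma null_rel_add_left:
  "u \<in> carrier U \<Longrightarrow> u' \<in> carrier U \<Longrightarrow> v \<in> carrier V
    \<Longrightarrow> frag_of (u \<oplus>\<^bsub>U\<^esub> u', v) - frag_of (u, v) - frag_of (u', v) \<in> tensor_null R U V"
  unfolding tensor_null_def by (intro generate.incl) blast

lemma null_rel_add_right:
  "u \<in> carrier U \<Longrightarrow> v \<in> carrier V \<Longrightarrow> v' \<in> carrier V
    \<Longrightarrow> frag_of (u, v \<oplus>\<^bsub>V\<^esub> v') - frag_of (u, v) - frag_of (u, v') \<in> tensor_null R U V"
  unfolding tensor_null_def by (intro generate.incl) blast

lemma null_rel_smult:
  "r \<in> carrier R \<Longrightarrow> u \<in> carrier U \<Longrightarrow> v \<in> carrier V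
    \<Longrightarrow> frag_of (r \<odot>\<^bsub>U\<^esub> u, v) - frag_of (u, r \<odot>\<^bsub>V\<^esub> v) \<in> tensor_null R U V"
  unfolding tensor_null_def by (intro generate.incl) blast

lemma cl_self: "c \<in> carrier Fr \<Longrightarrow> c \<in> cl c"
  unfolding tensor_class_def using Fr.rcos_self null_subgroup by blast

lemma cl_eqI:
  assumes "c \<in> carrier Fr" "c' \<in> carrier Fr" "c - c' \<in> tensor_null R U V"
  shows "cl c = cl c'"
proof -
  have "c \<in> cl c'"
    using assms(3) unfolding tensor_class_def r_coset_def by (auto intro!: bexI[of _ "c - c'"])
  then show ?thesis
    unfolding tensor_class_def using Fr.repr_independence[OF _ assms(2) null_subgroup] by metis
qed

lemma cl_eq_iff:
  assumes "c \<in> carrier Fr" "c' \<in> carrier Fr"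
  shows "cl c = cl c' \<longleftrightarrow> c - c' \<in> tensor_null R U V"
proof
  assume "cl c = cl c'"
  then have "c \<in> cl c'" using cl_self[OF assms(1)] by simp
  then show "c - c' \<in> tensor_null R U V" by (auto simp: tensor_class_def r_coset_def)
qed (rule cl_eqI[OF assms])

lemma Fr_sum: "(\<And>i. i \<in> I \<Longrightarrow> c i \<in> carrier Fr) \<Longrightarrow> sum c I \<in> carrier Fr"
  by (induction I rule: infinite_finite_induct) (use Fr_add in \<open>auto simp del: carrier_free_Abelian_group_iff\<close>, auto)

lemma null_sum: "(\<And>i. i \<in> I \<Longrightarrow> c i \<in> tensor_null R U V) \<Longrightarrow> sum c I \<in> tensor_null R U V"
  by (induction I rule: infinite_finite_induct) (auto simp: null_zero null_add)

lemma cl_memE: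
  assumes "c' \<in> cl c"
  obtains z where "z \<in> tensor_null R U V" "c' = z + c"
  using assms unfolding tensor_class_def r_coset_def by auto

lemma cl_zero: "cl 0 = tensor_null R U V"
  unfolding tensor_class_def using Fr.coset_mult_one[OF subgroup.subset[OF null_subgroup]] by simp

lemma carrier_tensor: "carrier (tensor R U V) = cl ` carrier Fr"
  by (auto simp: tensor_def RCOSETS_def tensor_class_def)

lemma zero_tensor: "\<zero>\<^bsub>tensor R U V\<^esub> = cl 0"
  by (simp add: tensor_def cl_zero)

lemma add_tensor:
  assumes "c \<in> carrier Fr" "c' \<in> carrier Fr"
  shows "cl c \<oplus>\<^bsub>tensor R U V\<^esub> cl c' = cl (c + c')"
proof -
  interpret normal "tensor_null R U V" Fr using Fr.subgroup_imp_normal[OF null_subgroup] .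
  show ?thesis using rcos_sum[OF assms] by (simp add: tensor_def tensor_class_def)
qed

lemma cl_add_left:
  assumes "u \<in> carrier U" "u' \<in> carrier U" "v \<in> carrier V"
  shows "cl (frag_of (u \<oplus>\<^bsub>U\<^esub> u', v)) = cl (frag_of (u, v) + frag_of (u', v))"
proof (intro cl_eqI Fr_add Fr_frag_of)
  show "frag_of (u \<oplus>\<^bsub>U\<^esub> u', v) - (frag_of (u, v) + frag_of (u', v)) \<in> tensor_null R U V"
    using null_rel_add_left[OF assms] by (simp add: diff_diff_eq)
qed (use assms in auto)

lemma cl_smult:
  assumes "r \<in> carrier R" "u \<in> carrier U" "v \<in> carrier V"
  shows "cl (frag_of (r \<odot>\<^bsub>U\<^esub> u, v)) = cl (frag_of (u, r \<odot>\<^bsub>V\<^esub> v))"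
  by (intro cl_eqI Fr_frag_of null_rel_smult) (use assms in auto)

lemma cl_zero_left:
  assumes "v \<in> carrier V"
  shows "cl (frag_of (\<zero>\<^bsub>U\<^esub>, v)) = cl 0"
proof -
  have "- frag_of (\<zero>\<^bsub>U\<^esub>, v) \<in> tensor_null R U V"
    using null_rel_add_left[OF U.M.zero_closed U.M.zero_closed assms] by simp
  then have "frag_of (\<zero>\<^bsub>U\<^esub>, v) - 0 \<in> tensor_null R U V" using null_minus by fastforce
  then show ?thesis using assms Fr.one_closed by (intro cl_eqI Fr_frag_of) auto
qed

lemma cl_minus_left:
  assumes "u \<in> carrier U" "v \<in> carrier V"
  shows "cl (frag_of (\<ominus>\<^bsub>U\<^esub> u, v)) = cl (- frag_of (u, v))"
proof (intro cl_eqI Fr_frag_of Fr_minus)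
  have "cl (frag_of (\<ominus>\<^bsub>U\<^esub> u, v) + frag_of (u, v)) = cl 0"
    using cl_add_left[of "\<ominus>\<^bsub>U\<^esub> u" u v] cl_zero_left assms by (simp add: U.M.l_neg)
  then have "frag_of (\<ominus>\<^bsub>U\<^esub> u, v) + frag_of (u, v) \<in> tensor_null R U V"
    using cl_self[OF Fr_add[OF Fr_frag_of Fr_frag_of], of "\<ominus>\<^bsub>U\<^esub> u" v u v] assms cl_zero by simp
  then show "frag_of (\<ominus>\<^bsub>U\<^esub> u, v) - - frag_of (u, v) \<in> tensor_null R U V" by simp
qed (use assms in auto)

end

lemma frag_extend_hom: "frag_extend h \<in> hom (free_Abelian_group S) (free_Abelian_group T)"
  if "\<And>x. x \<in> S \<Longrightarrow> h x \<in> carrier (free_Abelian_group T)"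
  using that keys_frag_extend[of h] by (fastforce simp: hom_def frag_extend_add)

text \<open>The union in the definitions of scalar multiplication and of induced maps runs over
  equal sets, because \<open>R\<close>-linear maps \<open>f\<close> and \<open>g\<close> of the factors respect the relations. Scalar
  multiplication is the case where \<open>f\<close> is the identity, \<open>tensor_map\<close> the one where \<open>g\<close> is.\<close>

lemma tensor_class_map:
  assumes UV: "tensor_product R U V" and UV': "tensor_product R U' V'"
    and f: "\<And>u. u \<in> carrier U \<Longrightarrow> f u \<in> carrier U'"
      "\<And>u u'. u \<in> carrier U \<Longrightarrow> u' \<in> carrier U \<Longrightarrow> f (u \<oplus>\<^bsub>U\<^esub> u') = f u \<oplus>\<^bsub>U'\<^esub> f u'"
      "\<And>r u. r \<in> carrier R \<Longrightarrow> u \<in> carrier U \<Longrightarrow> f (r \<odot>\<^bsub>U\<^esub> u) = r \<odot>\<^bsub>U'\<^esub> f u"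
    and g: "\<And>v. v \<in> carrier V \<Longrightarrow> g v \<in> carrier V'"
      "\<And>v v'. v \<in> carrier V \<Longrightarrow> v' \<in> carrier V \<Longrightarrow> g (v \<oplus>\<^bsub>V\<^esub> v') = g v \<oplus>\<^bsub>V'\<^esub> g v'"
      "\<And>r v. r \<in> carrier R \<Longrightarrow> v \<in> carrier V \<Longrightarrow> g (r \<odot>\<^bsub>V\<^esub> v) = r \<odot>\<^bsub>V'\<^esub> g v"
    and c: "c \<in> carrier (free_Abelian_group (carrier U \<times> carrier V))"
  defines "E \<equiv> frag_extend (\<lambda>(u, v). frag_of (f u, g v))"
  shows "(\<Union>c'\<in>tensor_class R U V c. tensor_class R U' V' (E c')) = tensor_class R U' V' (E c)"
    and "E c \<in> carrier (free_Abelian_group (carrier U' \<times> carrier V'))"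
proof -
  interpret T: tensor_product R U V by (rule UV)
  interpret T': tensor_product R U' V' by (rule UV')
  have Eh: "E \<in> hom T.Fr T'.Fr" unfolding E_def using f(1) g(1) by (intro frag_extend_hom) auto
  have Ecl: "E c \<in> carrier T'.Fr" if "c \<in> carrier T.Fr" for c using Eh that by (rule hom_in_carrier)
  have Enull: "E z \<in> tensor_null R U' V'" if "z \<in> tensor_null R U V" for z
  proof (rule T.null_hom_image[OF T'.Fr.group_axioms Eh T'.null_subgroup _ _ _ that])
    show "E (frag_of (u \<oplus>\<^bsub>U\<^esub> u', v) - frag_of (u, v) - frag_of (u', v)) \<in> tensor_null R U' V'"
      if "u \<in> carrier U" "u' \<in> carrier U" "v \<in> carrier V" for u u' v
      unfolding E_def frag_extend_diff frag_extend_of prod.case using that f g by (simp add: T'.null_rel_add_left)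
    show "E (frag_of (u, v \<oplus>\<^bsub>V\<^esub> v') - frag_of (u, v) - frag_of (u, v')) \<in> tensor_null R U' V'"
      if "u \<in> carrier U" "v \<in> carrier V" "v' \<in> carrier V" for u v v'
      unfolding E_def frag_extend_diff frag_extend_of prod.case using that f g by (simp add: T'.null_rel_add_right)
    show "E (frag_of (r \<odot>\<^bsub>U\<^esub> u, v) - frag_of (u, r \<odot>\<^bsub>V\<^esub> v)) \<in> tensor_null R U' V'"
      if "r \<in> carrier R" "u \<in> carrier U" "v \<in> carrier V" for r u v
      unfolding E_def frag_extend_diff frag_extend_of prod.case using that f g by (simp add: T'.null_rel_smult)
  qed
  have "T'.cl (E c') = T'.cl (E c)" if c': "c' \<in> T.cl c" for c'
  proof -
    obtain z where z: "z \<in> tensor_null R U V" "c' = z + c" using T.cl_memE[OF c'] .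
    have "c' \<in> carrier T.Fr" unfolding z(2) by (rule T.Fr_add[OF T.null_carrier[OF z(1)] c])
    moreover have "E c' - E c = E z" unfolding z(2) E_def frag_extend_add by simp
    ultimately show ?thesis using Ecl c Enull[OF z(1)] by (intro T'.cl_eqI) simp_all
  qed
  then show "(\<Union>c'\<in>T.cl c. T'.cl (E c')) = T'.cl (E c)" using T.cl_self[OF c] by blast
  show "E c \<in> carrier T'.Fr" by (rule Ecl[OF c])
qed

locale graded_basis = graded_module "polyS n" F "polyS_comp n" FG
  for n :: nat and F :: "(('k::field) mpoly, 'f, 'x) module_scheme" and FG :: "int \<Rightarrow> 'f set" +
  fixes B :: "'f set" and dg :: "'f \<Rightarrow> int"
  assumes finite_basis: "finite B"
    and basis_degree: "b \<in> B \<Longrightarrow> b \<in> FG (dg b)"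
    and basis: "u \<in> carrier F \<Longrightarrow> \<exists>!c. c \<in> B \<rightarrow>\<^sub>E carrier (polyS n) \<and> u = (\<Oplus>\<^bsub>F\<^esub>b\<in>B. c b \<odot>\<^bsub>F\<^esub> b)"
begin

definition coord :: "'f \<Rightarrow> 'f \<Rightarrow> 'k mpoly" where
  "coord u = (THE c. c \<in> B \<rightarrow>\<^sub>E carrier (polyS n) \<and> u = (\<Oplus>\<^bsub>F\<^esub>b\<in>B. c b \<odot>\<^bsub>F\<^esub> b))"

lemma basis_carrier: "b \<in> B \<Longrightarrow> b \<in> carrier F"
  using comp_carrier[OF basis_degree] .

lemma coord_props: "u \<in> carrier F \<Longrightarrow> coord u \<in> B \<rightarrow>\<^sub>E carrier (polyS n) \<and> u = (\<Oplus>\<^bsub>F\<^esub>b\<in>B. coord u b \<odot>\<^bsub>F\<^esub> b)"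
  unfolding coord_def by (rule theI'[OF basis])

lemma coord_closed: "u \<in> carrier F \<Longrightarrow> b \<in> B \<Longrightarrow> coord u b \<in> carrier (polyS n)"
  by (rule PiE_mem[OF conjunct1[OF coord_props]])

lemma coord_eqI:
  assumes c: "\<And>b. b \<in> B \<Longrightarrow> c b \<in> carrier (polyS n)" and u: "u = (\<Oplus>\<^bsub>F\<^esub>b\<in>B. c b \<odot>\<^bsub>F\<^esub> b)" and b: "b \<in> B"
  shows "coord u b = c b"
proof -
  have cb: "(\<lambda>b. c b \<odot>\<^bsub>F\<^esub> b) \<in> B \<rightarrow> carrier F" using c basis_carrier by auto
  then have uF: "u \<in> carrier F" unfolding u by (rule M.finsum_closed)
  have "u = (\<Oplus>\<^bsub>F\<^esub>b\<in>B. restrict c B b \<odot>\<^bsub>F\<^esub> b)"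
    unfolding u by (rule M.finsum_cong'[symmetric, OF refl cb]) simp
  moreover have "restrict c B \<in> B \<rightarrow>\<^sub>E carrier (polyS n)" using c by auto
  ultimately have "coord u = restrict c B"
    unfolding coord_def using uF by (intro the1_equality[OF basis] conjI)
  then show ?thesis using b by simp
qed

lemma coord_add:
  assumes u: "u \<in> carrier F" and u': "u' \<in> carrier F" and b: "b \<in> B"
  shows "coord (u \<oplus>\<^bsub>F\<^esub> u') b = coord u b \<oplus>\<^bsub>polyS n\<^esub> coord u' b"
proof (rule coord_eqI[OF _ _ b])
  have c: "(\<lambda>b. coord v b \<odot>\<^bsub>F\<^esub> b) \<in> B \<rightarrow> carrier F" if "v \<in> carrier F" for v
    using coord_closed[OF that] basis_carrier by auto
  have "u \<oplus>\<^bsub>F\<^esub> u' = (\<Oplus>\<^bsub>F\<^esub>b\<in>B. coord u b \<odot>\<^bsub>F\<^esub> b) \<oplus>\<^bsub>F\<^esub> (\<Oplus>\<^bsub>F\<^esub>b\<in>B. coord u' b \<odot>\<^bsub>F\<^esub> b)"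
    using coord_props u u' by auto
  also have "\<dots> = (\<Oplus>\<^bsub>F\<^esub>b\<in>B. coord u b \<odot>\<^bsub>F\<^esub> b \<oplus>\<^bsub>F\<^esub> coord u' b \<odot>\<^bsub>F\<^esub> b)"
    by (rule M.finsum_addf[symmetric, OF c[OF u] c[OF u']])
  also have "\<dots> = (\<Oplus>\<^bsub>F\<^esub>b\<in>B. (coord u b \<oplus>\<^bsub>polyS n\<^esub> coord u' b) \<odot>\<^bsub>F\<^esub> b)"
    by (rule M.finsum_cong') (use u u' coord_closed basis_carrier in \<open>auto simp: smult_l_distr\<close>)
  finally show "u \<oplus>\<^bsub>F\<^esub> u' = \<dots>" .
qed (use u u' coord_closed in auto)

lemma coord_smult:
  assumes r: "r \<in> carrier (polyS n)" and u: "u \<in> carrier F" and b: "b \<in> B"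
  shows "coord (r \<odot>\<^bsub>F\<^esub> u) b = r \<otimes>\<^bsub>polyS n\<^esub> coord u b"
proof (rule coord_eqI[OF _ _ b])
  have c: "(\<lambda>b. coord u b \<odot>\<^bsub>F\<^esub> b) \<in> B \<rightarrow> carrier F"
    using coord_closed[OF u] basis_carrier by auto
  have "r \<odot>\<^bsub>F\<^esub> u = r \<odot>\<^bsub>F\<^esub> (\<Oplus>\<^bsub>F\<^esub>b\<in>B. coord u b \<odot>\<^bsub>F\<^esub> b)"
    using coord_props u by auto
  also have "\<dots> = (\<Oplus>\<^bsub>F\<^esub>b\<in>B. r \<odot>\<^bsub>F\<^esub> (coord u b \<odot>\<^bsub>F\<^esub> b))"
    by (rule finsum_smult_ldistr[OF finite_basis r c])
  also have "\<dots> = (\<Oplus>\<^bsub>F\<^esub>b\<in>B. (r \<otimes>\<^bsub>polyS n\<^esub> coord u b) \<odot>\<^bsub>F\<^esub> b)"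
    by (rule M.finsum_cong') (use u r coord_closed basis_carrier in \<open>auto simp: smult_assoc1\<close>)
  finally show "r \<odot>\<^bsub>F\<^esub> u = \<dots>" .
qed (use u r coord_closed in auto)

lemma coord_basis:
  assumes b: "b \<in> B" and b': "b' \<in> B"
  shows "coord b b' = (if b' = b then \<one>\<^bsub>polyS n\<^esub> else \<zero>\<^bsub>polyS n\<^esub>)"
proof (rule coord_eqI[OF _ _ b', where c = "\<lambda>b'. if b' = b then \<one>\<^bsub>polyS n\<^esub> else \<zero>\<^bsub>polyS n\<^esub>"])
  have "(\<Oplus>\<^bsub>F\<^esub>b'\<in>B. (if b' = b then \<one>\<^bsub>polyS n\<^esub> else \<zero>\<^bsub>polyS n\<^esub>) \<odot>\<^bsub>F\<^esub> b')
      = (\<Oplus>\<^bsub>F\<^esub>b'\<in>B. if b = b' then b' else \<zero>\<^bsub>F\<^esub>)"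
    by (rule M.finsum_cong') (use basis_carrier in auto)
  also have "\<dots> = b" by (rule M.finsum_singleton[OF b finite_basis]) (use basis_carrier in auto)
  finally show "b = (\<Oplus>\<^bsub>F\<^esub>b'\<in>B. (if b' = b then \<one>\<^bsub>polyS n\<^esub> else \<zero>\<^bsub>polyS n\<^esub>) \<odot>\<^bsub>F\<^esub> b')" by simp
qed auto

lemma basis_subset: "B \<subseteq> carrier F"
  using basis_carrier by blast

lemma basis_spans: "mspan (polyS n) F B = carrier F"
proof
  note sub = mspan_submodule[OF basis_subset]
  show "mspan (polyS n) F B \<subseteq> carrier F" by (rule submoduleE(1)[OF sub])
  show "carrier F \<subseteq> mspan (polyS n) F B"
  proof
    fix u assume u: "u \<in> carrier F"
    have "(\<Oplus>\<^bsub>F\<^esub>b\<in>B. coord u b \<odot>\<^bsub>F\<^esub> b) \<in> mspan (polyS n) F B"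
    proof (rule M.subgroup_finsum[OF submodule.axioms(1)[OF sub]])
      fix b assume b: "b \<in> B"
      show "coord u b \<odot>\<^bsub>F\<^esub> b \<in> mspan (polyS n) F B"
        using submoduleE(4)[OF sub coord_closed[OF u b] subsetD[OF mspan_incl b]] .
    qed
    then show "u \<in> mspan (polyS n) F B" using coord_props[OF u] by simp
  qed
qed

lemma basis_induct:
  assumes u: "u \<in> carrier F" and H: "submodule H (polyS n) F" and b: "\<And>b. b \<in> B \<Longrightarrow> b \<in> H"
  shows "u \<in> H"
  using mspan_minimal[OF H, of B] b u basis_spans by blast

lemma homogeneous_basis_induct:
  assumes u: "u \<in> FG k" and H: "\<And>k. subgroup (H k) (add_monoid F)"
    and const: "\<And>c k u. u \<in> H k \<Longrightarrow> mpoly_const c \<odot>\<^bsub>F\<^esub> u \<in> H k"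
    and var: "\<And>v k u. v \<in> VarX ` {1..n} \<Longrightarrow> u \<in> H k \<Longrightarrow> mpoly_var v \<odot>\<^bsub>F\<^esub> u \<in> H (1 + k)"
    and b: "\<And>b. b \<in> B \<Longrightarrow> b \<in> H (dg b)"
  shows "u \<in> H k"
proof -
  have "component u k \<in> H k"
  proof (rule components_in_family[where V = "VarX ` {1..n}" and RG = "polyS_comp n" and w = "\<lambda>_. 1" and G = B,
        OF graded_module_axioms[unfolded polyS_def] polyS_const polyS_var basis_subset])
    show "mspan (poly_ring (VarX ` {1..n})) F B = carrier F" using basis_spans by (simp add: polyS_def)
    show "\<exists>g. x \<in> FG g \<and> x \<in> H g" if "x \<in> B" for x using basis_degree[OF that] b[OF that] by blast
  qed (use H const var comp_carrier[OF u] in auto)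
  then show ?thesis using component_homogeneous[OF u] by simp
qed

end

locale free_tensor = F: graded_basis n F FG B dg + N: fg_bigraded n m p N NG
  for n m :: nat and p :: "nat \<Rightarrow> nat"
    and F :: "(('k::field) mpoly, 'f) module" and FG :: "int \<Rightarrow> 'f set" and B :: "'f set" and dg :: "'f \<Rightarrow> int"
    and N :: "('k mpoly, 'v) module" and NG :: "int \<times> int \<Rightarrow> 'v set"
begin

sublocale T: tensor_product "polyS n" F N
  by (intro tensor_product.intro F.module_axioms N.S.module_axioms)

abbreviation "TN \<equiv> tensor (polyS n) F N"
abbreviation "P \<equiv> power_module B N"

text \<open>The element \<open>\<Sum>\<^sub>b b \<otimes> x\<^sub>b\<close>, before passing to classes. Its class depends linearly on \<open>x\<close>, and \<open>N\<^sup>B\<close> is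
  thereby identified with \<open>F \<otimes> N\<close>.\<close>

definition total :: "('f \<Rightarrow> 'v) \<Rightarrow> ('f \<times> 'v \<Rightarrow>\<^sub>0 int)" where
  "total x = (\<Sum>b\<in>B. frag_of (b, x b))"

lemma total_closed: "x \<in> carrier P \<Longrightarrow> total x \<in> carrier T.Fr"
  unfolding total_def by (intro T.Fr_sum T.Fr_frag_of F.basis_carrier) auto

lemma smult_N_commute:
  assumes "a \<in> carrier (polyA n m)" "r \<in> carrier (polyS n)" "v \<in> carrier N"
  shows "a \<odot>\<^bsub>N\<^esub> (r \<odot>\<^bsub>N\<^esub> v) = r \<odot>\<^bsub>N\<^esub> (a \<odot>\<^bsub>N\<^esub> v)"
proof -
  have r: "r \<in> carrier (polyA n m)" using assms(2) polyS_subset_polyA by blast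
  show ?thesis
    using N.smult_assoc1[OF assms(1) r assms(3)] N.smult_assoc1[OF r assms(1,3)] N.R.m_comm[OF assms(1) r] by simp
qed

lemma smult_tensor:
  assumes a: "a \<in> carrier (polyA n m)" and c: "c \<in> carrier T.Fr"
  shows "a \<odot>\<^bsub>TN\<^esub> T.cl c = T.cl (frag_extend (\<lambda>(u, v). frag_of (u, a \<odot>\<^bsub>N\<^esub> v)) c)"
  using tensor_class_map(1)[OF T.tensor_product_axioms T.tensor_product_axioms, where f = "\<lambda>u. u" and g = "\<lambda>v. a \<odot>\<^bsub>N\<^esub> v" and c = c]
    a c smult_N_commute[OF a] by (simp add: tensor_def N.smult_r_distr)

lemma smult_class_closed:
  assumes a: "a \<in> carrier (polyA n m)" and c: "c \<in> carrier T.Fr"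
  shows "frag_extend (\<lambda>(u, v). frag_of (u, a \<odot>\<^bsub>N\<^esub> v)) c \<in> carrier T.Fr"
  by (rule tensor_class_map(2)[OF T.tensor_product_axioms T.tensor_product_axioms, where f = "\<lambda>u. u"])
    (use a c smult_N_commute[OF a] in \<open>simp_all add: N.smult_r_distr\<close>)

lemma total_add:
  assumes x: "x \<in> carrier P" and y: "y \<in> carrier P"
  shows "total (x \<oplus>\<^bsub>P\<^esub> y) - (total x + total y) \<in> tensor_null (polyS n) F N"
proof -
  have "total (x \<oplus>\<^bsub>P\<^esub> y) - (total x + total y)
      = (\<Sum>b\<in>B. frag_of (b, x b \<oplus>\<^bsub>N\<^esub> y b) - frag_of (b, x b) - frag_of (b, y b))"
    by (simp add: total_def sum_subtractf sum.distrib diff_diff_eq)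
  also have "\<dots> \<in> tensor_null (polyS n) F N"
    using x y F.basis_carrier by (intro T.null_sum T.null_rel_add_right) auto
  finally show ?thesis .
qed

lemma frag_of_zero_null:
  assumes "u \<in> carrier F"
  shows "frag_of (u, \<zero>\<^bsub>N\<^esub>) \<in> tensor_null (polyS n) F N"
proof -
  have "- frag_of (u, \<zero>\<^bsub>N\<^esub>) \<in> tensor_null (polyS n) F N"
    using T.null_rel_add_right[OF assms N.M.zero_closed N.M.zero_closed] by simp
  then show ?thesis using T.null_minus by fastforce
qed

lemma total_zero: "total \<zero>\<^bsub>P\<^esub> \<in> tensor_null (polyS n) F N"
  unfolding total_def using F.basis_carrier frag_of_zero_null by (intro T.null_sum) auto

lemma total_single:
  assumes b: "b \<in> B" and v: "v \<in> carrier N"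
  shows "total (power_single B N b v) - frag_of (b, v) \<in> tensor_null (polyS n) F N"
proof -
  have "total (power_single B N b v) = frag_of (b, v) + (\<Sum>b'\<in>B - {b}. frag_of (b', \<zero>\<^bsub>N\<^esub>))"
    unfolding total_def by (subst sum.remove[OF F.finite_basis b]) (auto simp: power_single_def b intro!: sum.cong)
  moreover have "(\<Sum>b'\<in>B - {b}. frag_of (b', \<zero>\<^bsub>N\<^esub>)) \<in> tensor_null (polyS n) F N"
    using F.basis_carrier frag_of_zero_null by (intro T.null_sum) auto
  ultimately show ?thesis by simp
qed

interpretation P: Module.module "polyA n m" P by (rule module_power[OF N.module_axioms])

abbreviation to_tensor :: "('f \<Rightarrow> 'v) \<Rightarrow> ('f \<times> 'v \<Rightarrow>\<^sub>0 int) set" where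
  "to_tensor x \<equiv> T.cl (total x)"

lemma to_tensor_add:
  assumes "x \<in> carrier P" "y \<in> carrier P"
  shows "to_tensor (x \<oplus>\<^bsub>P\<^esub> y) = to_tensor x \<oplus>\<^bsub>TN\<^esub> to_tensor y"
proof -
  have "T.cl (total (x \<oplus>\<^bsub>P\<^esub> y)) = T.cl (total x + total y)"
    by (intro T.cl_eqI T.Fr_add total_closed total_add assms P.M.a_closed)
  then show ?thesis using T.add_tensor[OF total_closed total_closed] assms by metis
qed

lemma in_rangeE:
  assumes "C \<in> to_tensor ` carrier P"
  obtains x where "x \<in> carrier P" "to_tensor x = C"
  using assms by (rule imageE) (rule that, assumption, rule sym)

lemma diff_in_range:
  assumes c: "c \<in> carrier T.Fr" "c' \<in> carrier T.Fr" and r: "T.cl c \<in> to_tensor ` carrier P" "T.cl c' \<in> to_tensor ` carrier P"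
  shows "T.cl (c - c') \<in> to_tensor ` carrier P"
proof -
  obtain x where x: "x \<in> carrier P" "T.cl (total x) = T.cl c" by (rule in_rangeE[OF r(1)])
  obtain y where y: "y \<in> carrier P" "T.cl (total y) = T.cl c'" by (rule in_rangeE[OF r(2)])
  define z where "z = x \<oplus>\<^bsub>P\<^esub> \<ominus>\<^bsub>P\<^esub> y"
  have z: "z \<in> carrier P" "z \<oplus>\<^bsub>P\<^esub> y = x"
    unfolding z_def using x(1) y(1)
    by (rule P.M.a_closed[OF _ P.M.a_inv_closed]) (simp only: P.M.a_assoc x y P.M.a_inv_closed P.M.l_neg P.M.r_zero)
  have 1: "total x - c \<in> tensor_null (polyS n) F N" using T.cl_eq_iff[OF total_closed[OF x(1)] c(1)] x by simp
  have 2: "total y - c' \<in> tensor_null (polyS n) F N" using T.cl_eq_iff[OF total_closed[OF y(1)] c(2)] y by simp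
  have 3: "total x - (total z + total y) \<in> tensor_null (polyS n) F N" using total_add[OF z(1) y(1)] unfolding z(2) .
  have "total z - (c - c') = (total x - c) + - (total y - c') + - (total x - (total z + total y))" by simp
  also have "\<dots> \<in> tensor_null (polyS n) F N" by (intro T.null_add T.null_minus 1 2 3)
  finally have "T.cl (total z) = T.cl (c - c')" by (intro T.cl_eqI total_closed z(1) T.Fr_diff c)
  then show ?thesis by (rule image_eqI[OF sym z(1)])
qed

lemma add_in_range:
  assumes c: "c \<in> carrier T.Fr" "c' \<in> carrier T.Fr" and r: "T.cl c \<in> to_tensor ` carrier P" "T.cl c' \<in> to_tensor ` carrier P"
  shows "T.cl (c + c') \<in> to_tensor ` carrier P"
proof -
  obtain x where x: "x \<in> carrier P" "T.cl (total x) = T.cl c" by (rule in_rangeE[OF r(1)])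
  obtain y where y: "y \<in> carrier P" "T.cl (total y) = T.cl c'" by (rule in_rangeE[OF r(2)])
  have "T.cl (c + c') = to_tensor (x \<oplus>\<^bsub>P\<^esub> y)"
    using to_tensor_add[OF x(1) y(1)] x y T.add_tensor[OF c] by simp
  then show ?thesis by (rule image_eqI[OF _ P.M.a_closed[OF x(1) y(1)]])
qed

lemma cl_zero_total: "T.cl 0 = to_tensor \<zero>\<^bsub>P\<^esub>"
  using total_zero T.null_minus[OF total_zero] T.Fr.one_closed
  by (intro T.cl_eqI total_closed P.M.zero_closed) auto

lemma zero_in_range: "T.cl 0 \<in> to_tensor ` carrier P"
  unfolding cl_zero_total by (rule imageI) (rule P.M.zero_closed)

text \<open>Tensors \<open>u \<otimes> v\<close> reduce to the case where \<open>u\<close> is a basis element, since coefficients from \<open>S\<close> can be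
  moved to the second factor.\<close>

lemma pure_in_range:
  assumes u: "u \<in> carrier F" and v: "v \<in> carrier N"
  shows "T.cl (frag_of (u, v)) \<in> to_tensor ` carrier P"
proof -
  define H where "H = {u \<in> carrier F. \<forall>v\<in>carrier N. T.cl (frag_of (u, v)) \<in> to_tensor ` carrier P}"
  have "submodule H (polyS n) F"
  proof (rule F.submoduleI)
    show "\<zero>\<^bsub>F\<^esub> \<in> H" using T.cl_zero_left zero_in_range by (simp add: H_def)
    show "\<ominus>\<^bsub>F\<^esub> u \<in> H" if "u \<in> H" for u
      using that T.cl_minus_left[of u] diff_in_range[OF T.Fr.one_closed T.Fr_frag_of, of u] zero_in_range
      by (auto simp: H_def)
    show "u \<oplus>\<^bsub>F\<^esub> u' \<in> H" if "u \<in> H" "u' \<in> H" for u u'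
      using that T.cl_add_left[of u u'] add_in_range[OF T.Fr_frag_of T.Fr_frag_of, of u _ u'] by (auto simp: H_def)
    show "r \<odot>\<^bsub>F\<^esub> u \<in> H" if "r \<in> carrier (polyS n)" "u \<in> H" for r u
      using that T.cl_smult[of r u] by (auto simp: H_def)
  qed (auto simp: H_def)
  moreover have "b \<in> H" if b: "b \<in> B" for b
  proof -
    have "T.cl (frag_of (b, v)) \<in> to_tensor ` carrier P" if v: "v \<in> carrier N" for v
    proof -
      have s: "power_single B N b v \<in> carrier P" using v by (auto simp: power_single_def)
      have "to_tensor (power_single B N b v) = T.cl (frag_of (b, v))"
        by (intro T.cl_eqI total_closed s T.Fr_frag_of total_single b v F.basis_carrier)
      then show ?thesis by (rule image_eqI[OF sym s])
    qed
    then show ?thesis using F.basis_carrier[OF b] by (simp add: H_def)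
  qed
  ultimately have "u \<in> H" by (rule F.basis_induct[OF u])
  then show ?thesis using v by (simp add: H_def)
qed

lemma to_tensor_surj: "carrier TN = to_tensor ` carrier P"
proof
  have "T.cl c \<in> to_tensor ` carrier P" if c: "c \<in> carrier T.Fr" for c
  proof -
    have "Poly_Mapping.keys c \<subseteq> carrier F \<times> carrier N" using c by simp
    then show ?thesis
    proof (rule free_Abelian_group_induct[where P = "\<lambda>c. T.cl c \<in> to_tensor ` carrier P"])
      show "T.cl (x - y) \<in> to_tensor ` carrier P"
        if "Poly_Mapping.keys x \<subseteq> carrier F \<times> carrier N" "Poly_Mapping.keys y \<subseteq> carrier F \<times> carrier N"
          "T.cl x \<in> to_tensor ` carrier P" "T.cl y \<in> to_tensor ` carrier P" for x y
        using that by (intro diff_in_range) simp_all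
    qed (auto simp: zero_in_range pure_in_range simp del: power_module_sel)
  qed
  then show "carrier TN \<subseteq> to_tensor ` carrier P" unfolding T.carrier_tensor by blast
  show "to_tensor ` carrier P \<subseteq> carrier TN" unfolding T.carrier_tensor using total_closed by blast
qed

lemma total_smult: "frag_extend (\<lambda>(u, v). frag_of (u, a \<odot>\<^bsub>N\<^esub> v)) (total x) = total (a \<odot>\<^bsub>P\<^esub> x)"
  by (simp add: total_def frag_extend_sum[OF F.finite_basis] o_def)

sublocale TS: module_surjection "polyA n m" P TN to_tensor
proof (intro module_surjection.intro module_surjection_axioms.intro P.module_axioms to_tensor_surj to_tensor_add)
  show "to_tensor \<zero>\<^bsub>P\<^esub> = \<zero>\<^bsub>TN\<^esub>" using cl_zero_total T.zero_tensor by simp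
  show "to_tensor (a \<odot>\<^bsub>P\<^esub> x) = a \<odot>\<^bsub>TN\<^esub> to_tensor x" if "a \<in> carrier (polyA n m)" "x \<in> carrier P" for a x
    using smult_tensor[OF that(1) total_closed[OF that(2)]] total_smult by simp
qed

text \<open>The bilinear map \<open>(u, v) \<mapsto> u\<^sub>b v\<close>, with \<open>u\<^sub>b\<close> the coordinate of \<open>u\<close> at \<open>b\<close>, recovers \<open>x\<^sub>b\<close> from
  \<open>\<Sum>\<^sub>b b \<otimes> x\<^sub>b\<close>.\<close>

lemma to_tensor_kernel:
  assumes x: "x \<in> carrier P" and 0: "to_tensor x = \<zero>\<^bsub>TN\<^esub>"
  shows "x = \<zero>\<^bsub>P\<^esub>"
proof (rule extensionalityI[where A = B])
  fix b assume b: "b \<in> B"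
  have xN: "b' \<in> B \<Longrightarrow> x b' \<in> carrier N" for b' using x by auto
  have null: "total x \<in> tensor_null (polyS n) F N"
    using 0 T.cl_eq_iff[OF total_closed[OF x] T.Fr.one_closed] by (simp add: T.zero_tensor)
  have cN: "F.coord u b \<odot>\<^bsub>N\<^esub> v \<in> carrier N" if "u \<in> carrier F" "v \<in> carrier N" for u v
    using N.S.smult_closed[OF F.coord_closed[OF that(1) b] that(2)] .
  have "(\<lambda>(u, v). F.coord u b \<odot>\<^bsub>N\<^esub> v) ` (carrier F \<times> carrier N) \<subseteq> carrier (add_monoid N)"
    using cN by auto
  then obtain h where h: "h \<in> hom T.Fr (add_monoid N)"
    and h_frag: "\<And>z. z \<in> carrier F \<times> carrier N \<Longrightarrow> h (frag_of z) = (\<lambda>(u, v). F.coord u b \<odot>\<^bsub>N\<^esub> v) z"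
    using comm_group.free_Abelian_group_universal[OF N.M.a_comm_group] by blast
  interpret h: group_hom T.Fr "add_monoid N" h
    by (intro group_hom.intro group_hom_axioms.intro T.Fr.group_axioms N.M.a_group h)
  have h_add: "h (c + c') = h c \<oplus>\<^bsub>N\<^esub> h c'" if "c \<in> carrier T.Fr" "c' \<in> carrier T.Fr" for c c'
    using h.hom_mult[OF that] by simp
  have h_minus: "h (- c) = \<ominus>\<^bsub>N\<^esub> h c" if "c \<in> carrier T.Fr" for c
    using h.hom_inv[OF that] that by (simp add: a_inv_def)
  have h_diff: "h (c - c') = h c \<oplus>\<^bsub>N\<^esub> \<ominus>\<^bsub>N\<^esub> h c'" if "c \<in> carrier T.Fr" "c' \<in> carrier T.Fr" for c c'
    using h_add[OF that(1) T.Fr_minus[OF that(2)]] h_minus[OF that(2)] by simp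
  have h_fr: "h (frag_of (u, v)) = F.coord u b \<odot>\<^bsub>N\<^esub> v" if "u \<in> carrier F" "v \<in> carrier N" for u v
    using h_frag[of "(u, v)"] that by simp
  have "subgroup {\<zero>\<^bsub>N\<^esub>} (add_monoid N)" by (rule N.M.subgroup_addI) auto
  then have "h (total x) \<in> {\<zero>\<^bsub>N\<^esub>}"
  proof (rule T.null_hom_image[OF N.M.a_group h _ _ _ _ null])
    fix u u' v assume *: "u \<in> carrier F" "u' \<in> carrier F" "v \<in> carrier N"
    let ?a = "F.coord u b \<odot>\<^bsub>N\<^esub> v" and ?a' = "F.coord u' b \<odot>\<^bsub>N\<^esub> v"
    have "h (frag_of (u \<oplus>\<^bsub>F\<^esub> u', v)) = ?a \<oplus>\<^bsub>N\<^esub> ?a'"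
      using * by (simp add: h_fr F.coord_add b N.S.smult_l_distr F.coord_closed)
    then have "h (frag_of (u \<oplus>\<^bsub>F\<^esub> u', v) - frag_of (u, v) - frag_of (u', v))
        = ?a \<oplus>\<^bsub>N\<^esub> ?a' \<oplus>\<^bsub>N\<^esub> \<ominus>\<^bsub>N\<^esub> ?a \<oplus>\<^bsub>N\<^esub> \<ominus>\<^bsub>N\<^esub> ?a'"
      using * by (simp add: h_diff h_fr T.Fr_diff T.Fr_frag_of del: carrier_free_Abelian_group_iff)
    also have "\<dots> = \<zero>\<^bsub>N\<^esub>"
      using cN[OF *(1,3)] cN[OF *(2,3)] by (simp add: N.M.a_ac N.M.r_neg N.M.r_neg1 N.M.r_neg2)
    finally show "h (frag_of (u \<oplus>\<^bsub>F\<^esub> u', v) - frag_of (u, v) - frag_of (u', v)) \<in> {\<zero>\<^bsub>N\<^esub>}" by simp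
  next
    fix u v v' assume *: "u \<in> carrier F" "v \<in> carrier N" "v' \<in> carrier N"
    let ?a = "F.coord u b \<odot>\<^bsub>N\<^esub> v" and ?a' = "F.coord u b \<odot>\<^bsub>N\<^esub> v'"
    have "h (frag_of (u, v \<oplus>\<^bsub>N\<^esub> v')) = ?a \<oplus>\<^bsub>N\<^esub> ?a'"
      using * by (simp add: h_fr b N.S.smult_r_distr F.coord_closed)
    then have "h (frag_of (u, v \<oplus>\<^bsub>N\<^esub> v') - frag_of (u, v) - frag_of (u, v'))
        = ?a \<oplus>\<^bsub>N\<^esub> ?a' \<oplus>\<^bsub>N\<^esub> \<ominus>\<^bsub>N\<^esub> ?a \<oplus>\<^bsub>N\<^esub> \<ominus>\<^bsub>N\<^esub> ?a'"
      using * by (simp add: h_diff h_fr T.Fr_diff T.Fr_frag_of del: carrier_free_Abelian_group_iff)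
    also have "\<dots> = \<zero>\<^bsub>N\<^esub>"
      using cN[OF *(1,2)] cN[OF *(1,3)] by (simp add: N.M.a_ac N.M.r_neg N.M.r_neg1 N.M.r_neg2)
    finally show "h (frag_of (u, v \<oplus>\<^bsub>N\<^esub> v') - frag_of (u, v) - frag_of (u, v')) \<in> {\<zero>\<^bsub>N\<^esub>}" by simp
  next
    fix r :: "'k mpoly" and u v assume *: "r \<in> carrier (polyS n)" "u \<in> carrier F" "v \<in> carrier N"
    have "h (frag_of (r \<odot>\<^bsub>F\<^esub> u, v)) = F.coord u b \<odot>\<^bsub>N\<^esub> (r \<odot>\<^bsub>N\<^esub> v)"
      using * N.S.smult_assoc1[OF F.coord_closed[OF *(2) b] *(1,3)] F.R.m_comm[OF *(1) F.coord_closed[OF *(2) b]]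
      by (simp add: h_fr F.coord_smult b)
    then show "h (frag_of (r \<odot>\<^bsub>F\<^esub> u, v) - frag_of (u, r \<odot>\<^bsub>N\<^esub> v)) \<in> {\<zero>\<^bsub>N\<^esub>}"
      using * cN[of u "r \<odot>\<^bsub>N\<^esub> v"] N.S.smult_closed[OF *(1,3)]
      by (simp add: h_diff h_fr N.M.r_neg T.Fr_frag_of del: carrier_free_Abelian_group_iff)
  qed
  moreover have "h (\<Sum>b'\<in>C. frag_of (b', x b')) = (if b \<in> C then x b else \<zero>\<^bsub>N\<^esub>)" if "finite C" "C \<subseteq> B" for C
    using that
  proof (induction C)
    case empty
    then show ?case using h.hom_one by simp
  next
    case (insert b' C)
    then have b': "b' \<in> B" by simp
    have s: "(\<Sum>b'\<in>C. frag_of (b', x b')) \<in> carrier T.Fr"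
      using insert.prems xN F.basis_carrier by (intro T.Fr_sum T.Fr_frag_of) auto
    have "h (frag_of (b', x b')) = (if b' = b then x b else \<zero>\<^bsub>N\<^esub>)"
      using h_fr[OF F.basis_carrier[OF b'] xN[OF b']] F.coord_basis[OF b' b] xN[OF b'] by auto
    then show ?case
      using insert h_add[OF T.Fr_frag_of[OF F.basis_carrier[OF b'] xN[OF b']] s] xN[OF b] by auto
  qed
  ultimately show "x b = \<zero>\<^bsub>P\<^esub> b"
    using b F.finite_basis by (simp add: total_def)
qed (use x in \<open>auto simp: PiE_iff\<close>)

text \<open>A tensor \<open>b \<otimes> v\<close> has degree \<open>deg b + deg v\<close>, so the component of degree \<open>g\<close> consists of the
  families with \<open>x\<^sub>b\<close> of degree \<open>g - deg b\<close>. For a general homogeneous \<open>u\<close> instead of \<open>b\<close>, the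
  tensors \<open>u \<otimes> v\<close> are reached by induction on \<open>u\<close>.\<close>

lemma tensor_comp_image:
  "tensor_comp (polyS n) F FG N NG = (\<lambda>g. to_tensor ` (\<Pi>\<^sub>E b\<in>B. NG (g + (- dg b, 0))))"
proof
  fix g :: "int \<times> int"
  obtain c d where g: "g = (c, d)" by (cases g)
  let ?C = "\<lambda>c d. to_tensor ` (\<Pi>\<^sub>E b\<in>B. NG (c - dg b, d))"
  let ?S = "\<lambda>c. {T.cl (frag_of (u, v)) | u v k. u \<in> FG k \<and> v \<in> NG (c - k, d)}"
  interpret PG: fg_bigraded n m p P "\<lambda>g. \<Pi>\<^sub>E b\<in>B. NG (g + (- dg b, 0))"
    by (rule fg_bigraded_power[OF N.fg_bigraded_axioms F.finite_basis])
  have C: "subgroup (?C c d) (add_monoid TN)" for c d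
    using TS.subgroup_image[OF PG.comp_subgroup[of "(c, d)"]] by simp
  have C_add: "x \<oplus>\<^bsub>TN\<^esub> y \<in> ?C c d" if "x \<in> ?C c d" "y \<in> ?C c d" for x y c d
    by (rule subgroup_add_add[OF C that])
  have cl_minus: "T.cl (- c) = \<ominus>\<^bsub>TN\<^esub> T.cl c" if "c \<in> carrier T.Fr" for c
    using TS.I.M.minus_equality[of "T.cl (- c)" "T.cl c"] T.add_tensor[OF T.Fr_minus[OF that] that]
      that T.Fr_minus[OF that] by (simp add: T.zero_tensor T.carrier_tensor del: carrier_free_Abelian_group_iff)
  have S_carrier: "?S c \<subseteq> carrier TN"
    unfolding T.carrier_tensor using F.comp_carrier N.comp_carrier T.Fr_frag_of by blast
  have pure: "T.cl (frag_of (u, v)) \<in> ?C c d" if u: "u \<in> FG k" and v: "v \<in> NG (c - k, d)" for u v k c d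
  proof -
    define H where "H k = {u \<in> carrier F. \<forall>c d. \<forall>v\<in>NG (c - k, d). T.cl (frag_of (u, v)) \<in> ?C c d}" for k
    have "u \<in> H k"
    proof (rule F.homogeneous_basis_induct[OF u])
      show "subgroup (H k) (add_monoid F)" for k
      proof (rule F.M.subgroup_addI)
        show "\<zero>\<^bsub>F\<^esub> \<in> H k"
          using subgroup_add_zero[OF C] T.cl_zero_left N.comp_carrier by (auto simp: H_def T.zero_tensor)
        show "u \<oplus>\<^bsub>F\<^esub> u' \<in> H k" if u: "u \<in> H k" "u' \<in> H k" for u u'
        proof -
          have uF: "u \<in> carrier F" "u' \<in> carrier F" using u by (auto simp: H_def)
          have "T.cl (frag_of (u \<oplus>\<^bsub>F\<^esub> u', v)) \<in> ?C c d" if v: "v \<in> NG (c - k, d)" for v c d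
          proof -
            have vN: "v \<in> carrier N" by (rule N.comp_carrier[OF v])
            have "T.cl (frag_of (u \<oplus>\<^bsub>F\<^esub> u', v)) = T.cl (frag_of (u, v)) \<oplus>\<^bsub>TN\<^esub> T.cl (frag_of (u', v))"
              using T.cl_add_left[OF uF vN] T.add_tensor[OF T.Fr_frag_of[OF uF(1) vN] T.Fr_frag_of[OF uF(2) vN]] by simp
            then show ?thesis using C_add u v by (simp add: H_def)
          qed
          then show ?thesis using uF by (simp add: H_def)
        qed
        show "\<ominus>\<^bsub>F\<^esub> u \<in> H k" if u: "u \<in> H k" for u
        proof -
          have uF: "u \<in> carrier F" using u by (auto simp: H_def)
          have "T.cl (frag_of (\<ominus>\<^bsub>F\<^esub> u, v)) \<in> ?C c d" if v: "v \<in> NG (c - k, d)" for v c d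
          proof -
            have vN: "v \<in> carrier N" by (rule N.comp_carrier[OF v])
            have "T.cl (frag_of (\<ominus>\<^bsub>F\<^esub> u, v)) = \<ominus>\<^bsub>TN\<^esub> T.cl (frag_of (u, v))"
              using T.cl_minus_left[OF uF vN] cl_minus[OF T.Fr_frag_of[OF uF vN]] by simp
            then show ?thesis using subgroup_add_minus[OF C] u v by (simp add: H_def)
          qed
          then show ?thesis using uF by (simp add: H_def)
        qed
      qed (auto simp: H_def)
      show "mpoly_const r \<odot>\<^bsub>F\<^esub> u \<in> H k" if u: "u \<in> H k" for r k u
      proof -
        have r: "(mpoly_const r :: 'k mpoly) \<in> carrier (polyS n)" by (simp add: polyS_def)
        have uF: "u \<in> carrier F" using u by (auto simp: H_def)
        have "T.cl (frag_of (mpoly_const r \<odot>\<^bsub>F\<^esub> u, v)) \<in> ?C c d" if v: "v \<in> NG (c - k, d)" for v c d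
        proof -
          have "mpoly_const r \<odot>\<^bsub>N\<^esub> v \<in> NG (c - k, d)"
            using N.comp_smult[OF polyA_const v] by simp
          then show ?thesis using T.cl_smult[OF r uF N.comp_carrier[OF v]] u by (simp add: H_def)
        qed
        then show ?thesis using uF r by (simp add: H_def)
      qed
      show "mpoly_var w \<odot>\<^bsub>F\<^esub> u \<in> H (1 + k)" if w: "w \<in> VarX ` {1..n}" and u: "u \<in> H k" for w k u
      proof -
        have r: "(mpoly_var w :: 'k mpoly) \<in> carrier (polyS n)" using poly_ring_var[OF w] by (simp add: polyS_def)
        have uF: "u \<in> carrier F" using u by (auto simp: H_def)
        have wA: "(mpoly_var w :: 'k mpoly) \<in> polyA_comp n m p (1, 0)"
          using polyS_var[OF w] polyS_comp_polyA_comp by blast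
        have "T.cl (frag_of (mpoly_var w \<odot>\<^bsub>F\<^esub> u, v)) \<in> ?C c d" if v: "v \<in> NG (c - (1 + k), d)" for v c d
        proof -
          have "mpoly_var w \<odot>\<^bsub>N\<^esub> v \<in> NG (c - k, d)"
            using N.comp_smult[OF wA v] by simp
          then show ?thesis using T.cl_smult[OF r uF N.comp_carrier[OF v]] u by (simp add: H_def)
        qed
        then show ?thesis using uF r by (simp add: H_def)
      qed
      show "b \<in> H (dg b)" if b: "b \<in> B" for b
      proof -
        have "T.cl (frag_of (b, v)) \<in> ?C c d" if v: "v \<in> NG (c - dg b, d)" for v c d
        proof -
          have s: "power_single B N b v \<in> (\<Pi>\<^sub>E b\<in>B. NG (c - dg b, d))"
            using v N.comp_zero by (auto simp: power_single_def)
          have vN: "v \<in> carrier N" by (rule N.comp_carrier[OF v])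
          have sP: "power_single B N b v \<in> carrier P" using vN by (auto simp: power_single_def)
          have "to_tensor (power_single B N b v) = T.cl (frag_of (b, v))"
            by (intro T.cl_eqI total_closed sP T.Fr_frag_of total_single b vN F.basis_carrier)
          then show ?thesis by (rule image_eqI[OF sym s])
        qed
        then show ?thesis using F.basis_carrier[OF b] by (simp add: H_def)
      qed
    qed
    then show ?thesis using v by (simp add: H_def)
  qed
  have gen: "subgroup (generate (add_monoid TN) (?S c)) (add_monoid TN)"
    using S_carrier by (intro TS.I.M.add.generate_is_subgroup) simp
  have "generate (add_monoid TN) (?S c) \<subseteq> ?C c d"
    by (rule TS.I.M.add.generate_subgroup_incl[OF _ C]) (use pure in blast)
  moreover have "?C c d \<subseteq> generate (add_monoid TN) (?S c)"
  proof
    fix y assume "y \<in> ?C c d"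
    then obtain x where x: "x \<in> (\<Pi>\<^sub>E b\<in>B. NG (c - dg b, d))" and y: "y = to_tensor x" by blast
    have xN: "x b \<in> carrier N" if "b \<in> B" for b using N.comp_carrier[OF PiE_mem[OF x that]] .
    have "T.cl (\<Sum>b\<in>E. frag_of (b, x b)) \<in> generate (add_monoid TN) (?S c)" if "finite E" "E \<subseteq> B" for E
      using that
    proof (induction E)
      case empty
      then show ?case using subgroup_add_zero[OF gen] T.zero_tensor by simp
    next
      case (insert b E)
      then have b: "b \<in> B" and E: "E \<subseteq> B" by auto
      have fb: "frag_of (b, x b) \<in> carrier T.Fr" by (rule T.Fr_frag_of[OF F.basis_carrier[OF b] xN[OF b]])
      have fE: "(\<Sum>b\<in>E. frag_of (b, x b)) \<in> carrier T.Fr"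
        using E xN F.basis_carrier by (intro T.Fr_sum T.Fr_frag_of) auto
      have "T.cl (frag_of (b, x b)) \<in> generate (add_monoid TN) (?S c)"
        using F.basis_degree[OF b] PiE_mem[OF x b] by (intro generate.incl) blast
      from subgroup_add_add[OF gen this insert.IH[OF E]]
      show ?case using insert.hyps T.add_tensor[OF fb fE] by simp
    qed
    from this[OF F.finite_basis subset_refl] show "y \<in> generate (add_monoid TN) (?S c)"
      unfolding y total_def .
  qed
  ultimately show "tensor_comp (polyS n) F FG N NG g = to_tensor ` (\<Pi>\<^sub>E b\<in>B. NG (g + (- dg b, 0)))"
    by (simp add: tensor_comp_def g)
qed

lemma fg_bigraded_tensor: "fg_bigraded n m p TN (tensor_comp (polyS n) F FG N NG)"
proof -
  interpret PG: fg_bigraded n m p P "\<lambda>g. \<Pi>\<^sub>E b\<in>B. NG (g + (- dg b, 0))"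
    by (rule fg_bigraded_power[OF N.fg_bigraded_axioms F.finite_basis])
  have "graded_module (polyA n m) TN (polyA_comp n m p) (tensor_comp (polyS n) F FG N NG)"
    unfolding tensor_comp_image
  proof (rule TS.graded_image[OF PG.graded_module_axioms polyA_comp_carrier])
    fix x g assume "x \<in> carrier P" "to_tensor x = \<zero>\<^bsub>TN\<^esub>"
    then have "x = \<zero>\<^bsub>P\<^esub>" by (rule to_tensor_kernel)
    then show "to_tensor (PG.component x g) = \<zero>\<^bsub>TN\<^esub>"
      using PG.component_zero TS.f_zero by (simp only:)
  qed
  then show ?thesis using TS.fin_gen_image[OF PG.fg]
    by (intro fg_bigraded.intro fg_bigraded_axioms.intro)
qed

end

section \<open>Modules of homomorphisms\<close>

lemma hom_module_sel [simp]:
  "carrier (hom_module R U V) = {f \<in> extensional (carrier U). linear_map R U V f}"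
  "\<zero>\<^bsub>hom_module R U V\<^esub> = (\<lambda>u\<in>carrier U. \<zero>\<^bsub>V\<^esub>)"
  "f \<oplus>\<^bsub>hom_module R U V\<^esub> g = (\<lambda>u\<in>carrier U. f u \<oplus>\<^bsub>V\<^esub> g u)"
  "a \<odot>\<^bsub>hom_module R U V\<^esub> f = (\<lambda>u\<in>carrier U. a \<odot>\<^bsub>V\<^esub> f u)"
  by (simp_all add: hom_module_def)

lemma linear_mapD:
  assumes "linear_map R U V f"
  shows "u \<in> carrier U \<Longrightarrow> f u \<in> carrier V"
    and "u \<in> carrier U \<Longrightarrow> u' \<in> carrier U \<Longrightarrow> f (u \<oplus>\<^bsub>U\<^esub> u') = f u \<oplus>\<^bsub>V\<^esub> f u'"
    and "r \<in> carrier R \<Longrightarrow> u \<in> carrier U \<Longrightarrow> f (r \<odot>\<^bsub>U\<^esub> u) = r \<odot>\<^bsub>V\<^esub> f u"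
  using assms by (auto simp: linear_map_def hom_def)

lemma linear_mapI:
  assumes "\<And>u. u \<in> carrier U \<Longrightarrow> f u \<in> carrier V"
    and "\<And>u u'. u \<in> carrier U \<Longrightarrow> u' \<in> carrier U \<Longrightarrow> f (u \<oplus>\<^bsub>U\<^esub> u') = f u \<oplus>\<^bsub>V\<^esub> f u'"
    and "\<And>r u. r \<in> carrier R \<Longrightarrow> u \<in> carrier U \<Longrightarrow> f (r \<odot>\<^bsub>U\<^esub> u) = r \<odot>\<^bsub>V\<^esub> f u"
  shows "linear_map R U V f"
  using assms by (auto simp: linear_map_def hom_def)

lemma linear_map_zero:
  assumes "Module.module R U" "Module.module R V" "linear_map R U V f"
  shows "f \<zero>\<^bsub>U\<^esub> = \<zero>\<^bsub>V\<^esub>"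
proof -
  interpret U: Module.module R U by fact
  interpret V: Module.module R V by fact
  have "f (\<zero>\<^bsub>R\<^esub> \<odot>\<^bsub>U\<^esub> \<zero>\<^bsub>U\<^esub>) = \<zero>\<^bsub>R\<^esub> \<odot>\<^bsub>V\<^esub> f \<zero>\<^bsub>U\<^esub>" by (intro linear_mapD(3)[OF assms(3)]) auto
  then show ?thesis using linear_mapD(1)[OF assms(3), of "\<zero>\<^bsub>U\<^esub>"] by simp
qed

lemma linear_map_minus:
  assumes "Module.module R U" "Module.module R V" "linear_map R U V f" "u \<in> carrier U"
  shows "f (\<ominus>\<^bsub>U\<^esub> u) = \<ominus>\<^bsub>V\<^esub> f u"
proof -
  interpret U: Module.module R U by fact
  interpret V: Module.module R V by fact
  have "f (\<ominus>\<^bsub>U\<^esub> u) \<oplus>\<^bsub>V\<^esub> f u = \<zero>\<^bsub>V\<^esub>"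
    using linear_mapD(2)[OF assms(3), of "\<ominus>\<^bsub>U\<^esub> u" u] linear_map_zero[OF assms(1-3)] assms(4) by (simp add: U.M.l_neg)
  then show ?thesis
    using V.M.minus_equality linear_mapD(1)[OF assms(3)] assms(4) by (metis U.M.a_inv_closed)
qed

context free_tensor
begin

abbreviation "HN \<equiv> hom_module (polyS n) F N"

text \<open>The homomorphism with prescribed values on the basis, which identifies \<open>N\<^sup>B\<close> with \<open>Hom(F, N)\<close>.\<close>

definition to_hom :: "('f \<Rightarrow> 'v) \<Rightarrow> 'f \<Rightarrow> 'v" where
  "to_hom x = (\<lambda>u\<in>carrier F. \<Oplus>\<^bsub>N\<^esub>b\<in>B. F.coord u b \<odot>\<^bsub>N\<^esub> x b)"

lemma to_hom_summand:
  assumes "x \<in> carrier P" "u \<in> carrier F"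
  shows "(\<lambda>b. F.coord u b \<odot>\<^bsub>N\<^esub> x b) \<in> B \<rightarrow> carrier N"
  using N.S.smult_closed[OF F.coord_closed[OF assms(2)]] assms(1) by auto

lemma to_hom_closed:
  assumes x: "x \<in> carrier P"
  shows "to_hom x \<in> carrier HN"
proof -
  have c: "F.coord u b \<in> carrier (polyS n)" "x b \<in> carrier N" if "u \<in> carrier F" "b \<in> B" for u b
    using F.coord_closed that x by auto
  have "linear_map (polyS n) F N (to_hom x)"
  proof (rule linear_mapI)
    show "to_hom x u \<in> carrier N" if "u \<in> carrier F" for u
      using N.M.finsum_closed[OF to_hom_summand[OF x that]] that by (simp add: to_hom_def)
    show "to_hom x (u \<oplus>\<^bsub>F\<^esub> u') = to_hom x u \<oplus>\<^bsub>N\<^esub> to_hom x u'" if u: "u \<in> carrier F" "u' \<in> carrier F" for u u'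
    proof -
      have "(\<Oplus>\<^bsub>N\<^esub>b\<in>B. F.coord (u \<oplus>\<^bsub>F\<^esub> u') b \<odot>\<^bsub>N\<^esub> x b)
          = (\<Oplus>\<^bsub>N\<^esub>b\<in>B. F.coord u b \<odot>\<^bsub>N\<^esub> x b \<oplus>\<^bsub>N\<^esub> F.coord u' b \<odot>\<^bsub>N\<^esub> x b)"
        by (rule N.M.finsum_cong')
          (use c u in \<open>auto simp: F.coord_add N.S.smult_l_distr intro!: N.M.a_closed N.S.smult_closed\<close>)
      also have "\<dots> = (\<Oplus>\<^bsub>N\<^esub>b\<in>B. F.coord u b \<odot>\<^bsub>N\<^esub> x b) \<oplus>\<^bsub>N\<^esub> (\<Oplus>\<^bsub>N\<^esub>b\<in>B. F.coord u' b \<odot>\<^bsub>N\<^esub> x b)"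
        by (rule N.M.finsum_addf[OF to_hom_summand[OF x u(1)] to_hom_summand[OF x u(2)]])
      finally show ?thesis using u by (simp add: to_hom_def)
    qed
    show "to_hom x (r \<odot>\<^bsub>F\<^esub> u) = r \<odot>\<^bsub>N\<^esub> to_hom x u" if r: "r \<in> carrier (polyS n)" and u: "u \<in> carrier F" for r u
    proof -
      have "(\<Oplus>\<^bsub>N\<^esub>b\<in>B. F.coord (r \<odot>\<^bsub>F\<^esub> u) b \<odot>\<^bsub>N\<^esub> x b) = (\<Oplus>\<^bsub>N\<^esub>b\<in>B. r \<odot>\<^bsub>N\<^esub> (F.coord u b \<odot>\<^bsub>N\<^esub> x b))"
        by (rule N.M.finsum_cong')
          (use c u r in \<open>auto simp: F.coord_smult N.S.smult_assoc1 intro!: N.S.smult_closed\<close>)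
      also have "\<dots> = r \<odot>\<^bsub>N\<^esub> (\<Oplus>\<^bsub>N\<^esub>b\<in>B. F.coord u b \<odot>\<^bsub>N\<^esub> x b)"
        by (rule N.S.finsum_smult_ldistr[symmetric, OF F.finite_basis r to_hom_summand[OF x u]])
      finally show ?thesis using u r by (simp add: to_hom_def)
    qed
  qed
  then show ?thesis by (simp add: to_hom_def)
qed

lemma to_hom_basis:
  assumes x: "x \<in> carrier P" and b: "b \<in> B"
  shows "to_hom x b = x b"
proof -
  have xN: "x b' \<in> carrier N" if "b' \<in> B" for b' using x that by auto
  have "(\<Oplus>\<^bsub>N\<^esub>b'\<in>B. F.coord b b' \<odot>\<^bsub>N\<^esub> x b') = (\<Oplus>\<^bsub>N\<^esub>b'\<in>B. if b = b' then x b' else \<zero>\<^bsub>N\<^esub>)"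
    by (rule N.M.finsum_cong') (use xN F.coord_basis[OF b] in auto)
  also have "\<dots> = x b" by (rule N.M.finsum_singleton[OF b F.finite_basis]) (use xN in auto)
  finally show ?thesis using F.basis_carrier[OF b] by (simp add: to_hom_def)
qed

lemma hom_eqI:
  assumes f: "f \<in> carrier HN" and g: "g \<in> carrier HN" and eq: "\<And>b. b \<in> B \<Longrightarrow> f b = g b"
  shows "f = g"
proof (rule extensionalityI[where A = "carrier F"])
  have fl: "linear_map (polyS n) F N f" and gl: "linear_map (polyS n) F N g" using f g by simp_all
  fix u assume u: "u \<in> carrier F"
  have "submodule {u \<in> carrier F. f u = g u} (polyS n) F"
    using linear_mapD[OF fl] linear_mapD[OF gl]
      linear_map_zero[OF F.module_axioms N.S.module_axioms fl] linear_map_zero[OF F.module_axioms N.S.module_axioms gl]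
      linear_map_minus[OF F.module_axioms N.S.module_axioms fl] linear_map_minus[OF F.module_axioms N.S.module_axioms gl]
    by (intro F.submoduleI) auto
  then have "u \<in> {u \<in> carrier F. f u = g u}"
    using eq F.basis_carrier by (intro F.basis_induct[OF u]) auto
  then show "f u = g u" by simp
qed (use f g in auto)

lemma hom_add_closed:
  assumes f: "f \<in> carrier HN" and g: "g \<in> carrier HN"
  shows "f \<oplus>\<^bsub>HN\<^esub> g \<in> carrier HN"
proof -
  have fl: "linear_map (polyS n) F N f" and gl: "linear_map (polyS n) F N g" using f g by simp_all
  have "linear_map (polyS n) F N (f \<oplus>\<^bsub>HN\<^esub> g)"
    using linear_mapD[OF fl] linear_mapD[OF gl]
    by (intro linear_mapI) (auto simp: N.M.a_ac N.S.smult_r_distr)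
  then show ?thesis by simp
qed

lemma hom_smult_closed:
  assumes a: "a \<in> carrier (polyA n m)" and f: "f \<in> carrier HN"
  shows "a \<odot>\<^bsub>HN\<^esub> f \<in> carrier HN"
proof -
  have fl: "linear_map (polyS n) F N f" using f by simp
  have "linear_map (polyS n) F N (a \<odot>\<^bsub>HN\<^esub> f)"
    using linear_mapD[OF fl] smult_N_commute[OF a] a
    by (intro linear_mapI) (auto simp: N.smult_r_distr)
  then show ?thesis by simp
qed

lemma to_hom_surj: "carrier HN = to_hom ` carrier P"
proof
  show "carrier HN \<subseteq> to_hom ` carrier P"
  proof
    fix f assume f: "f \<in> carrier HN"
    then have r: "restrict f B \<in> carrier P" using linear_mapD(1) F.basis_carrier by fastforce
    have "f = to_hom (restrict f B)"
      by (rule hom_eqI[OF f to_hom_closed[OF r]]) (simp add: to_hom_basis[OF r])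
    then show "f \<in> to_hom ` carrier P" using r by (rule image_eqI)
  qed
qed (use to_hom_closed in blast)

sublocale HS: module_surjection "polyA n m" P HN to_hom
proof (intro module_surjection.intro module_surjection_axioms.intro TS.module_axioms to_hom_surj)
  show add: "to_hom (x \<oplus>\<^bsub>P\<^esub> y) = to_hom x \<oplus>\<^bsub>HN\<^esub> to_hom y" if "x \<in> carrier P" "y \<in> carrier P" for x y
    using that TS.M.a_closed[OF that] F.basis_carrier
    by (intro hom_eqI to_hom_closed hom_add_closed) (simp_all add: to_hom_basis del: power_module_sel(1) hom_module_sel(1))
  show smult: "to_hom (a \<odot>\<^bsub>P\<^esub> x) = a \<odot>\<^bsub>HN\<^esub> to_hom x" if "a \<in> carrier (polyA n m)" "x \<in> carrier P" for a x
    using that TS.smult_closed[OF that] F.basis_carrier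
    by (intro hom_eqI to_hom_closed hom_smult_closed) (simp_all add: to_hom_basis del: power_module_sel(1) hom_module_sel(1))
  show "to_hom \<zero>\<^bsub>P\<^esub> = \<zero>\<^bsub>HN\<^esub>"
  proof (rule extensionalityI[where A = "carrier F"])
    fix u assume u: "u \<in> carrier F"
    have "(\<Oplus>\<^bsub>N\<^esub>b\<in>B. F.coord u b \<odot>\<^bsub>N\<^esub> \<zero>\<^bsub>P\<^esub> b) = (\<Oplus>\<^bsub>N\<^esub>b\<in>B. \<zero>\<^bsub>N\<^esub>)"
      by (rule N.M.finsum_cong') (use F.coord_closed[OF u] in auto)
    then show "to_hom \<zero>\<^bsub>P\<^esub> u = \<zero>\<^bsub>HN\<^esub> u" using u by (simp add: to_hom_def)
  qed (auto simp: to_hom_def)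
qed

text \<open>A map of degree \<open>g\<close> sends \<open>b\<close> to degree \<open>deg b + g\<close>: the shift is opposite to the one for tensor
  products. Conversely, correct degrees on the basis give correct degrees on all homogeneous
  elements, by induction.\<close>

lemma hom_comp_image:
  "hom_comp (polyS n) F FG N NG = (\<lambda>g. to_hom ` (\<Pi>\<^sub>E b\<in>B. NG (g + (dg b, 0))))"
proof
  fix g :: "int \<times> int"
  obtain c d where g: "g = (c, d)" by (cases g)
  have "hom_comp (polyS n) F FG N NG g = to_hom ` (\<Pi>\<^sub>E b\<in>B. NG (dg b + c, d))"
  proof
    show "hom_comp (polyS n) F FG N NG g \<subseteq> to_hom ` (\<Pi>\<^sub>E b\<in>B. NG (dg b + c, d))"
    proof
      fix f assume "f \<in> hom_comp (polyS n) F FG N NG g"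
      then have f: "f \<in> carrier HN" and fd: "\<And>i. f ` FG i \<subseteq> NG (i + c, d)" by (auto simp: hom_comp_def g)
      have r: "restrict f B \<in> (\<Pi>\<^sub>E b\<in>B. NG (dg b + c, d))"
        using fd F.basis_degree by auto
      have rP: "restrict f B \<in> carrier P" using PiE_mem[OF r] N.comp_carrier by auto
      have "f = to_hom (restrict f B)"
        by (rule hom_eqI[OF f to_hom_closed[OF rP]]) (simp add: to_hom_basis[OF rP])
      then show "f \<in> to_hom ` (\<Pi>\<^sub>E b\<in>B. NG (dg b + c, d))" using r by (rule image_eqI)
    qed
    show "to_hom ` (\<Pi>\<^sub>E b\<in>B. NG (dg b + c, d)) \<subseteq> hom_comp (polyS n) F FG N NG g"
    proof
      fix f assume "f \<in> to_hom ` (\<Pi>\<^sub>E b\<in>B. NG (dg b + c, d))"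
      then obtain x where x: "x \<in> (\<Pi>\<^sub>E b\<in>B. NG (dg b + c, d))" and f: "f = to_hom x" by blast
      have xP: "x \<in> carrier P"
        using x PiE_mem[OF x] N.comp_carrier by (auto simp: PiE_iff)
      have fH: "f \<in> carrier HN" unfolding f by (rule to_hom_closed[OF xP])
      then have fl: "linear_map (polyS n) F N f" by simp
      have "f u \<in> NG (i + c, d)" if u: "u \<in> FG i" for u i
      proof -
        define H where "H i = {u \<in> carrier F. f u \<in> NG (i + c, d)}" for i
        have "u \<in> H i"
        proof (rule F.homogeneous_basis_induct[OF u])
          show "subgroup (H k) (add_monoid F)" for k
            using linear_mapD[OF fl] linear_map_zero[OF F.module_axioms N.S.module_axioms fl]
              linear_map_minus[OF F.module_axioms N.S.module_axioms fl] N.comp_zero N.comp_add N.comp_minus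
            by (intro F.M.subgroup_addI) (auto simp: H_def)
          show "mpoly_const r \<odot>\<^bsub>F\<^esub> u \<in> H k" if u: "u \<in> H k" for r k u
          proof -
            have r: "(mpoly_const r :: 'k mpoly) \<in> carrier (polyS n)" by (simp add: polyS_def)
            show ?thesis
              using u linear_mapD(3)[OF fl r] N.comp_smult[OF polyA_const[of r], of "f u" "(k + c, d)"] r
              by (auto simp: H_def)
          qed
          show "mpoly_var w \<odot>\<^bsub>F\<^esub> u \<in> H (1 + k)" if w: "w \<in> VarX ` {1..n}" and u: "u \<in> H k" for w k u
          proof -
            have r: "(mpoly_var w :: 'k mpoly) \<in> carrier (polyS n)" using poly_ring_var[OF w] by (simp add: polyS_def)
            have wA: "(mpoly_var w :: 'k mpoly) \<in> polyA_comp n m p (1, 0)"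
              using polyS_var[OF w] polyS_comp_polyA_comp by blast
            have uF: "u \<in> carrier F" and fu: "f u \<in> NG (k + c, d)" using u by (auto simp: H_def)
            show ?thesis
              using linear_mapD(3)[OF fl r uF] N.comp_smult[OF wA fu] F.smult_closed[OF r uF]
              by (simp add: H_def add.assoc)
          qed
          show "b \<in> H (dg b)" if b: "b \<in> B" for b
            using F.basis_carrier[OF b] PiE_mem[OF x b] to_hom_basis[OF xP b] by (simp add: H_def f)
        qed
        then show ?thesis by (simp add: H_def)
      qed
      then show "f \<in> hom_comp (polyS n) F FG N NG g" using fH by (auto simp: hom_comp_def g)
    qed
  qed
  then show "hom_comp (polyS n) F FG N NG g = to_hom ` (\<Pi>\<^sub>E b\<in>B. NG (g + (dg b, 0)))"
    by (simp add: g add.commute)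
qed

lemma fg_bigraded_hom: "fg_bigraded n m p HN (hom_comp (polyS n) F FG N NG)"
proof -
  interpret PG: fg_bigraded n m p P "\<lambda>g. \<Pi>\<^sub>E b\<in>B. NG (g + (dg b, 0))"
    by (rule fg_bigraded_power[OF N.fg_bigraded_axioms F.finite_basis])
  have "graded_module (polyA n m) HN (polyA_comp n m p) (hom_comp (polyS n) F FG N NG)"
    unfolding hom_comp_image
  proof (rule HS.graded_image[OF PG.graded_module_axioms polyA_comp_carrier])
    fix x g assume x: "x \<in> carrier P" and z: "to_hom x = \<zero>\<^bsub>HN\<^esub>"
    have "x b = \<zero>\<^bsub>P\<^esub> b" if "b \<in> B" for b
      using to_hom_basis[OF x that] z F.basis_carrier[OF that] that by simp
    then have "x = \<zero>\<^bsub>P\<^esub>" using x by (intro extensionalityI[where A = B]) (auto simp: PiE_iff)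
    then show "to_hom (PG.component x g) = \<zero>\<^bsub>HN\<^esub>"
      using PG.component_zero HS.f_zero by (simp only:)
  qed
  then show ?thesis using HS.fin_gen_image[OF PG.fg]
    by (intro fg_bigraded.intro fg_bigraded_axioms.intro)
qed

end

section \<open>Differentials\<close>

text \<open>A homomorphism of degree zero commutes with taking components. Kernel and image are therefore
  submodules of the kind that \<open>fg_bigraded_subquotient\<close> requires.\<close>

locale bigraded_map = L: fg_bigraded n m p L LG + L': fg_bigraded n m p L' LG'
  for n m :: nat and p :: "nat \<Rightarrow> nat"
    and L :: "(('k::field) mpoly, 'b) module" and LG :: "int \<times> int \<Rightarrow> 'b set"
    and L' :: "('k mpoly, 'c) module" and LG' :: "int \<times> int \<Rightarrow> 'c set" +
  fixes h :: "'b \<Rightarrow> 'c"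
  assumes h_closed: "x \<in> carrier L \<Longrightarrow> h x \<in> carrier L'"
    and h_zero: "h \<zero>\<^bsub>L\<^esub> = \<zero>\<^bsub>L'\<^esub>"
    and h_add: "x \<in> carrier L \<Longrightarrow> y \<in> carrier L \<Longrightarrow> h (x \<oplus>\<^bsub>L\<^esub> y) = h x \<oplus>\<^bsub>L'\<^esub> h y"
    and h_smult: "a \<in> carrier (polyA n m) \<Longrightarrow> x \<in> carrier L \<Longrightarrow> h (a \<odot>\<^bsub>L\<^esub> x) = a \<odot>\<^bsub>L'\<^esub> h x"
    and h_comp: "x \<in> LG g \<Longrightarrow> h x \<in> LG' g"
begin

lemma h_minus:
  assumes "x \<in> carrier L"
  shows "h (\<ominus>\<^bsub>L\<^esub> x) = \<ominus>\<^bsub>L'\<^esub> h x"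
proof -
  have "h (\<ominus>\<^bsub>L\<^esub> x) \<oplus>\<^bsub>L'\<^esub> h x = \<zero>\<^bsub>L'\<^esub>"
    using h_add[of "\<ominus>\<^bsub>L\<^esub> x" x] assms by (simp add: L.M.l_neg h_zero)
  then show ?thesis
    using L'.M.minus_equality[of "h (\<ominus>\<^bsub>L\<^esub> x)" "h x"] h_closed assms by simp
qed

lemma component_h: "x \<in> carrier L \<Longrightarrow> L'.component (h x) g = h (L.component x g)"
  by (rule component_map[OF L.graded_module_axioms L'.graded_module_axioms]) (auto simp: h_add h_zero h_comp)

lemma kernel_submodule: "submodule (a_kernel L L' h) (polyA n m) L"
  unfolding a_kernel_def' by (rule L.submoduleI) (auto simp: h_zero h_add h_minus h_smult)

lemma kernel_component: "x \<in> a_kernel L L' h \<Longrightarrow> L.component x g \<in> a_kernel L L' h"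
  unfolding a_kernel_def' using component_h[of x g] L'.component_zero L.component_closed by simp

lemma image_submodule: "submodule (h ` carrier L) (polyA n m) L'"
proof (rule L'.submoduleI)
  show "\<zero>\<^bsub>L'\<^esub> \<in> h ` carrier L" using h_zero by (intro image_eqI[of _ _ "\<zero>\<^bsub>L\<^esub>"]) auto
  show "\<ominus>\<^bsub>L'\<^esub> y \<in> h ` carrier L" if "y \<in> h ` carrier L" for y
    using that by (elim imageE) (auto simp flip: h_minus)
  show "y \<oplus>\<^bsub>L'\<^esub> z \<in> h ` carrier L" if "y \<in> h ` carrier L" "z \<in> h ` carrier L" for y z
    using that by (elim imageE) (auto simp flip: h_add)
  show "a \<odot>\<^bsub>L'\<^esub> y \<in> h ` carrier L" if "a \<in> carrier (polyA n m)" "y \<in> h ` carrier L" for a y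
    using that by (elim imageE) (auto simp flip: h_smult)
qed (use h_closed in blast)

lemma image_component: "y \<in> h ` carrier L \<Longrightarrow> L'.component y g \<in> h ` carrier L"
  using component_h L.component_closed by (elim imageE) (auto intro: image_eqI)

end

locale free_differential = F: free_tensor n m p F FG B dg N NG + F': free_tensor n m p F' FG' B' dg' N NG
  for n m :: nat and p :: "nat \<Rightarrow> nat"
    and F :: "(('k::field) mpoly, 'f) module" and FG :: "int \<Rightarrow> 'f set" and B :: "'f set" and dg :: "'f \<Rightarrow> int"
    and F' :: "('k mpoly, 'f) module" and FG' :: "int \<Rightarrow> 'f set" and B' :: "'f set" and dg' :: "'f \<Rightarrow> int"
    and N :: "('k mpoly, 'v) module" and NG :: "int \<times> int \<Rightarrow> 'v set" +
  fixes d :: "'f \<Rightarrow> 'f"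
  assumes d_linear: "linear_map (polyS n) F F' d"
    and d_degree: "d ` FG k \<subseteq> FG' k"
begin

abbreviation "dN \<equiv> tensor_map (polyS n) F' N d"
abbreviation "E \<equiv> frag_extend (\<lambda>(u, v). frag_of (d u, v))"

lemma dN_class:
  assumes c: "c \<in> carrier F.T.Fr"
  shows "dN (F.T.cl c) = F'.T.cl (E c)" and "E c \<in> carrier F'.T.Fr"
  using tensor_class_map[OF F.T.tensor_product_axioms F'.T.tensor_product_axioms, where f = d and g = "\<lambda>v. v" and c = c]
    linear_mapD[OF d_linear] c by (simp_all add: tensor_map_def)

lemma bigraded_map_tensor:
  "bigraded_map n m p F.TN (tensor_comp (polyS n) F FG N NG) F'.TN (tensor_comp (polyS n) F' FG' N NG) dN"
proof -
  interpret T: fg_bigraded n m p F.TN "tensor_comp (polyS n) F FG N NG" by (rule F.fg_bigraded_tensor)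
  interpret T': fg_bigraded n m p F'.TN "tensor_comp (polyS n) F' FG' N NG" by (rule F'.fg_bigraded_tensor)
  have closed: "dN x \<in> carrier F'.TN" if x: "x \<in> carrier F.TN" for x
  proof -
    obtain c where c: "c \<in> carrier F.T.Fr" "x = F.T.cl c" using x unfolding F.T.carrier_tensor by (elim imageE) (rule that)
    show ?thesis
      unfolding c(2) dN_class(1)[OF c(1)] F'.T.carrier_tensor by (rule imageI) (rule dN_class(2)[OF c(1)])
  qed
  have zero: "dN \<zero>\<^bsub>F.TN\<^esub> = \<zero>\<^bsub>F'.TN\<^esub>"
    using dN_class(1)[OF F.T.Fr.one_closed] by (simp add: F.T.zero_tensor F'.T.zero_tensor)
  have add: "dN (x \<oplus>\<^bsub>F.TN\<^esub> y) = dN x \<oplus>\<^bsub>F'.TN\<^esub> dN y" if x: "x \<in> carrier F.TN" and y: "y \<in> carrier F.TN" for x y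
  proof -
    obtain c where c: "c \<in> carrier F.T.Fr" "x = F.T.cl c" using x unfolding F.T.carrier_tensor by (elim imageE) (rule that)
    obtain c' where c': "c' \<in> carrier F.T.Fr" "y = F.T.cl c'" using y unfolding F.T.carrier_tensor by (elim imageE) (rule that)
    show ?thesis
      unfolding c(2) c'(2) F.T.add_tensor[OF c(1) c'(1)] dN_class(1)[OF F.T.Fr_add[OF c(1) c'(1)]]
        dN_class(1)[OF c(1)] dN_class(1)[OF c'(1)] F'.T.add_tensor[OF dN_class(2)[OF c(1)] dN_class(2)[OF c'(1)]]
        frag_extend_add by simp
  qed
  have smult: "dN (a \<odot>\<^bsub>F.TN\<^esub> x) = a \<odot>\<^bsub>F'.TN\<^esub> dN x"
    if a: "a \<in> carrier (polyA n m)" and x: "x \<in> carrier F.TN" for a x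
  proof -
    obtain c where c: "c \<in> carrier F.T.Fr" "x = F.T.cl c" using x unfolding F.T.carrier_tensor by (elim imageE) (rule that)
    let ?A = "frag_extend (\<lambda>(u, v). frag_of (u, a \<odot>\<^bsub>N\<^esub> v)) :: ('f \<times> 'v \<Rightarrow>\<^sub>0 int) \<Rightarrow> _"
    have A: "?A c \<in> carrier F.T.Fr"
      by (rule F.smult_class_closed[OF a c(1)])
    have comm: "E (?A z) = ?A (E z)" for z
    proof -
      have "E (?A z) = frag_extend (\<lambda>(u, v). frag_of (d u, a \<odot>\<^bsub>N\<^esub> v)) z"
        using frag_extend_compose[of "\<lambda>(u, v). frag_of (d u, v)" "\<lambda>(u, v). (u, a \<odot>\<^bsub>N\<^esub> v)" z]
        by (simp add: o_def case_prod_unfold)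
      also have "\<dots> = ?A (E z)"
        using frag_extend_compose[of "\<lambda>(u, v). frag_of (u, a \<odot>\<^bsub>N\<^esub> v)" "\<lambda>(u, v). (d u, v)" z]
        by (simp add: o_def case_prod_unfold)
      finally show ?thesis .
    qed
    show ?thesis
      unfolding c(2) F.smult_tensor[OF a c(1)] dN_class(1)[OF A] dN_class(1)[OF c(1)]
        F'.smult_tensor[OF a dN_class(2)[OF c(1)]] comm ..
  qed
  have minus: "dN (\<ominus>\<^bsub>F.TN\<^esub> x) = \<ominus>\<^bsub>F'.TN\<^esub> dN x" if x: "x \<in> carrier F.TN" for x
  proof -
    have "dN (\<ominus>\<^bsub>F.TN\<^esub> x) \<oplus>\<^bsub>F'.TN\<^esub> dN x = \<zero>\<^bsub>F'.TN\<^esub>"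
      using add[of "\<ominus>\<^bsub>F.TN\<^esub> x" x] x zero by (simp add: F.TS.I.M.l_neg)
    then show ?thesis
      using F'.TS.I.M.minus_equality[of "dN (\<ominus>\<^bsub>F.TN\<^esub> x)" "dN x"] closed x by simp
  qed
  have comp: "dN x \<in> tensor_comp (polyS n) F' FG' N NG g" if "x \<in> tensor_comp (polyS n) F FG N NG g" for x g
  proof -
    obtain c e where g: "g = (c, e)" by (cases g)
    let ?S = "{F.T.cl (frag_of (u, v)) | u v k. u \<in> FG k \<and> v \<in> NG (c - k, e)}"
    let ?H = "{x \<in> carrier F.TN. dN x \<in> tensor_comp (polyS n) F' FG' N NG g}"
    have "subgroup ?H (add_monoid F.TN)"
      by (rule F.TS.I.M.subgroup_addI) (auto simp: zero add minus T'.comp_zero T'.comp_add T'.comp_minus)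
    moreover have "?S \<subseteq> ?H"
    proof
      fix y assume "y \<in> ?S"
      then obtain u v k where u: "u \<in> FG k" and v: "v \<in> NG (c - k, e)" and y: "y = F.T.cl (frag_of (u, v))" by blast
      have f: "frag_of (u, v) \<in> carrier F.T.Fr" by (rule F.T.Fr_frag_of[OF F.F.comp_carrier[OF u] F.N.comp_carrier[OF v]])
      have "dN y = F'.T.cl (frag_of (d u, v))" unfolding y dN_class(1)[OF f] by simp
      also have "\<dots> \<in> tensor_comp (polyS n) F' FG' N NG g"
        unfolding tensor_comp_def g prod.case using u v d_degree by (intro generate.incl) blast
      finally have "dN y \<in> tensor_comp (polyS n) F' FG' N NG g" .
      moreover have "y \<in> carrier F.TN" unfolding y F.T.carrier_tensor by (rule imageI) (rule f)
      ultimately show "y \<in> ?H" by simp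
    qed
    ultimately have "generate (add_monoid F.TN) ?S \<subseteq> ?H" by (intro F.TS.I.M.add.generate_subgroup_incl)
    then show ?thesis using that by (auto simp: tensor_comp_def g)
  qed
  show ?thesis
    using closed zero add smult comp
    by (intro bigraded_map.intro bigraded_map_axioms.intro T.fg_bigraded_axioms T'.fg_bigraded_axioms)
qed

text \<open>Precomposition reverses the direction.\<close>

lemma bigraded_map_hom:
  "bigraded_map n m p F'.HN (hom_comp (polyS n) F' FG' N NG) F.HN (hom_comp (polyS n) F FG N NG)
     (\<lambda>f. compose (carrier F) f d)"
proof (intro bigraded_map.intro bigraded_map_axioms.intro F.fg_bigraded_hom F'.fg_bigraded_hom)
  note dl = linear_mapD[OF d_linear]
  show closed: "compose (carrier F) f d \<in> carrier F.HN" if "f \<in> carrier F'.HN" for f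
  proof -
    have fl: "linear_map (polyS n) F' N f" using that by simp
    have "linear_map (polyS n) F N (compose (carrier F) f d)"
      using linear_mapD[OF fl] dl by (intro linear_mapI) (auto simp: compose_def)
    then show ?thesis by (simp add: compose_def)
  qed
  show "compose (carrier F) \<zero>\<^bsub>F'.HN\<^esub> d = \<zero>\<^bsub>F.HN\<^esub>"
    using dl by (auto simp: compose_def fun_eq_iff)
  show "compose (carrier F) (f \<oplus>\<^bsub>F'.HN\<^esub> g) d = compose (carrier F) f d \<oplus>\<^bsub>F.HN\<^esub> compose (carrier F) g d" for f g
    using dl by (auto simp: compose_def fun_eq_iff)
  show "compose (carrier F) (a \<odot>\<^bsub>F'.HN\<^esub> f) d = a \<odot>\<^bsub>F.HN\<^esub> compose (carrier F) f d" for a f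
    using dl by (auto simp: compose_def fun_eq_iff)
  show "compose (carrier F) f d \<in> hom_comp (polyS n) F FG N NG g" if "f \<in> hom_comp (polyS n) F' FG' N NG g" for f g
  proof -
    obtain c e where g: "g = (c, e)" by (cases g)
    have f: "f \<in> carrier F'.HN" and fd: "\<And>i. f ` FG' i \<subseteq> NG (i + c, e)" using that by (auto simp: hom_comp_def g)
    have "compose (carrier F) f d ` FG i \<subseteq> NG (i + c, e)" for i
    proof
      fix y assume "y \<in> compose (carrier F) f d ` FG i"
      then obtain u where u: "u \<in> FG i" "y = f (d u)" using F.F.comp_carrier by (auto simp: compose_def)
      then have "d u \<in> FG' i" using d_degree by blast
      then show "y \<in> NG (i + c, e)" using fd u(2) by blast
    qed
    then show ?thesis using closed[OF f] by (simp add: hom_comp_def g)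
  qed
qed

end

section \<open>Tor and Ext\<close>

lemma graded_free_finE:
  assumes "graded_free_fin (polyS n) (polyS_comp n) F FG"
  obtains B dg where "graded_basis n F FG B dg"
proof -
  obtain B where B: "graded_module (polyS n) F (polyS_comp n) FG" "finite B" "B \<subseteq> (\<Union>g. FG g)"
    "\<forall>x\<in>carrier F. \<exists>!c. c \<in> B \<rightarrow>\<^sub>E carrier (polyS n) \<and> x = (\<Oplus>\<^bsub>F\<^esub>b\<in>B. c b \<odot>\<^bsub>F\<^esub> b)"
    using assms unfolding graded_free_fin_def by (elim conjE exE) (rule that)
  have "\<forall>b\<in>B. \<exists>g. b \<in> FG g" using B(3) by blast
  then obtain dg where "\<And>b. b \<in> B \<Longrightarrow> b \<in> FG (dg b)" by metis
  then have "graded_basis n F FG B dg"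
    using B(1,2) bspec[OF B(4)] by (intro graded_basis.intro graded_basis_axioms.intro)
  then show thesis by (rule that)
qed

lemma (in fg_bigraded) strand_properties:
  "(\<forall>k. graded_module (polyS n) (strand L LG k) (polyS_comp n) (\<lambda>j. LG (j, k)) \<and> fin_gen (polyS n) (strand L LG k))
   \<and> (\<exists>\<delta>. \<forall>\<^sub>F k in at_top. module_dim (polyS n) (strand L LG k) = \<delta>)"
  using strand_graded strand_fin_gen strand_dim_eventually_constant by blast

text \<open>Homogeneous bases chosen in all degrees of the resolution at once.\<close>

lemma resolution_free_tensor:
  assumes N: "fg_bigraded n m p N NG"
    and resolution: "graded_free_resolution (polyS n) (polyS_comp n) M MG F FG d eps"
  obtains B dg where "\<And>i. free_tensor n m p (F i) (FG i) (B i) (dg i) N NG"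
    and "\<And>i. free_differential n m p (F (Suc i)) (FG (Suc i)) (B (Suc i)) (dg (Suc i))
      (F i) (FG i) (B i) (dg i) N NG (d i)"
proof -
  interpret res: graded_free_resolution "polyS n" "polyS_comp n" M MG F FG d eps by (rule resolution)
  have "\<forall>i. \<exists>B dg. graded_basis n (F i) (FG i) B dg"
    using graded_free_finE[OF res.free] by metis
  then obtain B dg where basis: "\<And>i. graded_basis n (F i) (FG i) (B i) (dg i)" by metis
  have free: "free_tensor n m p (F i) (FG i) (B i) (dg i) N NG" for i
    by (intro free_tensor.intro basis N)
  show thesis
    by (rule that[OF free])
      (intro free_differential.intro free_differential_axioms.intro free res.d_linear res.d_degree)
qed

theorem fg_bigraded_Tor:
  assumes N: "fg_bigraded n m p N NG"
    and resolution: "graded_free_resolution (polyS n) (polyS_comp n) M MG F FG d eps"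
  shows "fg_bigraded n m p (Tor (polyS n) F d N i) (Tor_comp (polyS n) F FG d N NG i)"
proof -
  obtain B dg where free: "\<And>i. free_tensor n m p (F i) (FG i) (B i) (dg i) N NG"
    and diff: "\<And>i. free_differential n m p (F (Suc i)) (FG (Suc i)) (B (Suc i)) (dg (Suc i))
      (F i) (FG i) (B i) (dg i) N NG (d i)"
    by (rule resolution_free_tensor[OF assms]) (rule that)
  note d = free_differential.bigraded_map_tensor[OF diff]
  let ?T = "tensor (polyS n) (F i) N"
  interpret T: fg_bigraded n m p ?T "tensor_comp (polyS n) (F i) (FG i) N NG"
    by (rule free_tensor.fg_bigraded_tensor[OF free])
  let ?Z = "Tor_cycles (polyS n) F d N i"
  have Z: "submodule ?Z (polyA n m) ?T"
    using T.carrier_is_submodule bigraded_map.kernel_submodule[OF d]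
    by (cases i) (auto simp: Tor_cycles_def)
  have Z_comp: "T.component x g \<in> ?Z" if "x \<in> ?Z" for x g
    using that T.component_closed bigraded_map.kernel_component[OF d]
    by (cases i) (auto simp: Tor_cycles_def)
  show ?thesis
    using T.fg_bigraded_subquotient[OF Z Z_comp bigraded_map.image_submodule[OF d] bigraded_map.image_component[OF d]]
    by (simp add: Tor_def Tor_comp_def[abs_def] Tor_boundaries_def)
qed

theorem fg_bigraded_Ext:
  assumes N: "fg_bigraded n m p N NG"
    and resolution: "graded_free_resolution (polyS n) (polyS_comp n) M MG F FG d eps"
  shows "fg_bigraded n m p (Ext (polyS n) F d N i) (Ext_comp (polyS n) F FG d N NG i)"
proof -
  obtain B dg where free: "\<And>i. free_tensor n m p (F i) (FG i) (B i) (dg i) N NG"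
    and diff: "\<And>i. free_differential n m p (F (Suc i)) (FG (Suc i)) (B (Suc i)) (dg (Suc i))
      (F i) (FG i) (B i) (dg i) N NG (d i)"
    by (rule resolution_free_tensor[OF assms]) (rule that)
  note d = free_differential.bigraded_map_hom[OF diff]
  let ?H = "hom_module (polyS n) (F i) N"
  interpret H: fg_bigraded n m p ?H "hom_comp (polyS n) (F i) (FG i) N NG"
    by (rule free_tensor.fg_bigraded_hom[OF free])
  let ?B = "Ext_coboundaries (polyS n) F d N i"
  have "submodule {\<zero>\<^bsub>?H\<^esub>} (polyA n m) ?H" by (rule H.submoduleI) (auto simp del: hom_module_sel)
  then have B: "submodule ?B (polyA n m) ?H"
    using bigraded_map.image_submodule[OF d]
    by (cases i) (auto simp: Ext_coboundaries_def simp del: hom_module_sel)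
  have B_comp: "H.component x g \<in> ?B" if "x \<in> ?B" for x g
    using that H.component_zero bigraded_map.image_component[OF d]
    by (cases i) (auto simp: Ext_coboundaries_def simp del: hom_module_sel)
  show ?thesis
    using H.fg_bigraded_subquotient[OF bigraded_map.kernel_submodule[OF d] bigraded_map.kernel_component[OF d] B B_comp]
    by (simp add: Ext_def Ext_comp_def[abs_def] Ext_cocycles_def del: hom_module_sel)
qed

theorem corollary3p2:
  fixes n m :: nat and p :: "nat \<Rightarrow> nat"
    and M :: "(('k::field) mpoly, 'm) module" and MG :: "int \<Rightarrow> 'm set"
    and N :: "('k mpoly, 'n) module" and NG :: "int \<times> int \<Rightarrow> 'n set"
    and F :: "nat \<Rightarrow> ('k mpoly, 'f) module" and FG :: "nat \<Rightarrow> int \<Rightarrow> 'f set"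
    and d :: "nat \<Rightarrow> 'f \<Rightarrow> 'f" and eps :: "'f \<Rightarrow> 'm"
  assumes M_graded: "graded_module (polyS n) M (polyS_comp n) MG"
    and M_fin_gen: "fin_gen (polyS n) M"
    and N_bigraded: "graded_module (polyA n m) N (polyA_comp n m p) NG"
    and N_fin_gen: "fin_gen (polyA n m) N"
    and resolution: "graded_free_resolution (polyS n) (polyS_comp n) M MG F FG d eps"
  shows "\<forall>i.
     (\<forall>k. graded_module (polyS n)
            (strand (Tor (polyS n) F d N i) (Tor_comp (polyS n) F FG d N NG i) k)
            (polyS_comp n) (\<lambda>j. Tor_comp (polyS n) F FG d N NG i (j, k))
        \<and> fin_gen (polyS n)
            (strand (Tor (polyS n) F d N i) (Tor_comp (polyS n) F FG d N NG i) k))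
   \<and> (\<exists>\<delta>. \<forall>\<^sub>F k in at_top. module_dim (polyS n)
            (strand (Tor (polyS n) F d N i) (Tor_comp (polyS n) F FG d N NG i) k) = \<delta>)
   \<and> (\<forall>k. graded_module (polyS n)
            (strand (Ext (polyS n) F d N i) (Ext_comp (polyS n) F FG d N NG i) k)
            (polyS_comp n) (\<lambda>j. Ext_comp (polyS n) F FG d N NG i (j, k))
        \<and> fin_gen (polyS n)
            (strand (Ext (polyS n) F d N i) (Ext_comp (polyS n) F FG d N NG i) k))
   \<and> (\<exists>\<delta>. \<forall>\<^sub>F k in at_top. module_dim (polyS n)
            (strand (Ext (polyS n) F d N i) (Ext_comp (polyS n) F FG d N NG i) k) = \<delta>)"
proof -
  have N: "fg_bigraded n m p N NG"
    using N_bigraded N_fin_gen by (intro fg_bigraded.intro fg_bigraded_axioms.intro)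
  note tor = fg_bigraded.strand_properties[OF fg_bigraded_Tor[OF N resolution]]
    and ext = fg_bigraded.strand_properties[OF fg_bigraded_Ext[OF N resolution]]
  show ?thesis
    using tor ext by blast
qed

end
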